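(* Let $\mathcal{M}=(M_k)_{k\ge 0}$ be a regular sequence. Let $\Omega=\Omega'\times I\subset\mathbb{R}^N\times\mathbb{R}$ be an open neighborhood of the origin, with $\Omega'\subset\mathbb{R}^N$ open and $I\subset\mathbb{R}$ an open interval. Let $f(x,t,\zeta_0,\zeta)$ be a function of class $\mathcal{C}^{\mathcal{M}}$ with respect to $(x,t)\in\Omega$ and holomorphic with respect to $(\zeta_0,\zeta)\in\mathbb{C}\times\mathbb{C}^N$, and let $u\in\mathcal{C}^2(\Omega)$ (complex valued) be a solution of the nonlinear PDE $$u_t=f(x,t,u,u_x)\quad\text{in }\Omega .$$ Then $$\mathrm{WF}_{\mathcal{M}}(u)\subset\mathrm{Char}(L^u),$$ where $L^u$ is the linearized operator $$L^u=\frac{\partial}{\partial t}-\sum_{j=1}^N\frac{\partial f}{\partial\zeta_j}(x,t,u(x,t),u_x(x,t))\frac{\partial}{\partial x_j}.$$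
   Context: Regular sequence: a sequence $\mathcal{M}=(M_k)_{k\ge0}$ of positive reals such that, with $m_k=M_k/k!$: (a) $m_0=m_1=1$; (b) $m_k^2\le m_{k-1}m_{k+1}$ for $k\ge1$; (c) $\sup_{k\ge 1}(m_{k+1}/m_k)^{1/k}<\infty$; (d) $\lim_{k\to\infty}m_k^{1/k}=\infty$. For $W\subset\mathbb{R}^n$ open, $\mathcal{C}^{\mathcal{M}}(W)$ is the set of $\mathcal{C}^\infty$ functions $g$ on $W$ such that for each compact $K\subset W$ there is $A>0$ with $\sup_K|D^\alpha g|\le A^{|\alpha|+1}M_{|\alpha|}$ for all $\alpha\in\mathbb{Z}_+^n$. A function on $W\times W''$, with $W''$ open in $\mathbb{C}^m$, is of class $\mathcal{C}^{\mathcal{M}}$ in the real variables $y\in W$ and holomorphic in $\zeta\in W''$ if it is $\mathcal{C}^\infty$, holomorphic in $\zeta$, and for each compact $K\subset W\times W''$ there is $A>0$ with $\sup_K|\partial_y^\alpha g|\le A^{|\alpha|+1}M_{|\alpha|}$ for all $\alpha$. FBI transform: for a compactly supported distribution $v$ on $\mathbb{R}^n$, $\mathcal{F}[v](y,\eta)=v_{y'}\big(e^{i(y-y')\cdot\eta-|\eta|(y-y')^2}\big)$, where $(y-y')^2=\sum_j(y_j-y_j')^2$. Denjoy-Carleman wave-front set: let $v$ be a distribution on an open set $W\subset\mathbb{R}^n$, $y_0\in W$, $\eta_0\in\mathbb{R}^n\setminus\{0\}$. The direction $\eta_0$ is $\mathcal{C}^{\mathcal{M}}$-regular for $v$ at $y_0$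 if there are $\chi\in\mathcal{C}^\infty_c(W)$ with $\chi=1$ near $y_0$, a neighborhood $V$ of $y_0$, an open cone $\Gamma\subset\mathbb{R}^n\setminus\{0\}$ containing $\eta_0$, and $A>0$ with $|\mathcal{F}[\chi v](y,\eta)|\le A^{k+1}M_k/|\eta|^k$ for all $k\in\mathbb{Z}_+$, $(y,\eta)\in V\times\Gamma$. $\mathrm{WF}_{\mathcal{M}}(v)\subset W\times(\mathbb{R}^n\setminus\{0\})$ is the set of $(y_0,\eta_0)$ such that $\eta_0$ is not $\mathcal{C}^{\mathcal{M}}$-regular for $v$ at $y_0$. Here $\mathrm{WF}_{\mathcal{M}}(u)$ is taken with $W=\Omega\subset\mathbb{R}^{N+1}$. $\mathrm{Char}(L^u)$ is the set of $(x,t;\xi,\tau)\in\Omega\times(\mathbb{R}^{N+1}\setminus\{0\})$ with $\tau-\sum_{j=1}^N\frac{\partial f}{\partial\zeta_j}(x,t,u(x,t),u_x(x,t))\,\xi_j=0$. *)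

theory Defs
  imports "HOL-Analysis.Analysis"
begin

section \<open>Regular sequences\<close>

definition regular_sequence :: "(nat \<Rightarrow> real) \<Rightarrow> bool" where
  "regular_sequence M \<longleftrightarrow>
     (let m = (\<lambda>k. M k / fact k) in
        (\<forall>k. M k > 0) \<and>
        m 0 = 1 \<and> m 1 = 1 \<and>
        (\<forall>k\<ge>1. (m k)\<^sup>2 \<le> m (k - 1) * m (k + 1)) \<and>
        bdd_above ((\<lambda>k. root k (m (k + 1) / m k)) ` {1..}) \<and>
        filterlim (\<lambda>k. root k (m k)) at_top sequentially)"

section \<open>Derivatives and smoothness\<close>

definition partial_deriv ::
    "'a::euclidean_space \<Rightarrow> ('a \<Rightarrow> 'b::real_normed_vector) \<Rightarrow> 'a \<Rightarrow> 'b" where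
  "partial_deriv b g x = frechet_derivative g (at x) b"

text \<open>
  A multi-index of order \<open>k\<close> is encoded as a list of \<open>k\<close> vectors from \<open>Basis\<close> (which
  enumerates the coordinate variables to differentiate by). Different orderings of the
  same list give the same derivative of a smooth function, so quantifying over all lists
  over \<open>Basis\<close> is quantifying over all multi-indices, the length being the order.
\<close>

fun iter_deriv ::
    "'a::euclidean_space list \<Rightarrow> ('a \<Rightarrow> 'b::real_normed_vector) \<Rightarrow> 'a \<Rightarrow> 'b" where
  "iter_deriv [] g = g"
| "iter_deriv (b # bs) g = partial_deriv b (iter_deriv bs g)"

text \<open>\<open>Ck_on k g W\<close> is meant for open \<open>W\<close>; values of \<open>g\<close> outside \<open>W\<close> are irrelevant then.\<close>

fun Ck_on :: "nat \<Rightarrow> ('a::euclidean_space \<Rightarrow> 'b::real_normed_vector) \<Rightarrow> 'a set \<Rightarrow> bool" where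
  "Ck_on 0 g W \<longleftrightarrow> continuous_on W g"
| "Ck_on (Suc k) g W \<longleftrightarrow>
     (\<forall>x\<in>W. g differentiable (at x)) \<and> (\<forall>b\<in>Basis. Ck_on k (partial_deriv b g) W)"

definition smooth_on :: "('a::euclidean_space \<Rightarrow> 'b::real_normed_vector) \<Rightarrow> 'a set \<Rightarrow> bool" where
  "smooth_on g W \<longleftrightarrow> (\<forall>k. Ck_on k g W)"

section \<open>Denjoy-Carleman classes with holomorphic parameters\<close>

definition vec_upd :: "(complex ^ 'm) \<Rightarrow> 'm \<Rightarrow> complex \<Rightarrow> complex ^ 'm" where
  "vec_upd z j w = (\<chi> i. if i = j then w else z $ i)"

text \<open>
  The complex parameter is \<open>(\<zeta>\<^sub>0, \<zeta>)\<close>, ranging over an open subset of \<open>\<complex> \<times> \<complex>\<^sup>m\<close>.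
  Holomorphy is complex differentiability in each of the variables \<open>\<zeta>\<^sub>0, \<zeta>\<^sub>1, \<dots>, \<zeta>\<^sub>m\<close>; it is
  only used together with joint smoothness.
\<close>

definition holomorphic_at_params :: "(complex \<times> (complex ^ 'm) \<Rightarrow> complex) \<Rightarrow> complex \<times> (complex ^ 'm) \<Rightarrow> bool" where
  "holomorphic_at_params h z \<longleftrightarrow>
     (\<lambda>w. h (w, snd z)) field_differentiable (at (fst z)) \<and>
     (\<forall>j. (\<lambda>w. h (fst z, vec_upd (snd z) j w)) field_differentiable (at (snd z $ j)))"

definition CM_holomorphic ::
    "(nat \<Rightarrow> real) \<Rightarrow> ('a::euclidean_space \<times> (complex \<times> (complex ^ 'm)) \<Rightarrow> complex) \<Rightarrow>
     'a set \<Rightarrow> (complex \<times> (complex ^ 'm)) set \<Rightarrow> bool" where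
  "CM_holomorphic M g W W'' \<longleftrightarrow>
     smooth_on g (W \<times> W'') \<and>
     (\<forall>y\<in>W. \<forall>z\<in>W''. holomorphic_at_params (\<lambda>z. g (y, z)) z) \<and>
     (\<forall>K. compact K \<longrightarrow> K \<subseteq> W \<times> W'' \<longrightarrow>
        (\<exists>A>0. \<forall>bs. set bs \<subseteq> Basis \<longrightarrow>
           (\<forall>(y, z)\<in>K. norm (iter_deriv bs (\<lambda>y. g (y, z)) y) \<le> A ^ (length bs + 1) * M (length bs))))"

section \<open>Distributions\<close>

definition supp :: "('a::topological_space \<Rightarrow> 'b::zero) \<Rightarrow> 'a set" where
  "supp \<phi> = closure {x. \<phi> x \<noteq> 0}"

text \<open>Test functions on \<open>W\<close> are functions on the whole space that vanish outside a compact
  subset of \<open>W\<close>.\<close>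

definition test_functions :: "'a::euclidean_space set \<Rightarrow> ('a \<Rightarrow> complex) set" where
  "test_functions W = {\<phi>. smooth_on \<phi> UNIV \<and> compact (supp \<phi>) \<and> supp \<phi> \<subseteq> W}"

definition distribution_on ::
    "'a::euclidean_space set \<Rightarrow> (('a \<Rightarrow> complex) \<Rightarrow> complex) \<Rightarrow> bool" where
  "distribution_on W v \<longleftrightarrow>
     (\<forall>\<phi>\<in>test_functions W. \<forall>\<psi>\<in>test_functions W. v (\<lambda>x. \<phi> x + \<psi> x) = v \<phi> + v \<psi>) \<and>
     (\<forall>\<phi>\<in>test_functions W. \<forall>c. v (\<lambda>x. c * \<phi> x) = c * v \<phi>) \<and>
     (\<forall>K. compact K \<longrightarrow> K \<subseteq> W \<longrightarrow>
        (\<exists>C\<ge>0. \<exists>k. \<forall>\<phi>\<in>test_functions W. \<forall>B. supp \<phi> \<subseteq> K \<longrightarrow>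
           (\<forall>bs x. set bs \<subseteq> Basis \<longrightarrow> length bs \<le> k \<longrightarrow> norm (iter_deriv bs \<phi> x) \<le> B) \<longrightarrow>
           norm (v \<phi>) \<le> C * B))"

definition distr_of_fun ::
    "'a::euclidean_space set \<Rightarrow> ('a \<Rightarrow> complex) \<Rightarrow> ('a \<Rightarrow> complex) \<Rightarrow> complex" where
  "distr_of_fun W u \<phi> = (LINT x:W|lborel. u x * \<phi> x)"

lemma set_integrable_mult_test_function:
  fixes u :: "'a::euclidean_space \<Rightarrow> complex"
  assumes u: "continuous_on W u" and \<phi>: "\<phi> \<in> test_functions W"
  shows "set_integrable lborel W (\<lambda>x. u x * \<phi> x)"
proof -
  have K: "compact (supp \<phi>)" "supp \<phi> \<subseteq> W" and c: "continuous_on UNIV \<phi>"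
    using \<phi> by (auto simp: test_functions_def smooth_on_def dest: spec[of _ 0])
  have z: "\<phi> x = 0" if "x \<notin> supp \<phi>" for x
    using that closure_subset[of "{x. \<phi> x \<noteq> 0}"] by (auto simp: supp_def)
  have "continuous_on (supp \<phi>) (\<lambda>x. u x * \<phi> x)"
    by (intro continuous_intros continuous_on_subset[OF u K(2)] continuous_on_subset[OF c]) auto
  hence "integrable lborel (\<lambda>x. indicator (supp \<phi>) x *\<^sub>R (u x * \<phi> x))"
    using K(1) borel_integrable_compact by blast
  moreover have "(\<lambda>x. indicator (supp \<phi>) x *\<^sub>R (u x * \<phi> x)) = (\<lambda>x. indicator W x *\<^sub>R (u x * \<phi> x))"
    using K(2) z by (auto simp: indicator_def fun_eq_iff)
  ultimately show ?thesis by (simp add: set_integrable_def)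
qed

lemma distribution_on_distr_of_fun:
  fixes u :: "'a::euclidean_space \<Rightarrow> complex"
  assumes u: "continuous_on W u"
  shows "distribution_on W (distr_of_fun W u)"
  unfolding distribution_on_def
proof (intro conjI ballI allI impI)
  fix \<phi> \<psi> assume "\<phi> \<in> test_functions W" "\<psi> \<in> test_functions W"
  thus "distr_of_fun W u (\<lambda>x. \<phi> x + \<psi> x) = distr_of_fun W u \<phi> + distr_of_fun W u \<psi>"
    using set_integrable_mult_test_function[OF u]
    by (simp add: distr_of_fun_def distrib_left set_integral_add)
next
  fix \<phi> and c :: complex
  have "(LINT x:W|lborel. u x * (c * \<phi> x)) = (LINT x:W|lborel. c * (u x * \<phi> x))"
    by (simp add: mult.left_commute)
  thus "distr_of_fun W u (\<lambda>x. c * \<phi> x) = c * distr_of_fun W u \<phi>"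
    by (simp add: distr_of_fun_def)
next
  fix K assume K: "compact K" "K \<subseteq> W"
  define h where "h = (\<lambda>x. indicator K x *\<^sub>R norm (u x))"
  have h: "integrable lborel h" unfolding h_def
    by (intro borel_integrable_compact K continuous_intros continuous_on_subset[OF u K(2)])
  show "\<exists>C\<ge>0. \<exists>k. \<forall>\<phi>\<in>test_functions W. \<forall>B. supp \<phi> \<subseteq> K \<longrightarrow>
           (\<forall>bs x. set bs \<subseteq> Basis \<longrightarrow> length bs \<le> k \<longrightarrow> norm (iter_deriv bs \<phi> x) \<le> B) \<longrightarrow>
           norm (distr_of_fun W u \<phi>) \<le> C * B"
  proof (intro exI[of _ "integral\<^sup>L lborel h"] conjI exI[of _ 0] ballI allI impI)
    show "0 \<le> integral\<^sup>L lborel h"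
      by (rule Bochner_Integration.integral_nonneg) (auto simp: h_def)
  next
    fix \<phi> B
    assume \<phi>: "\<phi> \<in> test_functions W" "supp \<phi> \<subseteq> K"
      and "\<forall>bs x. set bs \<subseteq> Basis \<longrightarrow> length bs \<le> 0 \<longrightarrow> norm (iter_deriv bs \<phi> x) \<le> B"
    hence B: "norm (\<phi> x) \<le> B" for x by simp
    hence B0: "0 \<le> B" using norm_ge_zero order_trans by blast
    have z: "\<phi> x = 0" if "x \<notin> K" for x
      using that \<phi>(2) closure_subset[of "{x. \<phi> x \<noteq> 0}"] by (auto simp: supp_def)
    have "norm (indicator W x *\<^sub>R (u x * \<phi> x)) \<le> h x * B" for x
      using B[of x] B0 z[of x] by (auto simp: h_def indicator_def norm_mult mult_left_mono)
    moreover have "integrable lborel (\<lambda>x. indicator W x *\<^sub>R (u x * \<phi> x))"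
      using set_integrable_mult_test_function[OF u \<phi>(1)] by (simp add: set_integrable_def)
    ultimately have "norm (distr_of_fun W u \<phi>) \<le> integral\<^sup>L lborel (\<lambda>x. h x * B)"
      unfolding distr_of_fun_def set_lebesgue_integral_def
      using Bochner_Integration.integral_norm_bound_integral h by blast
    thus "norm (distr_of_fun W u \<phi>) \<le> integral\<^sup>L lborel h * B" by simp
  qed
qed

section \<open>FBI transform and wave-front set\<close>

text \<open>A compactly supported distribution is regarded as a functional on all smooth functions on
  the space. In particular, for \<open>\<theta> \<in> test_functions W\<close> and a distribution \<open>v\<close> on \<open>W\<close>, the product
  \<open>\<theta> v\<close> is \<open>\<phi> \<mapsto> v (\<theta> \<phi>)\<close> for arbitrary smooth \<open>\<phi>\<close>, as \<open>\<theta> \<phi>\<close> is again a test function on \<open>W\<close>.\<close>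

definition mult_distr ::
    "('a \<Rightarrow> complex) \<Rightarrow> (('a \<Rightarrow> complex) \<Rightarrow> complex) \<Rightarrow> ('a \<Rightarrow> complex) \<Rightarrow> complex" where
  "mult_distr \<theta> v \<phi> = v (\<lambda>x. \<theta> x * \<phi> x)"

definition fbi ::
    "(('a::euclidean_space \<Rightarrow> complex) \<Rightarrow> complex) \<Rightarrow> 'a \<Rightarrow> 'a \<Rightarrow> complex" where
  "fbi v y \<eta> =
     v (\<lambda>y'. exp (\<i> * of_real ((y - y') \<bullet> \<eta>) - of_real (norm \<eta> * ((y - y') \<bullet> (y - y')))))"

definition open_cone :: "'a::euclidean_space set \<Rightarrow> bool" where
  "open_cone \<Gamma> \<longleftrightarrow> open \<Gamma> \<and> 0 \<notin> \<Gamma> \<and> (\<forall>\<eta>\<in>\<Gamma>. \<forall>c>0. c *\<^sub>R \<eta> \<in> \<Gamma>)"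

definition CM_regular_direction ::
    "(nat \<Rightarrow> real) \<Rightarrow> 'a::euclidean_space set \<Rightarrow> (('a \<Rightarrow> complex) \<Rightarrow> complex) \<Rightarrow> 'a \<Rightarrow> 'a \<Rightarrow> bool" where
  "CM_regular_direction M W v y0 \<eta>0 \<longleftrightarrow>
     (\<exists>\<theta>\<in>test_functions W. (\<forall>\<^sub>F x in nhds y0. \<theta> x = 1) \<and>
       (\<exists>V \<Gamma>. open V \<and> y0 \<in> V \<and> open_cone \<Gamma> \<and> \<eta>0 \<in> \<Gamma> \<and>
         (\<exists>A>0. \<forall>k. \<forall>y\<in>V. \<forall>\<eta>\<in>\<Gamma>.
            norm (fbi (mult_distr \<theta> v) y \<eta>) \<le> A ^ (k + 1) * M k / norm \<eta> ^ k)))"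

definition WF :: "(nat \<Rightarrow> real) \<Rightarrow> 'a::euclidean_space set \<Rightarrow>
    (('a \<Rightarrow> complex) \<Rightarrow> complex) \<Rightarrow> ('a \<times> 'a) set" where
  "WF M W v = {(y0, \<eta>0). y0 \<in> W \<and> \<eta>0 \<noteq> 0 \<and> \<not> CM_regular_direction M W v y0 \<eta>0}"

section \<open>The nonlinear equation and its linearization\<close>

text \<open>Points of \<open>\<real>\<^sup>N\<^sup>+\<^sup>1\<close> are pairs \<open>(x, t)\<close>, covectors are pairs \<open>(\<xi>, \<tau>)\<close>.\<close>

definition t_deriv :: "((real ^ 'n) \<times> real \<Rightarrow> complex) \<Rightarrow> (real ^ 'n) \<times> real \<Rightarrow> complex" where
  "t_deriv u p = partial_deriv (0, 1) u p"

definition x_grad :: "((real ^ 'n) \<times> real \<Rightarrow> complex) \<Rightarrow> (real ^ 'n) \<times> real \<Rightarrow> complex ^ 'n" where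
  "x_grad u p = (\<chi> j. partial_deriv (axis j 1, 0) u p)"

definition zeta_deriv ::
    "'n \<Rightarrow> ('p \<times> (complex \<times> (complex ^ 'n)) \<Rightarrow> complex) \<Rightarrow> 'p \<times> (complex \<times> (complex ^ 'n)) \<Rightarrow> complex" where
  "zeta_deriv j f = (\<lambda>(p, z0, z). deriv (\<lambda>w. f (p, z0, vec_upd z j w)) (z $ j))"

definition Char_linearized ::
    "((real ^ 'n) \<times> real) set \<Rightarrow> (((real ^ 'n) \<times> real) \<times> (complex \<times> (complex ^ 'n)) \<Rightarrow> complex) \<Rightarrow>
     ((real ^ 'n) \<times> real \<Rightarrow> complex) \<Rightarrow> (((real ^ 'n) \<times> real) \<times> ((real ^ 'n) \<times> real)) set" where
  "Char_linearized \<Omega> f u =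
     {(p, (\<xi>, \<tau>)). p \<in> \<Omega> \<and> (\<xi>, \<tau>) \<noteq> 0 \<and>
        complex_of_real \<tau> - (\<Sum>j\<in>UNIV. zeta_deriv j f (p, u p, x_grad u p) * complex_of_real (\<xi> $ j)) = 0}"

end

theory Submission
  imports Defs "HOL-Complex_Analysis.Cauchy_Integral_Formula"
begin

text \<open>
  Write \<open>L = L\<^sup>u = \<Sum>\<^sub>b \<beta>\<^sub>b \<partial>\<^sub>b\<close> and \<open>e\<^sup>Q\<close> for the FBI kernel as a function of \<open>y'\<close>, so that
  \<open>L e\<^sup>Q = |\<eta>| q e\<^sup>Q\<close> with \<open>q\<close> bounded away from \<open>0\<close> near a non-characteristic point. For a
  cutoff \<open>\<theta>\<close> put \<open>I \<Phi> = \<integral> \<Phi> \<theta> e\<^sup>Q\<close>. Integration by parts gives \<open>|\<eta>| I \<Phi> = I (P \<Phi>) - J \<Phi>\<close> with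
  \<open>P \<Phi> = - (L (\<Phi>/q) + (div \<beta>) \<Phi>/q)\<close>, where \<open>J \<Phi>\<close> contains \<open>L \<theta>\<close> and is exponentially small.

  The coefficients of \<open>L\<close> are only \<open>C\<^sup>1\<close>, so \<open>P\<close> cannot be iterated on functions of \<open>y'\<close>. However,
  because \<open>f\<close> is holomorphic in \<open>\<zeta>\<close>, the operator \<open>L\<close> acts on functions of \<open>(y', u, u\<^sub>x, u\<^sub>x\<^sub>x, 1/q)\<close>
  as a first-order operator whose coefficients are of class \<open>C\<^sup>M\<close> in these variables: this is the
  differentiated equation, which for \<open>u\<^sub>x\<^sub>x\<close> holds in the sense of uniform limits of \<open>C\<^sup>1\<close>
  functions. Hence \<open>k\<close> iterations starting from \<open>u\<close> cost \<open>k\<close> derivatives of functions of class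
  \<open>C\<^sup>M\<close> and gain \<open>|\<eta>|\<^sup>-\<^sup>k\<close>, which is the bound \<open>A\<^sup>k\<^sup>+\<^sup>1 M\<^sub>k / |\<eta>|\<^sup>k\<close>.
\<close>


section \<open>Weight sequences\<close>

text \<open>Iterating on functions of the enlarged variables would require a domain for these
  variables and estimates on it. Jets avoid this: only derivatives at points of the graph are
  recorded, P becomes an algebraic operation on these lists, and its iterates are controlled by the
  Leibniz rule alone. The link back to functions of \<open>y'\<close> is \<open>jcompat\<close>, the
  chain rule along L for every entry of a jet; it asks only that each variable have an L-derivative
  in a sense that is stable under sums and products. Making 1/q a variable of its own keeps
  everything polynomial in it: L(1/q) = -(1/q)^2 Lq, so the only estimate on reciprocals is a lower
  bound for |q|. The list of variables closes up because L u and L u_x have no second derivatives of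
  u on the right, and one more differentiation brings these in at most quadratically. The constants
  must not deteriorate with the number of steps: in every product the coefficient grows at most half
  as fast as the iterate, which makes the Leibniz sum geometric.\<close>

lemma regular_sequence_pos: "regular_sequence M \<Longrightarrow> 0 < M k"
  by (auto simp: regular_sequence_def Let_def)

lemma regular_sequence_0: "regular_sequence M \<Longrightarrow> M 0 = 1"
  by (auto simp: regular_sequence_def Let_def)

text \<open>Condition (b), log-convexity, compares two consecutive ratios; induction chains the
  comparisons.\<close>

lemma regular_sequence_ratio_mono:
  assumes "regular_sequence M" and "j \<le> k"
  defines "m \<equiv> \<lambda>k. M k / fact k"
  shows "m (Suc j) / m j \<le> m (Suc k) / m k"
  using assms(2)
proof (induction k rule: dec_induct)
  case (step k)
  have pos: "m i > 0" for i
    using regular_sequence_pos[OF assms(1)] by (simp add: m_def)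
  have "\<forall>k\<ge>1. (m k)\<^sup>2 \<le> m (k - 1) * m (k + 1)"
    using assms(1) by (auto simp: regular_sequence_def Let_def m_def)
  from this[rule_format, of "Suc k"] have "m (Suc k) * m (Suc k) \<le> m (Suc (Suc k)) * m k"
    by (simp add: power2_eq_square mult.commute)
  hence "m (Suc k) / m k \<le> m (Suc (Suc k)) / m (Suc k)"
    using pos[of k] pos[of "Suc k"] by (simp add: field_simps)
  with step.IH show ?case by linarith
qed simp

text \<open>Since m_0 = 1, \<open>m l\<close> is the product of the first l ratios. Shifting these
  ratios by j can only increase them, and the shifted product is m_(l+j) / m_j.\<close>

lemma regular_sequence_supermult:
  assumes "regular_sequence M"
  shows "(M l / fact l) * (M j / fact j) \<le> M (l + j) / fact (l + j)"
proof -
  define m where "m = (\<lambda>k. M k / fact k)"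
  have pos: "m i > 0" for i
    using regular_sequence_pos[OF assms] by (simp add: m_def)
  have "m l * m j \<le> m (l + j)"
  proof (induction l)
    case 0
    thus ?case using regular_sequence_0[OF assms] by (simp add: m_def)
  next
    case (Suc l)
    have "m (Suc l) * m j = (m l * m j) * (m (Suc l) / m l)"
      using pos[of l] by (simp add: field_simps)
    also have "\<dots> \<le> m (l + j) * (m (Suc (l + j)) / m (l + j))"
      using Suc regular_sequence_ratio_mono[OF assms, of l "l + j"]
        less_imp_le[OF pos[of "l + j"]] less_imp_le[OF pos[of "Suc l"]] less_imp_le[OF pos[of l]]
      by (intro mult_mono) (simp_all only: m_def divide_nonneg_nonneg le_add1)
    also have "\<dots> = m (Suc l + j)" using pos[of "l + j"] by simp
    finally show ?case .
  qed
  thus ?thesis by (simp add: m_def)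
qed

text \<open>The form needed in Leibniz sums: the binomial coefficient counts only the a derivatives
  being distributed, while the weight index K also counts those spent in earlier steps.\<close>

lemma regular_sequence_mult_le:
  assumes "regular_sequence M" "l \<le> a" "a \<le> K"
  shows "real (a choose l) * (M l * M (K - l)) \<le> M K"
proof -
  have pos: "0 < M i" for i by (rule regular_sequence_pos[OF assms(1)])
  have "real (a choose l) * (M l * M (K - l)) \<le> real (K choose l) * (M l * M (K - l))"
    using binomial_right_mono[OF assms(3), of l] pos[of l] pos[of "K - l"]
    by (intro mult_right_mono) auto
  also have "\<dots> = fact K * ((M l / fact l) * (M (K - l) / fact (K - l)))"
    using binomial_fact[of l K, where 'a=real] assms by simp
  also have "\<dots> \<le> fact K * (M K / fact K)"
    using regular_sequence_supermult[OF assms(1), of l "K - l"] assms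
    by (intro mult_left_mono) auto
  finally show ?thesis by simp
qed

lemma regular_sequence_le_Suc:
  assumes "regular_sequence M"
  shows "M k \<le> M (Suc k)"
proof -
  have m1: "M 1 = 1" using assms by (auto simp: regular_sequence_def Let_def)
  show ?thesis
    using regular_sequence_mult_le[OF assms, of 1 1 "Suc k"] m1 by simp
qed

lemma regular_sequence_mono:
  assumes "regular_sequence M" "j \<le> k"
  shows "M j \<le> M k"
  using assms(2) lift_Suc_mono_le[of M] regular_sequence_le_Suc[OF assms(1)] by blast

lemma regular_sequence_ge_1: "regular_sequence M \<Longrightarrow> 1 \<le> M k"
  using regular_sequence_mono[of M 0 k] by (simp add: regular_sequence_0)

text \<open>Factorials arise from Cauchy's inequality and from trading powers of the frequency for
  exponential decay. They are absorbed because m_l \<ge> 1 and \<open>m\<close> is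
  supermultiplicative.\<close>

lemma regular_sequence_fact_mult_le:
  assumes "regular_sequence M"
  shows "fact l * M j \<le> M (l + j)"
proof -
  have m1: "M 1 = 1" using assms by (auto simp: regular_sequence_def Let_def)
  have "1 \<le> M l / fact l"
  proof (induction l)
    case 0
    thus ?case using regular_sequence_0[OF assms] by simp
  next
    case (Suc l)
    moreover have "M l / fact l \<le> M (Suc l) / fact (Suc l)"
      using regular_sequence_supermult[OF assms, of 1 l] m1 by simp
    ultimately show ?case by linarith
  qed
  hence "M j / fact j \<le> (M l / fact l) * (M j / fact j)"
    using regular_sequence_pos[OF assms, of j] mult_right_mono[of 1 "M l / fact l" "M j / fact j"] by simp
  also have "\<dots> \<le> M (l + j) / fact (l + j)"
    by (rule regular_sequence_supermult[OF assms])
  finally have "M j / fact j \<le> M (l + j) / fact (l + j)" .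
  hence "M j * (fact (l + j) / fact j) \<le> M (l + j)"
    by (simp add: field_simps)
  moreover have "fact l * fact j \<le> (fact (l + j) :: real)"
    using fact_fact_dvd_fact[of l j] by (metis dvd_imp_le fact_gt_zero of_nat_fact of_nat_le_iff of_nat_mult)
  hence "fact l \<le> (fact (l + j) / fact j :: real)"
    by (simp add: field_simps)
  hence "M j * fact l \<le> M j * (fact (l + j) / fact j)"
    using regular_sequence_pos[OF assms, of j] by (intro mult_left_mono) auto
  ultimately show ?thesis by (simp add: mult.commute)
qed

text \<open>This is condition (c), stability of the class under one derivative, rewritten for M
  instead of m.\<close>

lemma regular_sequence_Suc_le:
  assumes "regular_sequence M"
  obtains B where "1 \<le> B" "\<And>k. M (Suc k) \<le> B ^ k * M k"
proof -
  define m where "m = (\<lambda>k. M k / fact k)"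
  have pos: "m i > 0" for i
    using regular_sequence_pos[OF assms] by (simp add: m_def)
  have m1: "M 1 = 1" using assms by (auto simp: regular_sequence_def Let_def)
  have "bdd_above ((\<lambda>k. root k (m (k + 1) / m k)) ` {1..})"
    using assms by (auto simp: regular_sequence_def Let_def m_def)
  then obtain C where C: "\<And>k. 1 \<le> k \<Longrightarrow> root k (m (k + 1) / m k) \<le> C"
    by (auto simp: bdd_above_def)
  \<comment> \<open>The 2 pays for the quotient of factorials, as k + 1 \<le> 2^k; the maximum gives
    1 \<le> B.\<close>
  define B where "B = 2 * max C 1"
  have "M (Suc k) \<le> B ^ k * M k" for k
  proof (cases "k = 0")
    case True
    thus ?thesis using m1 regular_sequence_0[OF assms] by simp
  next
    case False
    have r: "0 \<le> m (k + 1) / m k"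
      using pos[of k] pos[of "k + 1"] by simp
    have "m (k + 1) / m k = root k (m (k + 1) / m k) ^ k"
      using False r real_root_pow_pos2[of k] by simp
    also have "\<dots> \<le> (max C 1) ^ k"
      using C[of k] False r by (intro power_mono) (auto simp: le_max_iff_disj)
    finally have "m (Suc k) \<le> (max C 1) ^ k * m k"
      using pos[of k] by (simp add: field_simps)
    hence "real (Suc k) * fact k * m (Suc k) \<le> real (Suc k) * fact k * ((max C 1) ^ k * m k)"
      by (intro mult_left_mono) auto
    hence "M (Suc k) \<le> real (Suc k) * ((max C 1) ^ k * M k)"
      by (simp add: m_def mult_ac)
    also have "\<dots> \<le> 2 ^ k * ((max C 1) ^ k * M k)"
    proof (intro mult_right_mono)
      have "Suc k \<le> 2 ^ k" by (simp add: Suc_leI less_exp)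
      thus "real (Suc k) \<le> 2 ^ k" by (metis of_nat_le_iff of_nat_numeral of_nat_power)
      show "0 \<le> (max C 1) ^ k * M k"
        using regular_sequence_pos[OF assms, of k] by simp
    qed
    finally show ?thesis by (simp add: B_def power_mult_distrib)
  qed
  moreover have "1 \<le> B" by (simp add: B_def)
  ultimately show ?thesis using that by blast
qed

section \<open>Jets\<close>

text \<open>A jet lists the values, at one point, of all iterated derivatives of a function along
  derivations indexed by letters; in the word \<open>b # w\<close> the derivation \<open>b\<close> is applied first.\<close>

type_synonym 'l jet = "'l list \<Rightarrow> complex"

definition jderiv :: "'l \<Rightarrow> 'l jet \<Rightarrow> 'l jet" where
  "jderiv b F = (\<lambda>w. F (b # w))"

fun jmul :: "'l jet \<Rightarrow> 'l jet \<Rightarrow> 'l jet" where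
  "jmul F G [] = F [] * G []"
| "jmul F G (b # w) = jmul (\<lambda>w. F (b # w)) G w + jmul F (\<lambda>w. G (b # w)) w"

definition jconst :: "complex \<Rightarrow> 'l jet" where
  "jconst z = (\<lambda>w. if w = [] then z else 0)"

definition jcoord :: "'l \<Rightarrow> complex \<Rightarrow> 'l jet" where
  "jcoord l z = (\<lambda>w. if w = [] then z else if w = [l] then 1 else 0)"

lemma jderiv_apply [simp]: "jderiv b F w = F (b # w)"
  by (simp add: jderiv_def)

text \<open>The definition of \<open>jmul\<close> peels off the first letter, the innermost
  derivation. The chain rule adds an outermost one, so the Leibniz rule is also needed at the end of
  the word.\<close>

lemma jmul_snoc:
  "jmul F G (w @ [b]) = jmul (\<lambda>w. F (w @ [b])) G w + jmul F (\<lambda>w. G (w @ [b])) w"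
  by (induction F G w rule: jmul.induct) (simp_all add: algebra_simps)

lemma jmul_sum_left:
  "jmul (\<lambda>w. \<Sum>l\<in>S. c l * F l w) G w = (\<Sum>l\<in>S. c l * jmul (F l) G w)"
  by (induction w arbitrary: F G)
    (simp_all add: sum_distrib_left sum.distrib distrib_left mult_ac)

lemma jmul_sum_right:
  "jmul F (\<lambda>w. \<Sum>l\<in>S. c l * G l w) w = (\<Sum>l\<in>S. c l * jmul F (G l) w)"
  by (induction w arbitrary: F G)
    (simp_all add: sum_distrib_left sum.distrib distrib_left mult_ac)

text \<open>Pascal's rule, arranged as the induction step of the Leibniz estimate below.\<close>

lemma leibniz_sum_Suc:
  fixes f g :: "nat \<Rightarrow> real"
  shows "(\<Sum>l\<le>n. real (n choose l) * (f (Suc l) * g (n - l))) +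
         (\<Sum>l\<le>n. real (n choose l) * (f l * g (Suc (n - l)))) =
         (\<Sum>l\<le>Suc n. real (Suc n choose l) * (f l * g (Suc n - l)))"
proof -
  have "(\<Sum>l\<le>Suc n. real (Suc n choose l) * (f l * g (Suc n - l))) =
      f 0 * g (Suc n) + (\<Sum>l\<le>n. real (Suc n choose Suc l) * (f (Suc l) * g (n - l)))"
    by (subst sum.atMost_Suc_shift) simp
  also have "(\<Sum>l\<le>n. real (Suc n choose Suc l) * (f (Suc l) * g (n - l))) =
     (\<Sum>l\<le>n. real (n choose l) * (f (Suc l) * g (n - l))) +
     (\<Sum>l\<le>n. real (n choose Suc l) * (f (Suc l) * g (n - l)))"
    by (simp add: algebra_simps sum.distrib)
  also have "f 0 * g (Suc n) + (\<dots>) =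
     (\<Sum>l\<le>n. real (n choose l) * (f (Suc l) * g (n - l))) +
     (f 0 * g (Suc n) + (\<Sum>l\<le>n. real (n choose Suc l) * (f (Suc l) * g (n - l))))"
    by simp
  also have "f 0 * g (Suc n) + (\<Sum>l\<le>n. real (n choose Suc l) * (f (Suc l) * g (n - l))) =
     (\<Sum>l\<le>Suc n. real (n choose l) * (f l * g (Suc n - l)))"
    by (subst sum.atMost_Suc_shift) simp
  also have "\<dots> = (\<Sum>l\<le>n. real (n choose l) * (f l * g (Suc (n - l))))"
    by (simp add: Suc_diff_le)
  finally show ?thesis by simp
qed

text \<open>The bounds depend on lengths only, so the terms of the Leibniz rule that put the same
  number l of letters on the first factor can be grouped; there are n choose l of them.\<close>

lemma norm_jmul_le:
  assumes "\<And>w. w \<in> lists S \<Longrightarrow> norm (F w) \<le> f (length w)"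
    and "\<And>w. w \<in> lists S \<Longrightarrow> norm (G w) \<le> g (length w)"
    and "w \<in> lists S"
  shows "norm (jmul F G w) \<le>
    (\<Sum>l\<le>length w. real (length w choose l) * (f l * g (length w - l)))"
  using assms
proof (induction w arbitrary: F G f g)
  case Nil
  show ?case using Nil(1)[of "[]"] Nil(2)[of "[]"]
    by (auto simp: norm_mult intro!: mult_mono intro: order_trans[OF norm_ge_zero])
next
  case (Cons b w)
  have b: "b \<in> S" and w: "w \<in> lists S" using Cons.prems(3) by auto
  have "norm (jmul (\<lambda>w. F (b # w)) G w) \<le>
      (\<Sum>l\<le>length w. real (length w choose l) * (f (Suc l) * g (length w - l)))"
    using Cons.prems(1)[of "b # _"] Cons.prems(2) b w by (intro Cons.IH) auto
  moreover have "norm (jmul F (\<lambda>w. G (b # w)) w) \<le>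
      (\<Sum>l\<le>length w. real (length w choose l) * (f l * g (Suc (length w - l))))"
    using Cons.prems(2)[of "b # _"] Cons.prems(1) b w
    by (intro Cons.IH[where g="\<lambda>n. g (Suc n)"]) auto
  ultimately show ?case
    using leibniz_sum_Suc[of "length w" f g] norm_triangle_ineq
      [of "jmul (\<lambda>w. F (b # w)) G w" "jmul F (\<lambda>w. G (b # w)) w"]
    by (simp only: jmul.simps length_Cons)
qed

text \<open>The index k counts derivatives already spent by earlier iterations, D is the size and R
  the growth rate per further derivative. Keeping k apart from D and R lets R stay fixed during the
  iteration.\<close>

definition jbound :: "(nat \<Rightarrow> real) \<Rightarrow> 'l set \<Rightarrow> nat \<Rightarrow> real \<Rightarrow> real \<Rightarrow> 'l jet \<Rightarrow> bool" where
  "jbound M S k D R F \<longleftrightarrow> (\<forall>w\<in>lists S. norm (F w) \<le> D * R ^ length w * M (k + length w))"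

lemma jboundD:
  "jbound M S k D R F \<Longrightarrow> w \<in> lists S \<Longrightarrow> norm (F w) \<le> D * R ^ length w * M (k + length w)"
  by (simp add: jbound_def)

lemma jbound_mono:
  assumes M: "regular_sequence M" and F: "jbound M S k D R F"
    and "k \<le> k'" "D \<le> D'" "R \<le> R'" "0 \<le> D" "0 \<le> R"
  shows "jbound M S k' D' R' F"
  unfolding jbound_def
proof
  fix w assume "w \<in> lists S"
  hence "norm (F w) \<le> D * R ^ length w * M (k + length w)"
    using F by (simp add: jbound_def)
  also have "\<dots> \<le> D' * R' ^ length w * M (k' + length w)"
    using assms regular_sequence_mono[OF M, of "k + length w" "k' + length w"]
      less_imp_le[OF regular_sequence_pos[OF M]]
    by (intro mult_mono power_mono) auto
  finally show "norm (F w) \<le> D' * R' ^ length w * M (k' + length w)" .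
qed

lemma jbound_add:
  assumes "jbound M S k D R F" "jbound M S k E R G"
  shows "jbound M S k (D + E) R (\<lambda>w. F w + G w)"
  using assms unfolding jbound_def by (force simp: algebra_simps intro: norm_triangle_mono)

lemma jbound_uminus: "jbound M S k D R F \<Longrightarrow> jbound M S k D R (\<lambda>w. - F w)"
  by (simp add: jbound_def)

lemma jbound_sum:
  assumes "\<And>l. l \<in> T \<Longrightarrow> jbound M S k (D l) R (F l)"
  shows "jbound M S k (\<Sum>l\<in>T. D l) R (\<lambda>w. \<Sum>l\<in>T. F l w)"
  unfolding jbound_def
proof
  fix w assume "w \<in> lists S"
  hence "norm (\<Sum>l\<in>T. F l w) \<le> (\<Sum>l\<in>T. D l * R ^ length w * M (k + length w))"
    using assms by (intro sum_norm_le) (auto simp: jbound_def)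
  thus "norm (\<Sum>l\<in>T. F l w) \<le> (\<Sum>l\<in>T. D l) * R ^ length w * M (k + length w)"
    by (simp add: sum_distrib_right)
qed

lemma jbound_jderiv:
  assumes "jbound M S k D R F" "b \<in> S"
  shows "jbound M S (Suc k) (D * R) R (jderiv b F)"
  unfolding jbound_def
proof
  fix w assume "w \<in> lists S"
  hence "b # w \<in> lists S" using assms by auto
  from jboundD[OF assms(1) this]
  show "norm (jderiv b F w) \<le> D * R * R ^ length w * M (Suc k + length w)"
    by (simp add: mult_ac)
qed

text \<open>If l derivatives fall on the coefficient F, the growth rates contribute (A/R)^l \<le>
  2^(-l), and the weights recombine by \<open>regular_sequence_mult_le\<close>. The Leibniz sum is
  thus dominated by a geometric series: the rate R survives and only a factor 2 is lost, whatever k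
  and the length of the word.\<close>

lemma jbound_jmul:
  assumes M: "regular_sequence M"
    and F: "jbound M S 0 C A F" and G: "jbound M S k D R G"
    and "0 \<le> C" "0 \<le> A" "0 \<le> D" "2 * A \<le> R"
  shows "jbound M S k (2 * C * D) R (jmul F G)"
  unfolding jbound_def
proof
  fix w assume w: "w \<in> lists S"
  define n where "n = length w"
  have R: "0 \<le> R" using assms by linarith
  have pos: "0 \<le> M i" for i using regular_sequence_pos[OF M, of i] by simp
  have "norm (jmul F G w) \<le>
    (\<Sum>l\<le>n. real (n choose l) * ((C * A ^ l * M l) * (D * R ^ (n - l) * M (k + (n - l)))))"
    unfolding n_def using jboundD[OF F] jboundD[OF G] w
    by (intro norm_jmul_le[where S=S]) auto
  also have "\<dots> \<le> (\<Sum>l\<le>n. C * D * (R ^ n * M (k + n)) * (1 / 2) ^ l)"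
  proof (intro sum_mono)
    fix l assume l: "l \<in> {..n}"
    have "A ^ l * R ^ (n - l) \<le> (R / 2) ^ l * R ^ (n - l)"
      using assms R by (intro mult_right_mono power_mono) auto
    also have "\<dots> = (1 / 2) ^ l * R ^ n"
      using l by (simp add: power_divide field_simps flip: power_add)
    finally have A: "A ^ l * R ^ (n - l) \<le> (1 / 2) ^ l * R ^ n" .
    have "real (n choose l) * ((C * A ^ l * M l) * (D * R ^ (n - l) * M (k + (n - l)))) =
        C * D * ((A ^ l * R ^ (n - l)) * (real (n choose l) * (M l * M (k + n - l))))"
      using l by (simp add: mult_ac)
    also have "\<dots> \<le> C * D * (((1 / 2) ^ l * R ^ n) * M (k + n))"
      using regular_sequence_mult_le[OF M, of l n "k + n"] l A assms R pos
      by (intro mult_left_mono mult_mono[OF A]) auto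
    finally show "real (n choose l) * ((C * A ^ l * M l) * (D * R ^ (n - l) * M (k + (n - l))))
        \<le> C * D * (R ^ n * M (k + n)) * (1 / 2) ^ l"
      by (simp add: mult_ac)
  qed
  also have "\<dots> = C * D * (R ^ n * M (k + n)) * (\<Sum>l\<le>n. (1 / 2) ^ l)"
    by (simp add: sum_distrib_left)
  also have "\<dots> \<le> C * D * (R ^ n * M (k + n)) * 2"
  proof (intro mult_left_mono)
    have "(\<Sum>l\<le>n. (1 / 2) ^ l) = 2 - (1 / 2 :: real) ^ n"
      by (induction n) (auto simp: field_simps)
    thus "(\<Sum>l\<le>n. (1 / 2) ^ l) \<le> (2::real)" by simp
    show "0 \<le> C * D * (R ^ n * M (k + n))" using assms R pos by simp
  qed
  finally show "norm (jmul F G w) \<le> 2 * C * D * R ^ length w * M (k + length w)"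
    by (simp add: n_def mult_ac)
qed

text \<open>The index i will range over points together with base points and directions of the FBI
  phase, so that a single constant serves all frequencies.\<close>

definition CM_jets :: "(nat \<Rightarrow> real) \<Rightarrow> 'l set \<Rightarrow> 'i set \<Rightarrow> ('i \<Rightarrow> 'l jet) \<Rightarrow> bool" where
  "CM_jets M S J F \<longleftrightarrow> (\<exists>C\<ge>0. \<forall>i\<in>J. jbound M S 0 C C (F i))"

lemma CM_jetsI:
  assumes "regular_sequence M" "0 \<le> C" "0 \<le> A" "\<And>i. i \<in> J \<Longrightarrow> jbound M S 0 C A (F i)"
  shows "CM_jets M S J F"
  unfolding CM_jets_def using assms
  by (intro exI[of _ "max C A"]) (auto intro: jbound_mono[of M S 0 C A])

lemma CM_jets_add:
  assumes M: "regular_sequence M" and "CM_jets M S J F" "CM_jets M S J G"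
  shows "CM_jets M S J (\<lambda>i w. F i w + G i w)"
proof -
  obtain C D where C: "0 \<le> C" "\<forall>i\<in>J. jbound M S 0 C C (F i)"
    and D: "0 \<le> D" "\<forall>i\<in>J. jbound M S 0 D D (G i)"
    using assms unfolding CM_jets_def by blast
  show ?thesis
  proof (rule CM_jetsI[OF M])
    fix i assume "i \<in> J"
    thus "jbound M S 0 (C + D) (max C D) (\<lambda>w. F i w + G i w)"
      using C D by (intro jbound_add) (auto intro: jbound_mono[OF M])
  qed (use C D in auto)
qed

lemma CM_jets_jmul:
  assumes M: "regular_sequence M" and "CM_jets M S J F" "CM_jets M S J G"
  shows "CM_jets M S J (\<lambda>i. jmul (F i) (G i))"
proof -
  obtain C D where C: "0 \<le> C" "\<forall>i\<in>J. jbound M S 0 C C (F i)"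
    and D: "0 \<le> D" "\<forall>i\<in>J. jbound M S 0 D D (G i)"
    using assms unfolding CM_jets_def by blast
  show ?thesis
  proof (rule CM_jetsI[OF M])
    fix i assume i: "i \<in> J"
    have "jbound M S 0 D (2 * C + D) (G i)"
      using C D i by (auto intro: jbound_mono[OF M, of _ _ D D])
    thus "jbound M S 0 (2 * C * D) (2 * C + D) (jmul (F i) (G i))"
      using C D i by (intro jbound_jmul[OF M, of _ _ C]) auto
  qed (use C D in auto)
qed

text \<open>In contrast to \<open>jbound_jderiv\<close> the weight index is not raised: condition
  (c) moves the extra derivative into the growth rate. This is affordable because it happens a fixed
  number of times, to coefficients and not to iterates.\<close>

lemma CM_jets_jderiv:
  assumes M: "regular_sequence M" and "CM_jets M S J F" "b \<in> S"
  shows "CM_jets M S J (\<lambda>i. jderiv b (F i))"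
proof -
  obtain C where C: "0 \<le> C" "\<forall>i\<in>J. jbound M S 0 C C (F i)"
    using assms unfolding CM_jets_def by blast
  obtain B where B: "1 \<le> B" "\<And>k. M (Suc k) \<le> B ^ k * M k"
    using regular_sequence_Suc_le[OF M] by blast
  show ?thesis
  proof (rule CM_jetsI[OF M])
    fix i assume i: "i \<in> J"
    show "jbound M S 0 (C * C) (C * B) (jderiv b (F i))"
      unfolding jbound_def
    proof
      fix w assume "w \<in> lists S"
      hence "norm (jderiv b (F i) w) \<le> C * C * C ^ length w * M (Suc (length w))"
        using jboundD[OF jbound_jderiv[OF C(2)[rule_format, OF i] assms(3)]] by auto
      also have "\<dots> \<le> C * C * C ^ length w * (B ^ length w * M (length w))"
        using C B by (intro mult_left_mono) auto
      finally show "norm (jderiv b (F i) w) \<le> C * C * (C * B) ^ length w * M (0 + length w)"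
        by (simp add: power_mult_distrib mult_ac)
    qed
  qed (use C B in auto)
qed

lemma CM_jets_jcoord:
  assumes M: "regular_sequence M" and "\<And>i. i \<in> J \<Longrightarrow> norm (z i) \<le> C"
  shows "CM_jets M S J (\<lambda>i. jcoord l (z i))"
proof (rule CM_jetsI[OF M, of "max C 1" 1])
  fix i assume i: "i \<in> J"
  have "norm (jcoord l (z i) w) \<le> max C 1 * 1" for w
    using assms(2)[OF i] by (auto simp: jcoord_def)
  also have "max C 1 * 1 \<le> max C 1 * M n" for n
    using regular_sequence_ge_1[OF M, of n] by (intro mult_left_mono) auto
  finally show "jbound M S 0 (max C 1) 1 (jcoord l (z i))"
    by (auto simp: jbound_def)
qed auto

lemma CM_jets_jconst:
  assumes M: "regular_sequence M" and "\<And>i. i \<in> J \<Longrightarrow> norm (z i) \<le> C"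
  shows "CM_jets M S J (\<lambda>i. jconst (z i))"
proof (rule CM_jetsI[OF M, of "max C 1" 1])
  fix i assume i: "i \<in> J"
  have "norm (jconst (z i) w) \<le> max C 1 * 1" for w
    using assms(2)[OF i] by (auto simp: jconst_def)
  also have "max C 1 * 1 \<le> max C 1 * M n" for n
    using regular_sequence_ge_1[OF M, of n] by (intro mult_left_mono) auto
  finally show "jbound M S 0 (max C 1) 1 (jconst (z i))"
    by (auto simp: jbound_def)
qed auto

lemma CM_jets_sum:
  assumes M: "regular_sequence M" and "finite T" and "\<And>l. l \<in> T \<Longrightarrow> CM_jets M S J (F l)"
  shows "CM_jets M S J (\<lambda>i w. \<Sum>l\<in>T. F l i w)"
  using assms(2,3)
proof (induction T rule: finite_induct)
  case empty
  show ?case by (rule CM_jetsI[OF M, of 0 0]) (auto simp: jbound_def)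
next
  case (insert l T)
  thus ?case using CM_jets_add[OF M, of S J "F l" "\<lambda>i w. \<Sum>l\<in>T. F l i w"] by simp
qed

section \<open>The first-order operator on jets and its iterates\<close>

definition jfield :: "'l set \<Rightarrow> ('l \<Rightarrow> 'l jet) \<Rightarrow> 'l jet \<Rightarrow> 'l jet" where
  "jfield S c F = (\<lambda>w. \<Sum>l\<in>S. jmul (c l) (jderiv l F) w)"

text \<open>The operator P of the overview acting on jets, with \<open>r\<close> in the role of 1/q
  and \<open>d\<close> in that of div \<beta>.\<close>

definition jstep :: "'l set \<Rightarrow> ('l \<Rightarrow> 'l jet) \<Rightarrow> 'l jet \<Rightarrow> 'l jet \<Rightarrow> 'l jet \<Rightarrow> 'l jet" where
  "jstep S c d r F = (\<lambda>w. - (jfield S c (jmul r F) w + jmul d (jmul r F) w))"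

text \<open>Iterating a first-order operator with coefficients of the class costs one derivative, hence
  one index of \<open>M\<close>, per step; the radius \<open>R\<close> is never enlarged because it dominates
  twice the radii of the coefficients.\<close>

lemma jstep_iterate_bound:
  assumes M: "regular_sequence M" and S: "finite S"
    and c: "\<And>l. l \<in> S \<Longrightarrow> CM_jets M S J (c l)"
    and d: "CM_jets M S J d" and r: "CM_jets M S J r" and F: "CM_jets M S J F"
  obtains C where "0 \<le> C" and
    "\<And>i k. i \<in> J \<Longrightarrow> norm (((jstep S (\<lambda>l. c l i) (d i) (r i)) ^^ k) (F i) []) \<le> C ^ Suc k * M k"
proof -
  obtain Cc where Cc: "\<And>l. l \<in> S \<Longrightarrow> 0 \<le> Cc l" "\<And>l i. l \<in> S \<Longrightarrow> i \<in> J \<Longrightarrow> jbound M S 0 (Cc l) (Cc l) (c l i)"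
    using c unfolding CM_jets_def by metis
  obtain Cd Cr Cf where Cd: "0 \<le> Cd" "\<And>i. i \<in> J \<Longrightarrow> jbound M S 0 Cd Cd (d i)"
    and Cr: "0 \<le> Cr" "\<And>i. i \<in> J \<Longrightarrow> jbound M S 0 Cr Cr (r i)"
    and Cf: "0 \<le> Cf" "\<And>i. i \<in> J \<Longrightarrow> jbound M S 0 Cf Cf (F i)"
    using d r F unfolding CM_jets_def by metis
  define A where "A = sum Cc S + Cd + Cr + Cf"
  have sA: "0 \<le> sum Cc S" using Cc(1) by (intro sum_nonneg)
  have cA: "Cc l \<le> A" if "l \<in> S" for l
    using member_le_sum[OF that, of Cc] Cc(1) S Cd Cr Cf by (force simp: A_def)
  have A: "Cd \<le> A" "Cr \<le> A" "Cf \<le> A" "0 \<le> A"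
    using sA Cd Cr Cf by (auto simp: A_def)
  define R where "R = 2 * A"
  \<comment> \<open>Cost of one step: 2 * A for the product with r, again 2 * A for the product with
    a coefficient, a factor R for the derivative in each of the \<open>card S\<close> terms of the
    field, and the summand 1 for the term of order zero.\<close>
  define B where "B = 4 * A * A * (real (card S) * R + 1)"
  have R0: "0 \<le> R" "0 \<le> B" using A by (auto simp: R_def B_def)
  have main: "jbound M S k (A * B ^ k) R (((jstep S (\<lambda>l. c l i) (d i) (r i)) ^^ k) (F i))"
    if i: "i \<in> J" for i k
  proof (induction k)
    case 0
    show ?case using jbound_mono[OF M Cf(2)[OF i]] Cf A by (simp add: R_def)
  next
    case (Suc k)
    let ?G = "((jstep S (\<lambda>l. c l i) (d i) (r i)) ^^ k) (F i)"
    define E where "E = 2 * A * (A * B ^ k)"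
    have E0: "0 \<le> E" using A R0 by (simp add: E_def)
    have r: "jbound M S k E R (jmul (r i) ?G)"
      unfolding E_def
      using Suc jbound_mono[OF M Cr(2)[OF i], of 0 A A] Cr A R0
      by (intro jbound_jmul[OF M, of _ _ A]) (auto simp: R_def)
    have "jbound M S (Suc k) (2 * A * (E * R)) R (jmul (c l i) (jderiv l (jmul (r i) ?G)))"
      if l: "l \<in> S" for l
      using jbound_mono[OF M Cc(2)[OF l i], of 0 A A] Cc(1)[OF l] cA[OF l] A R0 E0 jbound_jderiv[OF r l]
      by (intro jbound_jmul[OF M, of _ _ A]) (auto simp: R_def)
    hence "jbound M S (Suc k) (\<Sum>l\<in>S. 2 * A * (E * R)) R (jfield S (\<lambda>l. c l i) (jmul (r i) ?G))"
      unfolding jfield_def by (intro jbound_sum)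
    moreover have "jbound M S (Suc k) (2 * A * E) R (jmul (d i) (jmul (r i) ?G))"
      using jbound_mono[OF M Cd(2)[OF i], of 0 A A] Cd A R0 E0 jbound_mono[OF M r, of "Suc k" E R]
      by (intro jbound_jmul[OF M, of _ _ A]) (auto simp: R_def)
    ultimately have "jbound M S (Suc k) ((\<Sum>l\<in>S. 2 * A * (E * R)) + 2 * A * E) R
        (jstep S (\<lambda>l. c l i) (d i) (r i) ?G)"
      unfolding jstep_def by (intro jbound_uminus jbound_add)
    moreover have "(\<Sum>l\<in>S. 2 * A * (E * R)) + 2 * A * E = A * B ^ Suc k"
      by (simp add: E_def B_def algebra_simps)
    ultimately show ?case by simp
  qed
  show ?thesis
  proof
    show "0 \<le> max A B" using A by simp
    fix i k assume i: "i \<in> J"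
    have "norm (((jstep S (\<lambda>l. c l i) (d i) (r i)) ^^ k) (F i) []) \<le> A * B ^ k * M k"
      using jboundD[OF main[OF i, of k], of "[]"] by simp
    also have "\<dots> \<le> max A B * max A B ^ k * M k"
      using A R0 regular_sequence_pos[OF M, of k]
      by (intro mult_right_mono mult_mono power_mono) auto
    finally show "norm (((jstep S (\<lambda>l. c l i) (d i) (r i)) ^^ k) (F i) []) \<le> max A B ^ Suc k * M k"
      by simp
  qed
qed

text \<open>\<open>Rel \<phi> \<psi>\<close> abstracts a (weak) statement that a fixed derivation maps \<open>\<phi>\<close> to \<open>\<psi>\<close>.\<close>

definition leibniz_rel :: "(('y \<Rightarrow> complex) \<Rightarrow> ('y \<Rightarrow> complex) \<Rightarrow> bool) \<Rightarrow> bool" where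
  "leibniz_rel Rel \<longleftrightarrow>
     (\<forall>\<phi> \<phi>' \<psi> \<psi>'. Rel \<phi> \<phi>' \<longrightarrow> Rel \<psi> \<psi>' \<longrightarrow> Rel (\<lambda>y. \<phi> y + \<psi> y) (\<lambda>y. \<phi>' y + \<psi>' y)) \<and>
     (\<forall>\<phi> \<phi>' \<psi> \<psi>'. Rel \<phi> \<phi>' \<longrightarrow> Rel \<psi> \<psi>' \<longrightarrow>
        Rel (\<lambda>y. \<phi> y * \<psi> y) (\<lambda>y. \<phi>' y * \<psi> y + \<phi> y * \<psi>' y)) \<and>
     (\<forall>c. Rel (\<lambda>_. c) (\<lambda>_. 0))"

text \<open>The chain rule for every entry of the jet, with \<open>c l\<close> the derivative of the
  variable l. The new letter stands at the end, as the outermost derivation, and leaves the front of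
  the word free for \<open>jderiv\<close>; hence this calculus never commutes two
  derivations.\<close>

definition jcompat :: "(('y \<Rightarrow> complex) \<Rightarrow> ('y \<Rightarrow> complex) \<Rightarrow> bool) \<Rightarrow> 'l set \<Rightarrow>
    ('l \<Rightarrow> 'y \<Rightarrow> complex) \<Rightarrow> ('y \<Rightarrow> 'l jet) \<Rightarrow> bool" where
  "jcompat Rel S c F \<longleftrightarrow>
     (\<forall>w\<in>lists S. Rel (\<lambda>y. F y w) (\<lambda>y. \<Sum>l\<in>S. c l y * F y (w @ [l])))"

lemma jcompat_add:
  assumes "leibniz_rel Rel" "jcompat Rel S c F" "jcompat Rel S c G"
  shows "jcompat Rel S c (\<lambda>y w. F y w + G y w)"
  using assms by (auto simp: jcompat_def leibniz_rel_def distrib_left sum.distrib)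

lemma jmul_rel:
  assumes R: "leibniz_rel Rel" and w: "w \<in> lists S"
    and F: "\<And>w. w \<in> lists S \<Longrightarrow> Rel (\<lambda>y. F y w) (\<lambda>y. F' y w)"
    and G: "\<And>w. w \<in> lists S \<Longrightarrow> Rel (\<lambda>y. G y w) (\<lambda>y. G' y w)"
  shows "Rel (\<lambda>y. jmul (F y) (G y) w) (\<lambda>y. jmul (F' y) (G y) w + jmul (F y) (G' y) w)"
  using F G w
proof (induction w arbitrary: F F' G G')
  case Nil
  thus ?case using R by (simp add: leibniz_rel_def)
next
  case (Cons b w)
  have b: "b \<in> S" and w: "w \<in> lists S" using Cons.prems by simp_all
  have 1: "Rel (\<lambda>y. jmul (\<lambda>w. F y (b # w)) (G y) w)
      (\<lambda>y. jmul (\<lambda>w. F' y (b # w)) (G y) w + jmul (\<lambda>w. F y (b # w)) (G' y) w)"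
    by (rule Cons.IH) (use Cons.prems b w in simp_all)
  have 2: "Rel (\<lambda>y. jmul (F y) (\<lambda>w. G y (b # w)) w)
      (\<lambda>y. jmul (F' y) (\<lambda>w. G y (b # w)) w + jmul (F y) (\<lambda>w. G' y (b # w)) w)"
    by (rule Cons.IH) (use Cons.prems b w in simp_all)
  have add: "\<And>\<phi> \<phi>' \<psi> \<psi>'. Rel \<phi> \<phi>' \<Longrightarrow> Rel \<psi> \<psi>' \<Longrightarrow> Rel (\<lambda>y. \<phi> y + \<psi> y) (\<lambda>y. \<phi>' y + \<psi>' y)"
    using R by (simp add: leibniz_rel_def)
  show ?case using add[OF 1 2] by (simp add: algebra_simps)
qed

lemma jcompat_jmul:
  assumes R: "leibniz_rel Rel" and "jcompat Rel S c F" "jcompat Rel S c G"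
  shows "jcompat Rel S c (\<lambda>y. jmul (F y) (G y))"
  unfolding jcompat_def
proof
  fix w assume w: "w \<in> lists S"
  have "Rel (\<lambda>y. jmul (F y) (G y) w)
      (\<lambda>y. jmul (\<lambda>w. \<Sum>l\<in>S. c l y * F y (w @ [l])) (G y) w +
           jmul (F y) (\<lambda>w. \<Sum>l\<in>S. c l y * G y (w @ [l])) w)"
    using assms by (intro jmul_rel[OF R w]) (auto simp: jcompat_def)
  thus "Rel (\<lambda>y. jmul (F y) (G y) w) (\<lambda>y. \<Sum>l\<in>S. c l y * jmul (F y) (G y) (w @ [l]))"
    by (simp add: jmul_snoc jmul_sum_left jmul_sum_right distrib_left sum.distrib)
qed

lemma jcompat_jderiv:
  assumes "jcompat Rel S c F" "b \<in> S"
  shows "jcompat Rel S c (\<lambda>y. jderiv b (F y))"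
proof -
  have "b # w \<in> lists S" if "w \<in> lists S" for w using that assms(2) by simp
  from assms(1)[unfolded jcompat_def, rule_format, OF this]
  show ?thesis by (simp add: jcompat_def)
qed

lemma jcompat_jconst:
  assumes "leibniz_rel Rel"
  shows "jcompat Rel S c (\<lambda>y. jconst z)"
  using assms by (auto simp: jcompat_def leibniz_rel_def jconst_def)

lemma jcompat_sum:
  assumes R: "leibniz_rel Rel" and "finite T" and "\<And>l. l \<in> T \<Longrightarrow> jcompat Rel S c (F l)"
  shows "jcompat Rel S c (\<lambda>y w. \<Sum>l\<in>T. F l y w)"
  using assms(2,3)
proof (induction T rule: finite_induct)
  case empty
  thus ?case using R by (auto simp: jcompat_def leibniz_rel_def)
next
  case (insert l T)
  thus ?case using jcompat_add[OF R, of S c "F l" "\<lambda>y w. \<Sum>l\<in>T. F l y w"] by simp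
qed

lemma jcompat_jcoord:
  assumes R: "leibniz_rel Rel" and "finite S" "l \<in> S" and v: "Rel v (c l)"
  shows "jcompat Rel S c (\<lambda>y. jcoord l (v y))"
  unfolding jcompat_def
proof
  fix w assume "w \<in> lists S"
  show "Rel (\<lambda>y. jcoord l (v y) w) (\<lambda>y. \<Sum>k\<in>S. c k y * jcoord l (v y) (w @ [k]))"
  proof (cases "w = []")
    case True
    have "(\<Sum>k\<in>S. c k y * jcoord l (v y) (w @ [k])) = (\<Sum>k\<in>S. if k = l then c k y else 0)" for y
      using True by (intro sum.cong) (auto simp: jcoord_def)
    thus ?thesis using True v assms by (simp add: jcoord_def)
  next
    case False
    thus ?thesis using R by (auto simp: jcoord_def leibniz_rel_def)
  qed
qed

lemma jcompat_uminus:
  assumes R: "leibniz_rel Rel" and "jcompat Rel S c F"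
  shows "jcompat Rel S c (\<lambda>y w. - F y w)"
proof -
  \<comment> \<open>Negation is multiplication by the constant jet -1, because
    \<open>leibniz_rel\<close> speaks only of sums, products and constants.\<close>
  have "jmul (jconst (-1)) (F y) w = - F y w" for y w
  proof -
    have z: "jmul (\<lambda>w. 0) G w = 0" for G :: "'b jet" and w
      by (induction w arbitrary: G) simp_all
    show ?thesis
      by (induction w arbitrary: F) (simp_all add: jconst_def z)
  qed
  thus ?thesis
    using jcompat_jmul[OF R jcompat_jconst[OF R, of S c "-1"] assms(2)] by (simp add: jcompat_def)
qed

lemma jcompat_jfield:
  assumes R: "leibniz_rel Rel" and S: "finite S"
    and "\<And>l. l \<in> S \<Longrightarrow> jcompat Rel S a (c l)" "jcompat Rel S a F"
  shows "jcompat Rel S a (\<lambda>y. jfield S (\<lambda>l. c l y) (F y))"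
  unfolding jfield_def using assms
  by (intro jcompat_sum jcompat_jmul jcompat_jderiv) auto

lemma jcompat_jstep:
  assumes R: "leibniz_rel Rel" and S: "finite S"
    and "\<And>l. l \<in> S \<Longrightarrow> jcompat Rel S a (c l)" "jcompat Rel S a d" "jcompat Rel S a r" "jcompat Rel S a F"
  shows "jcompat Rel S a (\<lambda>y. jstep S (\<lambda>l. c l y) (d y) (r y) (F y))"
  unfolding jstep_def using assms
  by (intro jcompat_uminus jcompat_add jcompat_jfield jcompat_jmul) auto


section \<open>Calculus with partial derivatives\<close>

lemma partial_deriv_at:
  "(g has_derivative g') (at x) \<Longrightarrow> partial_deriv b g x = g' b"
  using frechet_derivative_at[of g g' x] by (simp add: partial_deriv_def)

lemma has_derivative_partial_deriv:
  "g differentiable (at x) \<Longrightarrow> (g has_derivative (\<lambda>h. partial_deriv h g x)) (at x)"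
  using frechet_derivative_works[of g "at x"] by (simp add: partial_deriv_def)

lemma has_derivative_cong_open:
  assumes "open W" "x \<in> W" "\<And>y. y \<in> W \<Longrightarrow> f y = g y"
  shows "(f has_derivative D) (at x) \<longleftrightarrow> (g has_derivative D) (at x)"
  using assms has_derivative_transform_within_open[of f D x UNIV W g]
    has_derivative_transform_within_open[of g D x UNIV W f] by auto

lemma differentiable_cong_open:
  assumes "open W" "x \<in> W" "\<And>y. y \<in> W \<Longrightarrow> f y = g y"
  shows "f differentiable (at x) \<longleftrightarrow> g differentiable (at x)"
  unfolding differentiable_def using has_derivative_cong_open[OF assms] by simp

lemma partial_deriv_cong_open:
  assumes "open W" "x \<in> W" "\<And>y. y \<in> W \<Longrightarrow> f y = g y"
  shows "partial_deriv b f x = partial_deriv b g x"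
  unfolding partial_deriv_def frechet_derivative_def
  using has_derivative_cong_open[OF assms] by simp

lemma partial_deriv_linear:
  assumes "g differentiable (at x)"
  shows "linear (\<lambda>b. partial_deriv b g x)"
  using has_derivative_linear[OF has_derivative_partial_deriv[OF assms]] .

lemma partial_deriv_const: "partial_deriv b (\<lambda>_. c) x = 0"
  by (simp add: partial_deriv_at[OF has_derivative_const])

lemma partial_deriv_add:
  assumes "f differentiable (at x)" "g differentiable (at x)"
  shows "partial_deriv b (\<lambda>x. f x + g x) x = partial_deriv b f x + partial_deriv b g x"
  using partial_deriv_at[OF has_derivative_add[OF assms[THEN has_derivative_partial_deriv]]] by simp

lemma partial_deriv_mult:
  fixes f g :: "'a::euclidean_space \<Rightarrow> complex"
  assumes "f differentiable (at x)" "g differentiable (at x)"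
  shows "partial_deriv b (\<lambda>x. f x * g x) x = partial_deriv b f x * g x + f x * partial_deriv b g x"
  using partial_deriv_at[OF has_derivative_mult[OF assms[THEN has_derivative_partial_deriv]]]
  by simp

lemma partial_deriv_inverse:
  fixes f :: "'a::euclidean_space \<Rightarrow> complex"
  assumes "f differentiable (at x)" "f x \<noteq> 0"
  shows "partial_deriv b (\<lambda>x. inverse (f x)) x = - (inverse (f x) * partial_deriv b f x * inverse (f x))"
  using partial_deriv_at[OF Deriv.has_derivative_inverse[OF assms(2) has_derivative_partial_deriv[OF assms(1)]]] .

lemma Ck_on_cong:
  assumes "open W" "\<And>y. y \<in> W \<Longrightarrow> f y = g y"
  shows "Ck_on k f W \<longleftrightarrow> Ck_on k g W"
  using assms(2)
proof (induction k arbitrary: f g)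
  case 0
  thus ?case by (simp cong: continuous_on_cong)
next
  case (Suc k)
  have "Ck_on k (partial_deriv b f) W \<longleftrightarrow> Ck_on k (partial_deriv b g) W" for b
    using partial_deriv_cong_open[OF assms(1) _ Suc.prems] by (intro Suc.IH) auto
  thus ?case using differentiable_cong_open[OF assms(1) _ Suc.prems] by auto
qed

lemma Ck_on_SucD: "Ck_on (Suc k) g W \<Longrightarrow> Ck_on k g W"
proof (induction k arbitrary: g)
  case 0
  thus ?case
    by (auto intro!: continuous_at_imp_continuous_on differentiable_imp_continuous_within)
qed auto

lemma Ck_on_le: "Ck_on k g W \<Longrightarrow> j \<le> k \<Longrightarrow> Ck_on j g W"
proof (induction k)
  case (Suc k)
  thus ?case using Ck_on_SucD[of k g W] by (cases "j = Suc k") simp_all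
qed simp

lemma Ck_on_continuous: "Ck_on k g W \<Longrightarrow> continuous_on W g"
  using Ck_on_le[of k g W 0] by simp

lemma Ck_on_subset: "Ck_on k g W \<Longrightarrow> V \<subseteq> W \<Longrightarrow> Ck_on k g V"
  by (induction k arbitrary: g) (auto intro: continuous_on_subset)

lemma Ck_on_const [simp]: "Ck_on k (\<lambda>_. c) W"
proof (induction k arbitrary: c)
  case (Suc k)
  have "partial_deriv b (\<lambda>_. c) = (\<lambda>_. 0)" for b :: 'a
    by (simp add: fun_eq_iff partial_deriv_const)
  thus ?case using Suc by simp
qed simp

lemma Ck_on_add:
  assumes "open W" "Ck_on k f W" "Ck_on k g W"
  shows "Ck_on k (\<lambda>x. f x + g x) W"
  using assms(2,3)
proof (induction k arbitrary: f g)
  case (Suc k)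
  have "Ck_on k (partial_deriv b (\<lambda>x. f x + g x)) W" if "b \<in> Basis" for b
  proof -
    have "Ck_on k (\<lambda>x. partial_deriv b f x + partial_deriv b g x) W"
      using Suc that by (intro Suc.IH) auto
    thus ?thesis
      using Suc.prems by (subst Ck_on_cong[OF assms(1)]) (auto simp: partial_deriv_add)
  qed
  thus ?case using Suc.prems by auto
qed (auto intro: continuous_intros)

lemma Ck_on_mult:
  fixes f g :: "'a::euclidean_space \<Rightarrow> complex"
  assumes "open W" "Ck_on k f W" "Ck_on k g W"
  shows "Ck_on k (\<lambda>x. f x * g x) W"
  using assms(2,3)
proof (induction k arbitrary: f g)
  case (Suc k)
  have "Ck_on k (partial_deriv b (\<lambda>x. f x * g x)) W" if "b \<in> Basis" for b
  proof -
    have "Ck_on k (\<lambda>x. partial_deriv b f x * g x + f x * partial_deriv b g x) W"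
      using Suc.prems that Suc.prems[THEN Ck_on_SucD]
      by (intro Ck_on_add[OF assms(1)] Suc.IH) simp_all
    thus ?thesis
      using Suc.prems by (subst Ck_on_cong[OF assms(1)]) (auto simp: partial_deriv_mult)
  qed
  thus ?case using Suc.prems by (auto intro: differentiable_mult)
qed (auto intro: continuous_intros)

lemma Ck_on_uminus:
  fixes f :: "'a::euclidean_space \<Rightarrow> complex"
  assumes "open W" "Ck_on k f W"
  shows "Ck_on k (\<lambda>x. - f x) W"
  using Ck_on_mult[OF assms(1) Ck_on_const[of k "-1"] assms(2)] by simp

lemma Ck_on_sum:
  assumes "open W" "\<And>i. i \<in> I \<Longrightarrow> Ck_on k (f i) W"
  shows "Ck_on k (\<lambda>x. \<Sum>i\<in>I. f i x) W"
  using assms(2)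
proof (induction I rule: infinite_finite_induct)
  case (insert i I)
  thus ?case using Ck_on_add[OF assms(1), of k "f i" "\<lambda>x. \<Sum>i\<in>I. f i x"] by simp
qed auto

lemma Ck_on_inverse:
  fixes f :: "'a::euclidean_space \<Rightarrow> complex"
  assumes "open W" "Ck_on k f W" "\<And>x. x \<in> W \<Longrightarrow> f x \<noteq> 0"
  shows "Ck_on k (\<lambda>x. inverse (f x)) W"
  using assms(2)
proof (induction k)
  case 0
  thus ?case using assms(3) by (auto intro!: continuous_intros)
next
  case (Suc k)
  have inv: "Ck_on k (\<lambda>x. inverse (f x)) W"
    using Suc.IH Ck_on_SucD[OF Suc.prems] by blast
  have "Ck_on k (partial_deriv b (\<lambda>x. inverse (f x))) W" if "b \<in> Basis" for b
  proof -
    have "Ck_on k (\<lambda>x. - (inverse (f x) * partial_deriv b f x * inverse (f x))) W"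
      using Suc.prems inv that by (intro Ck_on_uminus Ck_on_mult assms(1)) auto
    thus ?thesis
      using Suc.prems assms(3) by (subst Ck_on_cong[OF assms(1)]) (auto simp: partial_deriv_inverse)
  qed
  thus ?case using Suc.prems assms(3) by (auto intro!: differentiable_inverse)
qed

lemma Ck_on_bounded_linear:
  assumes "bounded_linear l"
  shows "Ck_on k l W"
proof (cases k)
  case 0
  thus ?thesis using assms by (simp add: linear_continuous_on)
next
  case (Suc n)
  have d: "(l has_derivative l) (at x)" for x
    using assms by (rule bounded_linear_imp_has_derivative)
  hence "partial_deriv b l = (\<lambda>_. l b)" for b
    by (simp add: fun_eq_iff partial_deriv_at[OF d])
  thus ?thesis using d Suc by (auto simp: differentiable_def)
qed

lemma Ck_on_of_real_inner: "Ck_on k (\<lambda>x. complex_of_real ((x - z) \<bullet> b)) W" if "open W"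
proof -
  have "Ck_on k (\<lambda>x. complex_of_real (x \<bullet> b)) W"
    by (intro Ck_on_bounded_linear bounded_linear_compose[OF bounded_linear_of_real bounded_linear_inner_left])
  thus ?thesis
    using Ck_on_add[OF that _ Ck_on_const, of k "\<lambda>x. complex_of_real (x \<bullet> b)" "- complex_of_real (z \<bullet> b)"]
    by (simp add: inner_diff_left)
qed

section \<open>Symmetry of second partial derivatives\<close>

lemma has_vector_derivative_along:
  assumes "g differentiable (at (x + s *\<^sub>R b))"
  shows "((\<lambda>s. g (x + s *\<^sub>R b)) has_vector_derivative partial_deriv b g (x + s *\<^sub>R b)) (at s)"
proof -
  have "((\<lambda>s. x + s *\<^sub>R b) has_derivative (\<lambda>h. h *\<^sub>R b)) (at s)"
    by (auto intro!: derivative_eq_intros)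
  from has_derivative_compose[OF this has_derivative_partial_deriv[OF assms]]
  have "((\<lambda>s. g (x + s *\<^sub>R b)) has_derivative (\<lambda>h. partial_deriv (h *\<^sub>R b) g (x + s *\<^sub>R b))) (at s)" .
  moreover have "partial_deriv (h *\<^sub>R b) g (x + s *\<^sub>R b) = h *\<^sub>R partial_deriv b g (x + s *\<^sub>R b)" for h
    using linear_scale[OF partial_deriv_linear[OF assms]] .
  ultimately show ?thesis by (simp add: has_vector_derivative_def)
qed

lemma partial_deriv_Re:
  assumes "g differentiable (at x)"
  shows "partial_deriv b (\<lambda>x. Re (g x)) x = Re (partial_deriv b g x)"
    and "partial_deriv b (\<lambda>x. Im (g x)) x = Im (partial_deriv b g x)"
    and "(\<lambda>x. Re (g x)) differentiable (at x)" "(\<lambda>x. Im (g x)) differentiable (at x)"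
proof -
  have "((\<lambda>x. Re (g x)) has_derivative (\<lambda>h. Re (partial_deriv h g x))) (at x)"
    "((\<lambda>x. Im (g x)) has_derivative (\<lambda>h. Im (partial_deriv h g x))) (at x)"
    using has_derivative_partial_deriv[OF assms] by (auto intro: has_derivative_Re has_derivative_Im)
  thus "partial_deriv b (\<lambda>x. Re (g x)) x = Re (partial_deriv b g x)"
    "partial_deriv b (\<lambda>x. Im (g x)) x = Im (partial_deriv b g x)"
    "(\<lambda>x. Re (g x)) differentiable (at x)" "(\<lambda>x. Im (g x)) differentiable (at x)"
    by (auto simp: partial_deriv_at differentiable_def)
qed

text \<open>The mean value theorem twice: along b for the increment of g in direction c, then along
  c for the derivative of g along b. The left side is symmetric in b and c, which is the source of
  the symmetry of second derivatives.\<close>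

lemma second_difference_mvt:
  fixes g :: "'a::euclidean_space \<Rightarrow> real"
  assumes h: "0 < h" and W: "\<And>s t. s \<in> {0..h} \<Longrightarrow> t \<in> {0..h} \<Longrightarrow> x + s *\<^sub>R b + t *\<^sub>R c \<in> W"
    and g: "\<And>y. y \<in> W \<Longrightarrow> g differentiable (at y)"
    and gb: "\<And>y. y \<in> W \<Longrightarrow> partial_deriv b g differentiable (at y)"
  shows "\<exists>s\<in>{0..h}. \<exists>t\<in>{0..h}. g (x + h *\<^sub>R b + h *\<^sub>R c) - g (x + h *\<^sub>R b) - g (x + h *\<^sub>R c) + g x
      = h * h * partial_deriv c (partial_deriv b g) (x + s *\<^sub>R b + t *\<^sub>R c)"
proof -
  define \<phi> where "\<phi> = (\<lambda>s. g (x + h *\<^sub>R c + s *\<^sub>R b) - g (x + s *\<^sub>R b))"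
  have d: "DERIV \<phi> s :> partial_deriv b g (x + h *\<^sub>R c + s *\<^sub>R b) - partial_deriv b g (x + s *\<^sub>R b)"
    if "0 \<le> s" "s \<le> h" for s
  proof -
    have "x + h *\<^sub>R c + s *\<^sub>R b \<in> W" "x + s *\<^sub>R b \<in> W"
      using W[of s h] W[of s 0] that h by (auto simp: add_ac)
    thus ?thesis unfolding \<phi>_def
      using g has_vector_derivative_along[of g "x + h *\<^sub>R c" s b] has_vector_derivative_along[of g x s b]
      by (auto intro!: derivative_intros simp: has_real_derivative_iff_has_vector_derivative)
  qed
  obtain s where s: "0 < s" "s < h" "\<phi> h - \<phi> 0 = (h - 0) *
      (partial_deriv b g (x + h *\<^sub>R c + s *\<^sub>R b) - partial_deriv b g (x + s *\<^sub>R b))"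
    using MVT2[OF h d] by blast
  define \<psi> where "\<psi> = (\<lambda>t. partial_deriv b g (x + s *\<^sub>R b + t *\<^sub>R c))"
  have d2: "DERIV \<psi> t :> partial_deriv c (partial_deriv b g) (x + s *\<^sub>R b + t *\<^sub>R c)"
    if "0 \<le> t" "t \<le> h" for t
    unfolding \<psi>_def has_real_derivative_iff_has_vector_derivative
    using W[of s t] s that gb by (intro has_vector_derivative_along) auto
  obtain t where t: "0 < t" "t < h" "\<psi> h - \<psi> 0 = (h - 0) * partial_deriv c (partial_deriv b g) (x + s *\<^sub>R b + t *\<^sub>R c)"
    using MVT2[OF h d2] by blast
  have "\<phi> h - \<phi> 0 = h * (\<psi> h - \<psi> 0)"
    using s(3) by (simp add: \<psi>_def add_ac)
  hence "\<phi> h - \<phi> 0 = h * h * partial_deriv c (partial_deriv b g) (x + s *\<^sub>R b + t *\<^sub>R c)"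
    using t(3) by simp
  thus ?thesis using s t
    by (intro bexI[of _ s] bexI[of _ t]) (auto simp: \<phi>_def add_ac)
qed

text \<open>Both orders of differentiation give the same second difference over a small square, at
  possibly different intermediate points. These converge to x as the square shrinks, and continuity
  of the mixed derivatives identifies the limits.\<close>

lemma partial_deriv_commute_real:
  fixes g :: "'a::euclidean_space \<Rightarrow> real"
  assumes "open W" "x \<in> W"
    and g: "\<And>y. y \<in> W \<Longrightarrow> g differentiable (at y)"
    and gb: "\<And>y. y \<in> W \<Longrightarrow> partial_deriv b g differentiable (at y)"
    and gc: "\<And>y. y \<in> W \<Longrightarrow> partial_deriv c g differentiable (at y)"
    and "continuous_on W (partial_deriv c (partial_deriv b g))"
    and "continuous_on W (partial_deriv b (partial_deriv c g))"
  shows "partial_deriv c (partial_deriv b g) x = partial_deriv b (partial_deriv c g) x"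
proof -
  let ?u = "partial_deriv c (partial_deriv b g)" and ?v = "partial_deriv b (partial_deriv c g)"
  obtain r where r: "0 < r" "ball x r \<subseteq> W"
    using assms openE by blast
  \<comment> \<open>Squares of side r / (N * (n + 1)) stay in the ball of radius r around x, since a
    point of the square is displaced by at most the side times |b| + |c| < N.\<close>
  define N where "N = norm b + norm c + 1"
  define h where "h = (\<lambda>n. r / (N * (real n + 1)))"
  have N: "0 < N" by (simp add: N_def add_nonneg_pos)
  have h0: "0 < h n" for n using r N by (simp add: h_def)
  have near: "norm (s *\<^sub>R b + t *\<^sub>R c) \<le> h n * (norm b + norm c)"
    if "s \<in> {0..h n}" "t \<in> {0..h n}" for s t n
  proof -
    have "norm (s *\<^sub>R b + t *\<^sub>R c) \<le> s * norm b + t * norm c"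
      using that norm_triangle_ineq[of "s *\<^sub>R b" "t *\<^sub>R c"] by simp
    also have "\<dots> \<le> h n * norm b + h n * norm c"
      using that by (intro add_mono mult_right_mono) auto
    finally show ?thesis by (simp add: distrib_left)
  qed
  have hr: "h n * (norm b + norm c) < r" for n
  proof -
    have "h n * (norm b + norm c) < h n * N" using h0 by (simp add: N_def)
    also have "h n * N = r / (real n + 1)" using N by (simp add: h_def)
    also have "\<dots> \<le> r" using r by (simp add: field_simps)
    finally show ?thesis .
  qed
  have W: "x + s *\<^sub>R b + t *\<^sub>R c \<in> W" if "s \<in> {0..h n}" "t \<in> {0..h n}" for s t n
  proof -
    have "dist x (x + s *\<^sub>R b + t *\<^sub>R c) < r"
      using near[OF that] hr[of n] by (simp add: dist_norm norm_minus_commute add_ac)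
    thus ?thesis using r(2) by auto
  qed
  have "\<exists>p q. p \<in> W \<and> q \<in> W \<and> dist p x \<le> h n * (norm b + norm c) \<and> dist q x \<le> h n * (norm b + norm c)
      \<and> ?u p = ?v q" for n
  proof -
    obtain s t where st: "s \<in> {0..h n}" "t \<in> {0..h n}"
      and 1: "g (x + h n *\<^sub>R b + h n *\<^sub>R c) - g (x + h n *\<^sub>R b) - g (x + h n *\<^sub>R c) + g x
      = h n * h n * ?u (x + s *\<^sub>R b + t *\<^sub>R c)"
      using second_difference_mvt[OF h0, of n x b c W g] W g gb by blast
    have W': "x + t *\<^sub>R c + s *\<^sub>R b \<in> W" if "s \<in> {0..h n}" "t \<in> {0..h n}" for s t
      using W[OF that] by (simp add: add_ac)
    obtain s' t' where st': "s' \<in> {0..h n}" "t' \<in> {0..h n}"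
      and 2: "g (x + h n *\<^sub>R c + h n *\<^sub>R b) - g (x + h n *\<^sub>R c) - g (x + h n *\<^sub>R b) + g x
      = h n * h n * ?v (x + s' *\<^sub>R c + t' *\<^sub>R b)"
      using second_difference_mvt[OF h0, of n x c b W g] W' g gc by blast
    have "h n * h n * ?u (x + s *\<^sub>R b + t *\<^sub>R c) = h n * h n * ?v (x + s' *\<^sub>R c + t' *\<^sub>R b)"
      using 1 2 add.commute[of "h n *\<^sub>R b" "h n *\<^sub>R c"] by (simp only: add.assoc)
    hence "?u (x + s *\<^sub>R b + t *\<^sub>R c) = ?v (x + s' *\<^sub>R c + t' *\<^sub>R b)"
      using h0[of n] by simp
    moreover have "dist (x + s *\<^sub>R b + t *\<^sub>R c) x \<le> h n * (norm b + norm c)"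
      "dist (x + s' *\<^sub>R c + t' *\<^sub>R b) x \<le> h n * (norm b + norm c)"
      using near[OF st] near[of t' n s'] st' by (simp_all add: dist_norm add_ac)
    ultimately show ?thesis using W[OF st] W'[OF st'(2,1)] by blast
  qed
  then obtain p q where pq: "\<And>n. p n \<in> W" "\<And>n. q n \<in> W"
    "\<And>n. dist (p n) x \<le> h n * (norm b + norm c)" "\<And>n. dist (q n) x \<le> h n * (norm b + norm c)"
    "\<And>n. ?u (p n) = ?v (q n)" by metis
  have "(\<lambda>n. r / N * inverse (real (Suc n)) * (norm b + norm c)) \<longlonglongrightarrow> r / N * 0 * (norm b + norm c)"
    by (intro tendsto_intros LIMSEQ_inverse_real_of_nat)
  hence lim: "(\<lambda>n. h n * (norm b + norm c)) \<longlonglongrightarrow> 0"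
    by (simp add: h_def field_simps)
  have "p \<longlonglongrightarrow> x" "q \<longlonglongrightarrow> x"
    by (rule metric_tendsto_imp_tendsto[OF lim]; use pq h0 in \<open>auto simp: dist_real_def less_imp_le\<close>)+
  hence "(\<lambda>n. ?u (p n)) \<longlonglongrightarrow> ?u x" "(\<lambda>n. ?v (q n)) \<longlonglongrightarrow> ?v x"
    using assms pq(1-4) by (auto intro!: continuous_on_tendsto_compose[of W])
  thus ?thesis using LIMSEQ_unique unfolding pq(5) by blast
qed

lemma partial_deriv_commute:
  fixes g :: "'a::euclidean_space \<Rightarrow> complex"
  assumes W: "open W" "x \<in> W" and g: "Ck_on 2 g W" and bc: "b \<in> Basis" "c \<in> Basis"
  shows "partial_deriv c (partial_deriv b g) x = partial_deriv b (partial_deriv c g) x"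
proof -
  have g2: "Ck_on (Suc (Suc 0)) g W" using g by (simp add: numeral_2_eq_2)
  \<comment> \<open>\<open>P\<close> stands for Re and Im at once: the mean value theorem requires
    real values.\<close>
  have main: "P (partial_deriv c (partial_deriv b g) x) = P (partial_deriv b (partial_deriv c g) x)"
    if P: "\<And>(g :: 'a \<Rightarrow> complex) x b. g differentiable (at x) \<Longrightarrow> partial_deriv b (\<lambda>x. P (g x)) x = P (partial_deriv b g x)"
      "\<And>(g :: 'a \<Rightarrow> complex) x. g differentiable (at x) \<Longrightarrow> (\<lambda>x. P (g x)) differentiable (at x)"
      "\<And>g :: 'a \<Rightarrow> complex. continuous_on W g \<Longrightarrow> continuous_on W (\<lambda>x. P (g x))"
    for P :: "complex \<Rightarrow> real"
  proof -
    have d: "g differentiable (at y)" "partial_deriv b g differentiable (at y)"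
      "partial_deriv c g differentiable (at y)" if "y \<in> W" for y
      using g2 that bc by auto
    have 1: "partial_deriv e (\<lambda>x. P (g x)) y = P (partial_deriv e g y)" if "y \<in> W" for y e
      by (rule P(1)[OF d(1)[OF that]])
    have 2: "partial_deriv a (partial_deriv e (\<lambda>x. P (g x))) y = P (partial_deriv a (partial_deriv e g) y)"
      if "y \<in> W" "e = b \<or> e = c" for y e a
    proof -
      have "partial_deriv a (partial_deriv e (\<lambda>x. P (g x))) y = partial_deriv a (\<lambda>y. P (partial_deriv e g y)) y"
        using 1 that by (intro partial_deriv_cong_open[OF W(1)]) auto
      also have "\<dots> = P (partial_deriv a (partial_deriv e g) y)"
        using d that by (intro P(1)) auto
      finally show ?thesis .
    qed
    have 3: "partial_deriv e (\<lambda>x. P (g x)) differentiable (at y)" if "y \<in> W" "e = b \<or> e = c" for y e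
      using differentiable_cong_open[OF W(1) that(1), of "partial_deriv e (\<lambda>x. P (g x))" "\<lambda>y. P (partial_deriv e g y)"]
        1 P(2)[of "partial_deriv e g" y] d that by auto
    have 4: "continuous_on W (partial_deriv a (partial_deriv e (\<lambda>x. P (g x))))"
      if "e = b \<or> e = c" "a = b \<or> a = c" for a e
    proof -
      have "continuous_on W (\<lambda>y. P (partial_deriv a (partial_deriv e g) y))"
        using g2 bc that by (intro P(3)) auto
      thus ?thesis using 2 that by (simp cong: continuous_on_cong)
    qed
    have "partial_deriv c (partial_deriv b (\<lambda>x. P (g x))) x = partial_deriv b (partial_deriv c (\<lambda>x. P (g x))) x"
      using 3 4 P(2) d by (intro partial_deriv_commute_real[OF W]) auto
    thus ?thesis using 2 W by simp
  qed
  show ?thesis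
    using main[of Re] main[of Im]
    by (auto simp: complex_eq_iff partial_deriv_Re continuous_on_Re continuous_on_Im)
qed

section \<open>Difference quotients and integration by parts\<close>

lemma norm_diff_along_le:
  fixes g :: "'a::euclidean_space \<Rightarrow> 'b::real_normed_vector"
  assumes h: "0 \<le> h" and g: "\<And>s. s \<in> {0..h} \<Longrightarrow> g differentiable (at (x + s *\<^sub>R b))"
    and le: "\<And>s. s \<in> {0..h} \<Longrightarrow> norm (partial_deriv b g (x + s *\<^sub>R b) - v) \<le> C"
  shows "norm (g (x + h *\<^sub>R b) - g x - h *\<^sub>R v) \<le> C * h"
proof -
  define \<phi> where "\<phi> = (\<lambda>s. g (x + s *\<^sub>R b) - s *\<^sub>R v)"
  have "norm (\<phi> h - \<phi> 0) \<le> C * norm (h - 0)"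
  proof (rule differentiable_bound[where f'="\<lambda>s t. t *\<^sub>R (partial_deriv b g (x + s *\<^sub>R b) - v)"])
    fix s assume s: "s \<in> {0..h}"
    have "(\<phi> has_vector_derivative (partial_deriv b g (x + s *\<^sub>R b) - v)) (at s)"
      unfolding \<phi>_def using has_vector_derivative_along[OF g[OF s]]
      by (auto intro!: derivative_eq_intros)
    thus "(\<phi> has_derivative (\<lambda>t. t *\<^sub>R (partial_deriv b g (x + s *\<^sub>R b) - v))) (at s within {0..h})"
      unfolding has_vector_derivative_def by (rule has_derivative_at_withinI)
    show "onorm (\<lambda>t. t *\<^sub>R (partial_deriv b g (x + s *\<^sub>R b) - v)) \<le> C"
      using le[OF s] by (intro onorm_le) (simp add: mult.commute[of C] mult_left_mono)
  qed (use h in auto)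
  thus ?thesis using h by (simp add: \<phi>_def algebra_simps)
qed

lemma compact_thickening:
  fixes K :: "'a::euclidean_space set"
  assumes "compact K" "open W" "K \<subseteq> W"
  obtains \<delta> K' where "0 < \<delta>" "compact K'" "K' \<subseteq> W" "\<And>x z. x \<in> K \<Longrightarrow> norm z \<le> \<delta> \<Longrightarrow> x + z \<in> K'"
proof -
  obtain \<delta> where \<delta>: "0 < \<delta>" "(\<Union>x\<in>K. cball x \<delta>) \<subseteq> W"
    using compact_subset_open_imp_cball_epsilon_subset[OF assms] by blast
  show ?thesis
  proof
    show "compact {x + y |x y. x \<in> K \<and> y \<in> cball 0 \<delta>}"
      by (intro compact_sums assms compact_cball)
    show "{x + y |x y. x \<in> K \<and> y \<in> cball 0 \<delta>} \<subseteq> W"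
      using \<delta>(2) by (force simp: dist_norm)
  qed (use \<delta> in auto)
qed

lemma uniform_limit_translate:
  fixes \<phi> :: "'a::euclidean_space \<Rightarrow> complex"
  assumes "compact K" "open W" "K \<subseteq> W" "continuous_on W \<phi>"
    and h: "h \<longlonglongrightarrow> (0::real)"
  shows "uniform_limit K (\<lambda>n y. \<phi> (y + h n *\<^sub>R b)) \<phi> sequentially"
proof (rule uniform_limitI)
  fix e :: real assume e: "0 < e"
  obtain \<delta> K' where K': "0 < \<delta>" "compact K'" "K' \<subseteq> W" "\<And>x z. x \<in> K \<Longrightarrow> norm z \<le> \<delta> \<Longrightarrow> x + z \<in> K'"
    using compact_thickening[OF assms(1-3)] by metis
  have "uniformly_continuous_on K' \<phi>"
    using K' assms continuous_on_subset by (intro compact_uniformly_continuous) auto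
  then obtain d where d: "0 < d" "\<And>x y. x \<in> K' \<Longrightarrow> y \<in> K' \<Longrightarrow> dist y x < d \<Longrightarrow> dist (\<phi> y) (\<phi> x) < e"
    using e unfolding uniformly_continuous_on_def by metis
  have "(\<lambda>n. norm (h n *\<^sub>R b)) \<longlonglongrightarrow> norm (0 *\<^sub>R b)"
    by (intro tendsto_intros h)
  hence "eventually (\<lambda>n. norm (h n *\<^sub>R b) < min \<delta> d) sequentially"
    using K'(1) d(1) by (intro order_tendstoD) auto
  thus "\<forall>\<^sub>F n in sequentially. \<forall>x\<in>K. dist (\<phi> (x + h n *\<^sub>R b)) (\<phi> x) < e"
  proof eventually_elim
    case (elim n)
    show ?case
    proof
      fix x assume "x \<in> K"
      thus "dist (\<phi> (x + h n *\<^sub>R b)) (\<phi> x) < e"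
        using elim K'(4)[of x "h n *\<^sub>R b"] K'(4)[of x 0] K'(1) by (intro d) (auto simp: dist_norm)
    qed
  qed
qed

definition diff_quot :: "real \<Rightarrow> 'a::euclidean_space \<Rightarrow> ('a \<Rightarrow> complex) \<Rightarrow> 'a \<Rightarrow> complex" where
  "diff_quot h b \<phi> y = (\<phi> (y + h *\<^sub>R b) - \<phi> y) / of_real h"

lemma uniform_limit_diff_quot:
  fixes \<phi> :: "'a::euclidean_space \<Rightarrow> complex"
  assumes "compact K" "open W" "K \<subseteq> W" "Ck_on 1 \<phi> W" "b \<in> Basis"
    and h: "h \<longlonglongrightarrow> (0::real)" "\<And>n. 0 < h n"
  shows "uniform_limit K (\<lambda>n. diff_quot (h n) b \<phi>) (partial_deriv b \<phi>) sequentially"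
proof (rule uniform_limitI)
  fix e :: real assume e: "0 < e"
  obtain \<delta> K' where K': "0 < \<delta>" "compact K'" "K' \<subseteq> W" "\<And>x z. x \<in> K \<Longrightarrow> norm z \<le> \<delta> \<Longrightarrow> x + z \<in> K'"
    using compact_thickening[OF assms(1-3)] by metis
  have "continuous_on W (partial_deriv b \<phi>)" and diff: "\<And>y. y \<in> W \<Longrightarrow> \<phi> differentiable (at y)"
    using assms by auto
  hence "uniformly_continuous_on K' (partial_deriv b \<phi>)"
    using K'(2,3) by (intro compact_uniformly_continuous) (rule continuous_on_subset)
  moreover have "0 < e / 2" using e by simp
  ultimately obtain d where d: "0 < d"
    "\<And>x y. x \<in> K' \<Longrightarrow> y \<in> K' \<Longrightarrow> dist y x < d \<Longrightarrow> dist (partial_deriv b \<phi> y) (partial_deriv b \<phi> x) < e / 2"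
    unfolding uniformly_continuous_on_def by metis
  have "eventually (\<lambda>n. h n < min \<delta> d) sequentially"
    using K'(1) d(1) by (intro order_tendstoD[OF h(1)]) auto
  thus "\<forall>\<^sub>F n in sequentially. \<forall>x\<in>K. dist (diff_quot (h n) b \<phi> x) (partial_deriv b \<phi> x) < e"
  proof eventually_elim
    case (elim n)
    show ?case
    proof
      fix x assume x: "x \<in> K"
      have in': "x + s *\<^sub>R b \<in> K'" if "s \<in> {0..h n}" for s
        using that elim K'(4)[OF x, of "s *\<^sub>R b"] assms(5) by auto
      have "norm (\<phi> (x + h n *\<^sub>R b) - \<phi> x - h n *\<^sub>R partial_deriv b \<phi> x) \<le> e / 2 * h n"
      proof (rule norm_diff_along_le)
        fix s assume s: "s \<in> {0..h n}"
        show "\<phi> differentiable (at (x + s *\<^sub>R b))"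
          using in'[OF s] K'(3) diff by auto
        have "dist (partial_deriv b \<phi> (x + s *\<^sub>R b)) (partial_deriv b \<phi> x) < e / 2"
          using in'[OF s] K'(4)[OF x, of 0] K'(1) s elim assms(5) by (intro d) (auto simp: dist_norm)
        thus "norm (partial_deriv b \<phi> (x + s *\<^sub>R b) - partial_deriv b \<phi> x) \<le> e / 2"
          by (simp add: dist_norm)
      qed (use h(2)[of n] in auto)
      moreover have "diff_quot (h n) b \<phi> x - partial_deriv b \<phi> x =
          (\<phi> (x + h n *\<^sub>R b) - \<phi> x - h n *\<^sub>R partial_deriv b \<phi> x) / of_real (h n)"
        using h(2)[of n] by (simp add: diff_quot_def field_simps scaleR_conv_of_real)
      ultimately have "norm (diff_quot (h n) b \<phi> x - partial_deriv b \<phi> x) \<le> e / 2 * h n / h n"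
        using h(2)[of n] by (simp only: norm_divide norm_of_real abs_of_pos) (intro divide_right_mono, auto)
      hence "dist (diff_quot (h n) b \<phi> x) (partial_deriv b \<phi> x) \<le> e / 2"
        using h(2)[of n] by (simp add: dist_norm)
      thus "dist (diff_quot (h n) b \<phi> x) (partial_deriv b \<phi> x) < e" using e by simp
    qed
  qed
qed

lemma continuous_compact_support_integrable:
  fixes F :: "'a::euclidean_space \<Rightarrow> complex"
  assumes "continuous_on UNIV F" "compact K" "\<And>x. x \<notin> K \<Longrightarrow> F x = 0"
  shows "integrable lborel F"
proof -
  have "integrable lborel (\<lambda>x. indicator K x *\<^sub>R F x)"
    using assms by (intro borel_integrable_compact) (auto intro: continuous_on_subset)
  moreover have "(\<lambda>x. indicator K x *\<^sub>R F x) = F"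
    using assms(3) by (auto simp: indicator_def fun_eq_iff)
  ultimately show ?thesis by simp
qed

lemma lborel_integral_translate:
  fixes F :: "'a::euclidean_space \<Rightarrow> complex"
  shows "integral\<^sup>L lborel (\<lambda>x. F (x + a)) = integral\<^sup>L lborel F"
proof (cases "F \<in> borel_measurable borel")
  case True
  have "integral\<^sup>L (distr lborel borel ((+) a)) F = integral\<^sup>L lborel (\<lambda>x. F (a + x))"
    using True by (intro integral_distr) auto
  thus ?thesis by (simp only: lborel_distr_plus add.commute[of a])
next
  case False
  \<comment> \<open>Translation preserves non-measurability, so both integrals have the default
    value 0 of non-integrable functions.\<close>
  have "(\<lambda>x. F (x + a)) \<notin> borel_measurable borel"
  proof
    assume "(\<lambda>x. F (x + a)) \<in> borel_measurable borel"
    hence "(\<lambda>x. F ((x - a) + a)) \<in> borel_measurable borel"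
      by (rule measurable_compose[rotated]) simp
    thus False using False by simp
  qed
  hence "\<not> integrable lborel (\<lambda>x. F (x + a))" "\<not> integrable lborel F"
    using False by (auto dest: borel_measurable_integrable)
  thus ?thesis by (simp add: not_integrable_integral_eq)
qed

text \<open>Translation invariance of Lebesgue measure makes the integral of every difference
  quotient vanish. The quotients are dominated by the maximum of the derivative on a ball, so the
  limit can be taken under the integral.\<close>

lemma integral_partial_deriv_eq_0:
  fixes F :: "'a::euclidean_space \<Rightarrow> complex"
  assumes F: "Ck_on 1 F UNIV" and K: "compact K" "\<And>x. x \<notin> K \<Longrightarrow> F x = 0" and b: "b \<in> Basis"
  shows "integral\<^sup>L lborel (partial_deriv b F) = 0"
proof -
  define h where "h = (\<lambda>n. inverse (real (Suc n)))"
  have h: "h \<longlonglongrightarrow> 0" "\<And>n. 0 < h n" "\<And>n. h n \<le> 1"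
    using LIMSEQ_inverse_real_of_nat by (auto simp: h_def field_simps)
  obtain r where r: "0 < r" "K \<subseteq> ball 0 r"
    using bounded_subset_ballD[OF compact_imp_bounded[OF K(1)], of 0] by blast
  \<comment> \<open>The steps are at most 1, so the quotients live in the ball of radius r + 1 and
    are controlled by the derivative on the ball of radius r + 2.\<close>
  define K' where "K' = cball (0::'a) (r + 1)"
  have out: "diff_quot (h n) b F x = 0" if "x \<notin> K'" for n x
  proof -
    have "norm x > r + 1" using that by (simp add: K'_def)
    moreover have "norm (h n *\<^sub>R b) \<le> 1" using h(2,3)[of n] b by simp
    moreover have "norm x \<le> norm (x + h n *\<^sub>R b) + norm (h n *\<^sub>R b)"
      by (metis add_diff_cancel norm_triangle_ineq4)
    ultimately have "x + h n *\<^sub>R b \<notin> K" "x \<notin> K" using r(2) by auto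
    thus ?thesis by (simp add: diff_quot_def K(2))
  qed
  have contF: "continuous_on UNIV F" using Ck_on_continuous[OF F] .
  have int: "integrable lborel F"
    by (rule continuous_compact_support_integrable[OF contF K])
  have cont: "continuous_on UNIV (diff_quot (h n) b F)" for n
    unfolding diff_quot_def using h(2)[of n]
    by (intro continuous_intros continuous_on_compose2[OF contF]) auto
  have int_dq: "integrable lborel (diff_quot (h n) b F)" for n
    by (rule continuous_compact_support_integrable[OF cont, of K']) (auto simp: K'_def out[unfolded K'_def])
  have zero: "integral\<^sup>L lborel (diff_quot (h n) b F) = 0" for n
  proof -
    have "continuous_on UNIV (\<lambda>x. F (x + h n *\<^sub>R b))"
      by (intro continuous_intros continuous_on_compose2[OF contF]) auto
    hence "integrable lborel (\<lambda>x. F (x + h n *\<^sub>R b))"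
    proof (rule continuous_compact_support_integrable)
      show "compact ((\<lambda>x. - (h n *\<^sub>R b) + x) ` K)" using K(1) by (rule compact_translation)
      fix x assume "x \<notin> (\<lambda>x. - (h n *\<^sub>R b) + x) ` K"
      hence "x + h n *\<^sub>R b \<notin> K" by (force simp: image_iff)
      thus "F (x + h n *\<^sub>R b) = 0" by (rule K(2))
    qed
    thus ?thesis using int unfolding diff_quot_def
      by (simp add: lborel_integral_translate)
  qed
  have ul: "uniform_limit K' (\<lambda>n. diff_quot (h n) b F) (partial_deriv b F) sequentially"
    using F b h by (intro uniform_limit_diff_quot[of _ UNIV]) (auto simp: K'_def)
  have lim: "(\<lambda>n. diff_quot (h n) b F x) \<longlonglongrightarrow> partial_deriv b F x" for x
    using F b h tendsto_uniform_limitI[OF uniform_limit_diff_quot[of "{x}" UNIV F b h]] by auto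
  have pcont: "continuous_on UNIV (partial_deriv b F)" using F b by auto
  hence "bounded (partial_deriv b F ` cball 0 (r + 2))"
    by (intro compact_imp_bounded compact_continuous_image continuous_on_subset[OF pcont]) auto
  then obtain C where C: "\<And>x. norm x \<le> r + 2 \<Longrightarrow> norm (partial_deriv b F x) \<le> C"
    by (force simp: bounded_iff)
  have "(\<lambda>n. integral\<^sup>L lborel (diff_quot (h n) b F)) \<longlonglongrightarrow> integral\<^sup>L lborel (partial_deriv b F)"
  proof (rule integral_dominated_convergence[where w="\<lambda>x. indicator K' x *\<^sub>R C"])
    show "partial_deriv b F \<in> borel_measurable lborel"
      using borel_measurable_continuous_onI[OF pcont] by simp
    show "diff_quot (h n) b F \<in> borel_measurable lborel" for n
      using borel_measurable_continuous_onI[OF cont] by simp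
    show "integrable lborel (\<lambda>x. indicator K' x *\<^sub>R C)"
      by (intro borel_integrable_compact) (auto simp: K'_def)
    show "AE x in lborel. norm (diff_quot (h n) b F x) \<le> indicator K' x *\<^sub>R C" for n
    proof (rule AE_I2)
      fix x :: 'a
      show "norm (diff_quot (h n) b F x) \<le> indicator K' x *\<^sub>R C"
      proof (cases "x \<in> K'")
        case True
        have "norm (F (x + h n *\<^sub>R b) - F x - h n *\<^sub>R 0) \<le> C * h n"
        proof (rule norm_diff_along_le)
          fix s assume s: "s \<in> {0..h n}"
          show "F differentiable at (x + s *\<^sub>R b)" using F by auto
          have "norm (x + s *\<^sub>R b) \<le> norm x + s"
            using norm_triangle_ineq[of x "s *\<^sub>R b"] s b by simp
          thus "norm (partial_deriv b F (x + s *\<^sub>R b) - 0) \<le> C"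
            using C[of "x + s *\<^sub>R b"] True s h(3)[of n] by (simp add: K'_def)
        qed (use h(2)[of n] in auto)
        thus ?thesis using True h(2)[of n] by (simp add: diff_quot_def norm_divide field_simps)
      next
        case False
        thus ?thesis using out by simp
      qed
    qed
  qed (use lim in auto)
  thus ?thesis using zero LIMSEQ_unique by (simp add: LIMSEQ_const_iff)
qed


section \<open>First-order operators with \<open>C\<^sup>1\<close> coefficients\<close>

definition vfield :: "('a::euclidean_space \<Rightarrow> 'a \<Rightarrow> complex) \<Rightarrow> ('a \<Rightarrow> complex) \<Rightarrow> 'a \<Rightarrow> complex" where
  "vfield \<beta> \<phi> y = (\<Sum>b\<in>Basis. \<beta> b y * partial_deriv b \<phi> y)"

text \<open>The closure of the operator under uniform convergence on K, starting from functions that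
  are \<open>C^1\<close> near K. Uniform limits are strong enough to keep the product rule and to
  pass through integration by parts, and weak enough to admit functions that are merely
  continuous.\<close>

definition strong_deriv :: "('a::euclidean_space \<Rightarrow> 'a \<Rightarrow> complex) \<Rightarrow> 'a set \<Rightarrow>
    ('a \<Rightarrow> complex) \<Rightarrow> ('a \<Rightarrow> complex) \<Rightarrow> bool" where
  "strong_deriv \<beta> K \<phi> g \<longleftrightarrow>
     (\<exists>U \<phi>n. open U \<and> K \<subseteq> U \<and> (\<forall>n. Ck_on 1 (\<phi>n n) U) \<and>
        uniform_limit K \<phi>n \<phi> sequentially \<and>
        uniform_limit K (\<lambda>n. vfield \<beta> (\<phi>n n)) g sequentially)"

lemma vfield_add:
  "\<phi> differentiable (at y) \<Longrightarrow> \<psi> differentiable (at y) \<Longrightarrow>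
    vfield \<beta> (\<lambda>y. \<phi> y + \<psi> y) y = vfield \<beta> \<phi> y + vfield \<beta> \<psi> y"
  by (simp add: vfield_def partial_deriv_add distrib_left sum.distrib)

lemma vfield_mult:
  "\<phi> differentiable (at y) \<Longrightarrow> \<psi> differentiable (at y) \<Longrightarrow>
    vfield \<beta> (\<lambda>y. \<phi> y * \<psi> y) y = vfield \<beta> \<phi> y * \<psi> y + \<phi> y * vfield \<beta> \<psi> y"
  by (simp add: vfield_def partial_deriv_mult distrib_left sum.distrib sum_distrib_left mult_ac)

lemma continuous_on_vfield:
  assumes "Ck_on 1 \<phi> U" "K \<subseteq> U" "\<And>b. b \<in> Basis \<Longrightarrow> continuous_on K (\<beta> b)"
  shows "continuous_on K (vfield \<beta> \<phi>)"
  unfolding vfield_def using assms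
  by (intro continuous_intros) (auto intro: continuous_on_subset)

lemma strong_derivE:
  assumes "strong_deriv \<beta> K \<phi> g" "compact K" "\<And>b. b \<in> Basis \<Longrightarrow> continuous_on K (\<beta> b)"
  obtains U \<phi>n where "open U" "K \<subseteq> U" "\<And>n. Ck_on 1 (\<phi>n n) U"
    "uniform_limit K \<phi>n \<phi> sequentially"
    "uniform_limit K (\<lambda>n. vfield \<beta> (\<phi>n n)) g sequentially"
    "continuous_on K \<phi>" "continuous_on K g" "bounded (\<phi> ` K)" "bounded (g ` K)"
proof -
  obtain U \<phi>n where U: "open U" "K \<subseteq> U" "\<And>n. Ck_on 1 (\<phi>n n) U"
    "uniform_limit K \<phi>n \<phi> sequentially"
    "uniform_limit K (\<lambda>n. vfield \<beta> (\<phi>n n)) g sequentially"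
    using assms(1) unfolding strong_deriv_def by blast
  have "continuous_on K (\<phi>n n)" for n
    using Ck_on_continuous[OF U(3)] U(2) by (rule continuous_on_subset)
  hence c: "continuous_on K \<phi>"
    by (intro uniform_limit_theorem[OF _ U(4)]) auto
  have "continuous_on K (vfield \<beta> (\<phi>n n))" for n
    by (rule continuous_on_vfield[OF U(3) U(2) assms(3)])
  hence c': "continuous_on K g"
    by (intro uniform_limit_theorem[OF _ U(5)]) auto
  show ?thesis
    using that[OF U c c'] c c' assms(2) by (simp add: compact_continuous_image compact_imp_bounded)
qed

lemma strong_deriv_cong:
  assumes "strong_deriv \<beta> K \<phi> g" "\<And>y. y \<in> K \<Longrightarrow> g y = g' y"
  shows "strong_deriv \<beta> K \<phi> g'"
proof -
  have "uniform_limit K f g sequentially \<longleftrightarrow> uniform_limit K f g' sequentially" for f :: "nat \<Rightarrow> 'a \<Rightarrow> complex"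
    using assms(2) by (intro uniform_limit_cong') auto
  thus ?thesis using assms(1) by (simp add: strong_deriv_def)
qed

lemma strong_deriv_classical:
  assumes "open U" "K \<subseteq> U" "Ck_on 1 \<phi> U" "\<And>y. y \<in> K \<Longrightarrow> g y = vfield \<beta> \<phi> y"
  shows "strong_deriv \<beta> K \<phi> g"
  unfolding strong_deriv_def
proof (intro exI conjI allI)
  show "uniform_limit K (\<lambda>n. vfield \<beta> \<phi>) g sequentially"
    by (rule uniform_limitI) (use assms(4) in auto)
  show "uniform_limit K (\<lambda>n. \<phi>) \<phi> sequentially"
    by (rule uniform_limitI) auto
qed (use assms in auto)

text \<open>Products of uniformly convergent sequences converge uniformly because the limits are
  bounded on the compact K; the product rule of \<open>C^1\<close> functions therefore passes to the
  closure.\<close>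

lemma leibniz_rel_strong_deriv:
  assumes K: "compact K" and \<beta>: "\<And>b. b \<in> Basis \<Longrightarrow> continuous_on K (\<beta> b)"
  shows "leibniz_rel (strong_deriv \<beta> K)"
  unfolding leibniz_rel_def
proof (intro conjI allI impI)
  fix \<phi> \<phi>' \<psi> \<psi>' assume 1: "strong_deriv \<beta> K \<phi> \<phi>'" and 2: "strong_deriv \<beta> K \<psi> \<psi>'"
  obtain U f where U: "open U" "K \<subseteq> U" "\<And>n. Ck_on 1 (f n) U"
    "uniform_limit K f \<phi> sequentially" "uniform_limit K (\<lambda>n. vfield \<beta> (f n)) \<phi>' sequentially"
    "bounded (\<phi> ` K)" "bounded (\<phi>' ` K)"
    using strong_derivE[OF 1 K \<beta>] by metis
  obtain V h where V: "open V" "K \<subseteq> V" "\<And>n. Ck_on 1 (h n) V"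
    "uniform_limit K h \<psi> sequentially" "uniform_limit K (\<lambda>n. vfield \<beta> (h n)) \<psi>' sequentially"
    "bounded (\<psi> ` K)" "bounded (\<psi>' ` K)"
    using strong_derivE[OF 2 K \<beta>] by metis
  have UV: "open (U \<inter> V)" "K \<subseteq> U \<inter> V" "\<And>n. Ck_on 1 (f n) (U \<inter> V)" "\<And>n. Ck_on 1 (h n) (U \<inter> V)"
    using U(1,2) V(1,2) Ck_on_subset[OF U(3)] Ck_on_subset[OF V(3)] by blast+
  have d: "f n differentiable (at y)" "h n differentiable (at y)" if "y \<in> K" for n y
  proof -
    have "y \<in> U \<inter> V" using that UV(2) by blast
    thus "f n differentiable (at y)" "h n differentiable (at y)" using UV(3)[of n] UV(4)[of n] by simp_all
  qed
  show "strong_deriv \<beta> K (\<lambda>y. \<phi> y + \<psi> y) (\<lambda>y. \<phi>' y + \<psi>' y)"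
    unfolding strong_deriv_def
  proof (intro exI conjI allI)
    show "Ck_on 1 (\<lambda>y. f n y + h n y) (U \<inter> V)" for n by (intro Ck_on_add UV)
    show "uniform_limit K (\<lambda>n y. f n y + h n y) (\<lambda>y. \<phi> y + \<psi> y) sequentially"
      by (intro uniform_limit_add U V)
    have "uniform_limit K (\<lambda>n y. vfield \<beta> (f n) y + vfield \<beta> (h n) y) (\<lambda>y. \<phi>' y + \<psi>' y) sequentially"
      by (intro uniform_limit_add U V)
    thus "uniform_limit K (\<lambda>n. vfield \<beta> (\<lambda>y. f n y + h n y)) (\<lambda>y. \<phi>' y + \<psi>' y) sequentially"
      using d by (subst uniform_limit_cong) (auto simp: vfield_add)
  qed (use UV in auto)
  show "strong_deriv \<beta> K (\<lambda>y. \<phi> y * \<psi> y) (\<lambda>y. \<phi>' y * \<psi> y + \<phi> y * \<psi>' y)"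
    unfolding strong_deriv_def
  proof (intro exI conjI allI)
    show "Ck_on 1 (\<lambda>y. f n y * h n y) (U \<inter> V)" for n by (intro Ck_on_mult UV)
    show "uniform_limit K (\<lambda>n y. f n y * h n y) (\<lambda>y. \<phi> y * \<psi> y) sequentially"
      by (intro uniform_lim_mult U V)
    have "uniform_limit K (\<lambda>n y. vfield \<beta> (f n) y * h n y + f n y * vfield \<beta> (h n) y)
        (\<lambda>y. \<phi>' y * \<psi> y + \<phi> y * \<psi>' y) sequentially"
      by (intro uniform_limit_add uniform_lim_mult U V)
    thus "uniform_limit K (\<lambda>n. vfield \<beta> (\<lambda>y. f n y * h n y)) (\<lambda>y. \<phi>' y * \<psi> y + \<phi> y * \<psi>' y) sequentially"
      using d by (subst uniform_limit_cong) (auto simp: vfield_mult)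
  qed (use UV in auto)
next
  fix c :: complex
  show "strong_deriv \<beta> K (\<lambda>_. c) (\<lambda>_. 0)"
    by (rule strong_deriv_classical[of UNIV]) (auto simp: vfield_def partial_deriv_const simp del: Ck_on.simps)
qed

lemma partial_deriv_translate: "partial_deriv b (\<lambda>y. \<phi> (y + a)) y = partial_deriv b \<phi> (y + a)"
  and differentiable_translate: "(\<lambda>y. \<phi> (y + a)) differentiable (at y) \<longleftrightarrow> \<phi> differentiable (at (y + a))"
proof -
  have "((\<lambda>y. \<phi> (y + a)) has_derivative D) (at y) \<longleftrightarrow> (\<phi> has_derivative D) (at (y + a))" for D
  proof
    assume *: "(\<phi> has_derivative D) (at (y + a))"
    have "((\<lambda>y. y + a) has_derivative (\<lambda>h. h)) (at y)" by (auto intro!: derivative_eq_intros)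
    from has_derivative_compose[OF this *]
    show "((\<lambda>y. \<phi> (y + a)) has_derivative D) (at y)" .
  next
    assume "((\<lambda>y. \<phi> (y + a)) has_derivative D) (at y)"
    hence *: "((\<lambda>y. \<phi> (y + a)) has_derivative D) (at ((y + a) - a))" by simp
    have "((\<lambda>y. y - a) has_derivative (\<lambda>h. h)) (at (y + a))" by (auto intro!: derivative_eq_intros)
    from has_derivative_compose[OF this *]
    show "(\<phi> has_derivative D) (at (y + a))" by simp
  qed
  thus "partial_deriv b (\<lambda>y. \<phi> (y + a)) y = partial_deriv b \<phi> (y + a)"
    "(\<lambda>y. \<phi> (y + a)) differentiable (at y) \<longleftrightarrow> \<phi> differentiable (at (y + a))"
    by (simp_all add: partial_deriv_def frechet_derivative_def differentiable_def)
qed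

lemma Ck_on_translate:
  assumes "Ck_on k \<phi> W" "\<And>y. y \<in> U \<Longrightarrow> y + a \<in> W"
  shows "Ck_on k (\<lambda>y. \<phi> (y + a)) U"
  using assms(1)
proof (induction k arbitrary: \<phi>)
  case 0
  thus ?case using assms(2)
    by (auto intro!: continuous_on_compose2[of W \<phi> U "\<lambda>y. y + a"] continuous_intros)
next
  case (Suc k)
  have "partial_deriv b (\<lambda>y. \<phi> (y + a)) = (\<lambda>y. partial_deriv b \<phi> (y + a))" for b
    by (simp add: fun_eq_iff partial_deriv_translate)
  thus ?case using Suc assms(2) by (simp add: differentiable_translate)
qed

lemma uniform_limit_finite_sum:
  fixes f :: "'i \<Rightarrow> nat \<Rightarrow> 'a \<Rightarrow> complex"
  assumes "\<And>i. i \<in> I \<Longrightarrow> uniform_limit K (f i) (g i) F"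
  shows "uniform_limit K (\<lambda>n y. \<Sum>i\<in>I. f i n y) (\<lambda>y. \<Sum>i\<in>I. g i y) F"
  using assms
proof (induction I rule: infinite_finite_induct)
  case (insert i I)
  thus ?case
    by (simp add: uniform_limit_add)
qed (auto intro: uniform_limitI)

text \<open>The derivative of a \<open>C\<^sup>1\<close> solution \<open>v\<close> is only continuous, so the differentiated equation is
  reached through difference quotients of \<open>v\<close>, which are \<open>C\<^sup>1\<close>.\<close>

lemma strong_deriv_partial_deriv:
  assumes K: "compact K" "open W" "K \<subseteq> W"
    and \<beta>: "\<And>c. c \<in> Basis \<Longrightarrow> Ck_on 1 (\<beta> c) W"
    and v: "Ck_on 1 v W" and h: "Ck_on 1 h W" and eq: "\<And>y. y \<in> W \<Longrightarrow> vfield \<beta> v y = h y"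
    and b: "b \<in> Basis"
  shows "strong_deriv \<beta> K (partial_deriv b v)
    (\<lambda>y. partial_deriv b h y - (\<Sum>c\<in>Basis. partial_deriv b (\<beta> c) y * partial_deriv c v y))"
proof -
  obtain \<delta> where \<delta>: "0 < \<delta>" "(\<Union>x\<in>K. cball x \<delta>) \<subseteq> W"
    using compact_subset_open_imp_cball_epsilon_subset[OF K] by blast
  \<comment> \<open>One half of \<open>\<delta>\<close> is reserved for the neighbourhood on which
    the quotients must be \<open>C^1\<close>, the other for the step \<open>r n\<close>.\<close>
  define U where "U = (\<Union>x\<in>K. ball x (\<delta> / 2))"
  define r where "r = (\<lambda>n. \<delta> / 2 * inverse (real (Suc n)))"
  have "r \<longlonglongrightarrow> \<delta> / 2 * 0"
    unfolding r_def by (intro tendsto_intros LIMSEQ_inverse_real_of_nat)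
  hence r: "r \<longlonglongrightarrow> 0" "\<And>n. 0 < r n" "\<And>n. r n \<le> \<delta> / 2"
    using \<delta>(1) by (auto simp: r_def field_simps)
  have U: "open U" "K \<subseteq> U" using \<delta>(1) by (auto simp: U_def)
  have shift: "y + s *\<^sub>R b \<in> W" if y: "y \<in> U" and s: "s = 0 \<or> s = r n" for y s n
  proof -
    obtain x where x: "x \<in> K" "dist x y < \<delta> / 2" using y by (auto simp: U_def)
    have "dist y (y + s *\<^sub>R b) \<le> \<delta> / 2"
      using s r(2,3)[of n] b \<delta>(1) by (auto simp: dist_norm)
    hence "dist x (y + s *\<^sub>R b) \<le> \<delta>"
      using x(2) dist_triangle[of x "y + s *\<^sub>R b" y] by linarith
    hence "y + s *\<^sub>R b \<in> (\<Union>x\<in>K. cball x \<delta>)" using x(1) by (auto simp del: dist_add_cancel)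
    thus ?thesis using \<delta>(2) by blast
  qed
  have UW: "U \<subseteq> W" using shift[where s=0] by auto
  have C1: "Ck_on 1 (diff_quot (r n) b v) U" for n
  proof -
    have "Ck_on 1 (\<lambda>y. (v (y + r n *\<^sub>R b) + - v y) * (1 / of_real (r n))) U"
      using Ck_on_translate[OF v, of U "r n *\<^sub>R b"] shift Ck_on_subset[OF v UW]
      by (intro Ck_on_mult Ck_on_add Ck_on_uminus U(1) Ck_on_const) blast+
    thus ?thesis by (simp only: diff_quot_def[abs_def] add_uminus_conv_diff times_divide_eq_right mult_1_right)
  qed
  \<comment> \<open>Discrete product rule for the quotient of \<beta>_c \<partial>_c v, with the
    shift placed on \<partial>_c v. In this arrangement only \<beta> and h are differentiated in the
    limit, and v never twice.\<close>
  have comm: "vfield \<beta> (diff_quot (r n) b v) y =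
      diff_quot (r n) b h y - (\<Sum>c\<in>Basis. diff_quot (r n) b (\<beta> c) y * partial_deriv c v (y + r n *\<^sub>R b))"
    if y: "y \<in> K" for y n
  proof -
    have yU: "y \<in> U" using y U by auto
    have W: "y + r n *\<^sub>R b \<in> W" "y \<in> W" using shift[OF yU, of _ n] yU UW by auto
    have d: "v differentiable (at y)" "(\<lambda>y. v (y + r n *\<^sub>R b)) differentiable (at y)"
      using v W by (auto simp: differentiable_translate)
    have "partial_deriv c (diff_quot (r n) b v) y = diff_quot (r n) b (partial_deriv c v) y" for c
    proof -
      have "((\<lambda>y. (v (y + r n *\<^sub>R b) - v y) * (1 / of_real (r n))) has_derivative
         (\<lambda>c. (partial_deriv c (\<lambda>y. v (y + r n *\<^sub>R b)) y - partial_deriv c v y) * (1 / of_real (r n)))) (at y)"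
        using d[THEN has_derivative_partial_deriv]
        by (intro has_derivative_mult_left has_derivative_diff)
      from partial_deriv_at[OF this, of c] show ?thesis
        by (simp add: diff_quot_def[abs_def] partial_deriv_translate)
    qed
    hence "vfield \<beta> (diff_quot (r n) b v) y =
        (\<Sum>c\<in>Basis. \<beta> c y * ((partial_deriv c v (y + r n *\<^sub>R b) - partial_deriv c v y) / of_real (r n)))"
      by (simp add: vfield_def diff_quot_def)
    moreover have "diff_quot (r n) b h y =
        (\<Sum>c\<in>Basis. (\<beta> c (y + r n *\<^sub>R b) * partial_deriv c v (y + r n *\<^sub>R b) - \<beta> c y * partial_deriv c v y) / of_real (r n))"
      using eq[OF W(1)] eq[OF W(2)]
      by (simp add: diff_quot_def vfield_def sum_subtractf flip: sum_divide_distrib)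
    ultimately show ?thesis
      by (simp add: diff_quot_def sum_subtractf[symmetric] field_simps
          del: sum_subtractf) (simp add: sum_subtractf[symmetric] diff_divide_distrib algebra_simps)
  qed
  have bd: "bounded (g ` K)" if "continuous_on W g" for g :: "'a \<Rightarrow> complex"
    using K that by (intro compact_imp_bounded compact_continuous_image) (auto intro: continuous_on_subset)
  show ?thesis
    unfolding strong_deriv_def
  proof (intro exI conjI allI)
    show "uniform_limit K (\<lambda>n. diff_quot (r n) b v) (partial_deriv b v) sequentially"
      by (rule uniform_limit_diff_quot[OF K v b r(1,2)])
    have "uniform_limit K
      (\<lambda>n y. diff_quot (r n) b h y - (\<Sum>c\<in>Basis. diff_quot (r n) b (\<beta> c) y * partial_deriv c v (y + r n *\<^sub>R b)))
      (\<lambda>y. partial_deriv b h y - (\<Sum>c\<in>Basis. partial_deriv b (\<beta> c) y * partial_deriv c v y)) sequentially"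
      using b \<beta> v
      by (intro uniform_limit_minus uniform_limit_finite_sum uniform_lim_mult uniform_limit_diff_quot[OF K _ b r(1,2)]
            uniform_limit_translate[OF K _ r(1)] h \<beta> bd) auto
    thus "uniform_limit K (\<lambda>n. vfield \<beta> (diff_quot (r n) b v))
      (\<lambda>y. partial_deriv b h y - (\<Sum>c\<in>Basis. partial_deriv b (\<beta> c) y * partial_deriv c v y)) sequentially"
      using comm by (subst uniform_limit_cong) auto
  qed (use U C1 in auto)
qed

lemma uniform_limit_set_integral:
  fixes f :: "nat \<Rightarrow> 'a::euclidean_space \<Rightarrow> complex"
  assumes K: "compact K" and f: "\<And>n. continuous_on K (f n)"
    and lim: "uniform_limit K f g sequentially" and zero: "\<And>n. (LINT y:K|lborel. f n y) = 0"
  shows "(LINT y:K|lborel. g y) = 0"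
proof -
  have g: "continuous_on K g" using uniform_limit_theorem[OF _ lim] f by simp
  have int: "integrable lborel (\<lambda>y. indicator K y *\<^sub>R h y)" if "continuous_on K h" for h :: "'a \<Rightarrow> complex"
    using borel_integrable_compact[OF K that] by simp
  have "norm (LINT y:K|lborel. g y) \<le> e * measure lborel K" if e: "0 < e" for e
  proof -
    have "eventually (\<lambda>n. \<forall>y\<in>K. dist (f n y) (g y) < e) sequentially"
      using uniform_limitD[OF lim e] .
    then obtain n where n: "\<forall>y\<in>K. dist (f n y) (g y) < e"
      by (auto simp: eventually_sequentially)
    have "(LINT y:K|lborel. g y) = (LINT y:K|lborel. g y) - (LINT y:K|lborel. f n y)"
      using zero by simp
    also have "\<dots> = integral\<^sup>L lborel (\<lambda>y. indicator K y *\<^sub>R (g y - f n y))"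
      unfolding set_lebesgue_integral_def using int[OF g] int[OF f, of n]
      by (simp add: scaleR_diff_right)
    also have "norm \<dots> \<le> integral\<^sup>L lborel (\<lambda>y. indicator K y * e)"
    proof (rule Bochner_Integration.integral_norm_bound_integral)
      show "integrable lborel (\<lambda>y. indicator K y *\<^sub>R (g y - f n y))"
        by (intro int continuous_intros g f)
      show "integrable lborel (\<lambda>y. indicator K y * e)"
        using borel_integrable_compact[OF K continuous_on_const, of e] by simp
      show "norm (indicator K y *\<^sub>R (g y - f n y)) \<le> indicator K y * e" for y
        using n e by (auto simp: indicator_def dist_norm norm_minus_commute less_imp_le)
    qed
    also have "\<dots> = e * measure lborel K" using K by (simp add: borel_compact)
    finally show ?thesis .
  qed
  note bound = this
  have "norm (LINT y:K|lborel. g y) \<le> 0 + e" if e: "0 < e" for e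
  proof -
    have m: "0 \<le> measure lborel K" by (rule measure_nonneg)
    have aux: "0 < e / (m + 1)" "e / (m + 1) * m \<le> e" if "0 \<le> m" for m
      using e that by (auto simp: divide_simps distrib_left)
    \<comment> \<open>The denominator is increased by 1 because K may be a null set.\<close>
    have "norm (LINT y:K|lborel. g y) \<le> e / (measure lborel K + 1) * measure lborel K"
      by (rule bound[OF aux(1)[OF m]])
    also have "\<dots> \<le> e" by (rule aux(2)[OF m])
    finally show ?thesis by simp
  qed
  hence "norm (LINT y:K|lborel. g y) \<le> 0" by (rule field_le_epsilon)
  thus ?thesis by simp
qed

text \<open>For \<open>C^1\<close> approximants this says that the divergence of the field \<beta>
  \<phi> \<psi> integrates to 0; the identity involves only values and L-derivatives of the
  approximants, so it survives the uniform limit.\<close>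

lemma strong_deriv_by_parts:
  fixes \<beta> :: "'a::euclidean_space \<Rightarrow> 'a \<Rightarrow> complex"
  assumes K: "compact K" "open W" "K \<subseteq> W"
    and \<beta>: "\<And>c. c \<in> Basis \<Longrightarrow> Ck_on 1 (\<beta> c) W"
    and \<phi>: "strong_deriv \<beta> K \<phi> g" and \<psi>: "Ck_on 1 \<psi> UNIV"
    and K0: "compact K0" "K0 \<subseteq> interior K" "\<And>y. y \<notin> K0 \<Longrightarrow> \<psi> y = 0"
  shows "(LINT y:K|lborel. (g y + (\<Sum>b\<in>Basis. partial_deriv b (\<beta> b) y) * \<phi> y) * \<psi> y + \<phi> y * vfield \<beta> \<psi> y) = 0"
proof -
  have cont\<beta>: "continuous_on K (\<beta> b)" if "b \<in> Basis" for b
    using Ck_on_continuous[OF \<beta>[OF that]] K(3) by (rule continuous_on_subset)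
  have contd: "continuous_on K (\<lambda>y. \<Sum>b\<in>Basis. partial_deriv b (\<beta> b) y)"
    using \<beta> K(3) by (intro continuous_intros) (auto intro: continuous_on_subset)
  have cont\<psi>: "continuous_on K \<psi>" using Ck_on_continuous[OF \<psi>] by (rule continuous_on_subset) auto
  have contL\<psi>: "continuous_on K (vfield \<beta> \<psi>)"
    by (rule continuous_on_vfield[OF \<psi> _ cont\<beta>]) auto
  obtain U \<phi>n where U: "open U" "K \<subseteq> U" "\<And>n. Ck_on 1 (\<phi>n n) U"
    "uniform_limit K \<phi>n \<phi> sequentially" "uniform_limit K (\<lambda>n. vfield \<beta> (\<phi>n n)) g sequentially"
    "continuous_on K \<phi>" "continuous_on K g" "bounded (\<phi> ` K)" "bounded (g ` K)"
    using strong_derivE[OF \<phi> K(1) cont\<beta>] by metis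
  define s where "s = (\<lambda>\<phi> g y. (g y + (\<Sum>b\<in>Basis. partial_deriv b (\<beta> b) y) * \<phi> y) * \<psi> y + \<phi> y * vfield \<beta> \<psi> y)"
  have "(LINT y:K|lborel. s \<phi> g y) = 0"
  proof (rule uniform_limit_set_integral[OF K(1)])
    show "continuous_on K (s (\<phi>n n) (vfield \<beta> (\<phi>n n)))" for n
      unfolding s_def
      by (intro continuous_intros contd cont\<psi> contL\<psi> continuous_on_vfield[OF U(3) U(2) cont\<beta>]
          continuous_on_subset[OF Ck_on_continuous[OF U(3)] U(2)])
    have c0: "uniform_limit K (\<lambda>n. h) h sequentially" for h :: "'a \<Rightarrow> complex"
      by (rule uniform_limitI) auto
    have bd: "bounded (h ` K)" if "continuous_on K h" for h :: "'a \<Rightarrow> complex"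
      using K(1) that by (intro compact_imp_bounded compact_continuous_image)
    show "uniform_limit K (\<lambda>n. s (\<phi>n n) (vfield \<beta> (\<phi>n n))) (s \<phi> g) sequentially"
      unfolding s_def
      by (intro uniform_limit_add uniform_lim_mult U(4,5) c0 bd contd cont\<psi> contL\<psi> U(6,7) continuous_intros)
    fix n
    define O' where "O' = interior K"
    \<comment> \<open>The coefficients and approximants are known only near K, but \<psi> vanishes
      off K0. As the interior of K and the complement of K0 cover the space, extension by zero is
      \<open>C^1\<close> everywhere.\<close>
    define F where "F = (\<lambda>b y. if y \<in> O' then \<beta> b y * \<phi>n n y * \<psi> y else 0)"
    have O': "open O'" "O' \<subseteq> K" "open (- K0)" "O' \<union> - K0 = UNIV"
      using K0 interior_subset by (auto simp: O'_def compact_imp_closed)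
    have F1: "F b y = \<beta> b y * \<phi>n n y * \<psi> y" if "y \<in> O'" for b y using that by (simp add: F_def)
    have F2: "F b y = 0" if "y \<in> - K0" for b y using that K0(3) by (simp add: F_def)
    have C1: "Ck_on 1 (\<lambda>y. \<beta> b y * \<phi>n n y * \<psi> y) O'" if "b \<in> Basis" for b
      using O' K U(2) by (intro Ck_on_mult Ck_on_subset[OF \<beta>[OF that]] Ck_on_subset[OF U(3)] Ck_on_subset[OF \<psi>]) auto
    have CF: "Ck_on 1 (F b) UNIV" if b: "b \<in> Basis" for b
    proof -
      have "Ck_on 1 (F b) O'"
        using C1[OF b] Ck_on_cong[OF O'(1) F1, of "\<lambda>y. y" 1 "\<lambda>_. b"] by blast
      moreover have "Ck_on 1 (F b) (- K0)"
        using Ck_on_cong[OF O'(3), of "F b" "\<lambda>_. 0"] F2 Ck_on_const by metis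
      ultimately have "Ck_on 1 (F b) (O' \<union> - K0)"
        using O'(1,3) by (auto intro!: continuous_on_open_Un)
      thus ?thesis using O' by simp
    qed
    have "(\<Sum>b\<in>Basis. integral\<^sup>L lborel (partial_deriv b (F b))) = 0"
      using integral_partial_deriv_eq_0[OF CF K0(1)] F2 by simp
    moreover have "(\<Sum>b\<in>Basis. integral\<^sup>L lborel (partial_deriv b (F b))) =
        integral\<^sup>L lborel (\<lambda>y. \<Sum>b\<in>Basis. partial_deriv b (F b) y)"
    proof (rule Bochner_Integration.integral_sum[symmetric])
      fix b :: 'a assume b: "b \<in> Basis"
      show "integrable lborel (partial_deriv b (F b))"
      proof (rule continuous_compact_support_integrable[OF _ K0(1)])
        show "continuous_on UNIV (partial_deriv b (F b))" using CF[OF b] b by auto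
        show "partial_deriv b (F b) y = 0" if "y \<notin> K0" for y
          using partial_deriv_cong_open[OF O'(3), of y "F b" "\<lambda>_. 0"] that F2 by (simp add: partial_deriv_const)
      qed
    qed
    moreover have "(\<Sum>b\<in>Basis. partial_deriv b (F b) y) = indicator K y *\<^sub>R s (\<phi>n n) (vfield \<beta> (\<phi>n n)) y" for y
    proof (cases "y \<in> O'")
      case True
      hence "y \<in> K" "y \<in> W" "y \<in> U" using O' K U by auto
      hence d: "\<phi>n n differentiable (at y)" "\<psi> differentiable (at y)" "\<And>b. b \<in> Basis \<Longrightarrow> \<beta> b differentiable (at y)"
        using U(3) \<psi> \<beta> by auto
      have "partial_deriv b (F b) y = (\<beta> b y * partial_deriv b (\<phi>n n) y + partial_deriv b (\<beta> b) y * \<phi>n n y) * \<psi> y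
          + \<phi>n n y * (\<beta> b y * partial_deriv b \<psi> y)" if b: "b \<in> Basis" for b
        using partial_deriv_cong_open[OF O'(1) True, of "F b" "\<lambda>y. \<beta> b y * \<phi>n n y * \<psi> y" b] F1 d b
        by (simp add: partial_deriv_mult differentiable_mult algebra_simps)
      thus ?thesis using \<open>y \<in> K\<close>
        by (simp add: s_def vfield_def sum.distrib sum_distrib_left sum_distrib_right distrib_right)
    next
      case False
      hence y: "y \<in> - K0" using O' by auto
      have "partial_deriv b (F b) y = 0" for b
        using partial_deriv_cong_open[OF O'(3) y, of "F b" "\<lambda>_. 0"] F2 by (simp add: partial_deriv_const)
      moreover have "vfield \<beta> \<psi> y = 0"
        using partial_deriv_cong_open[OF O'(3) y, of \<psi> "\<lambda>_. 0"] K0(3) by (simp add: partial_deriv_const vfield_def)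
      ultimately show ?thesis using K0(3) y by (simp add: s_def)
    qed
    ultimately show "(LINT y:K|lborel. s (\<phi>n n) (vfield \<beta> (\<phi>n n)) y) = 0"
      by (simp add: set_lebesgue_integral_def)
  qed
  thus ?thesis by (simp add: s_def)
qed


section \<open>Jets along the graph of a solution\<close>

text \<open>The letters stand for the derivations with respect to the base coordinates, the unknowns, the
  first derivatives of the unknowns, and one further coordinate, the reciprocal of the symbol.\<close>

datatype ('a, 'm) letter = LY 'a | LV 'm | LW 'm 'a | LR

text \<open>These are the variables on which the data of the system depend. The remaining letters
  enter through total derivatives and through the reciprocal of the symbol.\<close>

definition letters0 :: "('a::euclidean_space, 'm::finite) letter set" where
  "letters0 = LY ` Basis \<union> range LV"

definition letters :: "('a::euclidean_space, 'm::finite) letter set" where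
  "letters = letters0 \<union> case_prod LW ` (UNIV \<times> Basis) \<union> {LR}"

lemma letters0_subset: "letters0 \<subseteq> letters"
  by (auto simp: letters_def)

lemma finite_letters [simp]: "finite letters0" "finite letters"
  by (auto simp: letters_def letters0_def)

lemma letters_intros [intro, simp]:
  "b \<in> Basis \<Longrightarrow> LY b \<in> letters0" "LV m \<in> letters0"
  "b \<in> Basis \<Longrightarrow> LY b \<in> letters" "LV m \<in> letters" "b \<in> Basis \<Longrightarrow> LW m b \<in> letters" "LR \<in> letters"
  by (auto simp: letters_def letters0_def)

lemma sum_letters0: "(\<Sum>l\<in>letters0. g l) = (\<Sum>b\<in>Basis. g (LY b)) + (\<Sum>m\<in>UNIV. g (LV m))"
proof -
  have "(\<Sum>l\<in>letters0. g l) = sum g (LY ` Basis) + sum g (range LV)"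
    unfolding letters0_def by (intro sum.union_disjoint) auto
  also have "sum g (LY ` Basis) = (\<Sum>b\<in>Basis. g (LY b))"
    by (subst sum.reindex) (auto simp: inj_on_def)
  also have "sum g (range LV) = (\<Sum>m\<in>UNIV. g (LV m))"
    by (subst sum.reindex) (auto simp: inj_on_def)
  finally show ?thesis .
qed

lemma sum_letters_eq_letters0:
  assumes "\<And>l. l \<in> letters - letters0 \<Longrightarrow> g l = 0"
  shows "(\<Sum>l\<in>letters. g l) = (\<Sum>l\<in>letters0. g l)"
  using assms letters0_subset by (intro sum.mono_neutral_right) auto

text \<open>The classical partial derivative in the format of \<open>leibniz_rel\<close>, so that
  the algebra of \<open>jcompat\<close> also yields the ordinary chain rule. The \<open>C^1\<close>
  condition is included to make the relation stable under sums and products.\<close>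

definition pder_rel :: "'a::euclidean_space set \<Rightarrow> 'a \<Rightarrow> ('a \<Rightarrow> complex) \<Rightarrow> ('a \<Rightarrow> complex) \<Rightarrow> bool" where
  "pder_rel W c \<phi> g \<longleftrightarrow> Ck_on 1 \<phi> W \<and> (\<forall>y\<in>W. partial_deriv c \<phi> y = g y)"

lemma leibniz_rel_pder_rel:
  assumes "open W"
  shows "leibniz_rel (pder_rel W c)"
proof -
  have d: "\<phi> differentiable (at y)" if "Ck_on 1 \<phi> W" "y \<in> W" for \<phi> :: "'a \<Rightarrow> complex" and y
    using that by simp
  show ?thesis
    unfolding leibniz_rel_def pder_rel_def
    using d by (auto simp: partial_deriv_add partial_deriv_mult partial_deriv_const
        simp del: Ck_on.simps One_nat_def intro: Ck_on_add[OF assms] Ck_on_mult[OF assms])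
qed

text \<open>The derivative along c of each variable on the graph. The value 0 at the letters
  \<open>LW\<close> and \<open>LR\<close> is harmless: it only meets jets that vanish there.\<close>

definition tcoef :: "('m \<Rightarrow> 'a::euclidean_space \<Rightarrow> complex) \<Rightarrow> 'a \<Rightarrow> ('a, 'm) letter \<Rightarrow> 'a \<Rightarrow> complex" where
  "tcoef v c l y = (case l of LY b \<Rightarrow> if b = c then 1 else 0 | LV m \<Rightarrow> partial_deriv c (v m) y
     | LW m b \<Rightarrow> 0 | LR \<Rightarrow> 0)"

text \<open>Jets of functions of (y, v) evaluated on the graph of v. Independence of the additional
  variables is the vanishing off \<open>letters0\<close>, and smooth dependence is the chain rule in
  every coordinate direction.\<close>

definition graph_jet :: "'a::euclidean_space set \<Rightarrow> ('m::finite \<Rightarrow> 'a \<Rightarrow> complex) \<Rightarrow>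
    ('a \<Rightarrow> ('a, 'm) letter jet) \<Rightarrow> bool" where
  "graph_jet W v F \<longleftrightarrow> (\<forall>y w. w \<notin> lists letters0 \<longrightarrow> F y w = 0) \<and>
     (\<forall>c\<in>Basis. jcompat (pder_rel W c) letters (tcoef v c) F)"

lemma jmul_eq_0:
  assumes "\<And>w. w \<notin> lists S \<Longrightarrow> F w = 0" "\<And>w. w \<notin> lists S \<Longrightarrow> G w = 0" "w \<notin> lists S"
  shows "jmul F G w = 0"
proof -
  have zero: "jmul (\<lambda>_. 0) G w = 0" "jmul G (\<lambda>_. 0) w = 0" for G :: "'a jet" and w
    by (induction w arbitrary: G) simp_all
  show ?thesis using assms
  proof (induction w arbitrary: F G)
    case (Cons b w)
    show ?case
    proof (cases "b \<in> S")
      case True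
      hence "w \<notin> lists S" using Cons.prems(3) by auto
      thus ?thesis using Cons True by simp
    next
      case False
      thus ?thesis using Cons.prems(1,2) zero by simp
    qed
  qed simp
qed

lemma graph_jet_add: "open W \<Longrightarrow> graph_jet W v F \<Longrightarrow> graph_jet W v G \<Longrightarrow> graph_jet W v (\<lambda>y w. F y w + G y w)"
  by (simp add: graph_jet_def jcompat_add leibniz_rel_pder_rel)

lemma graph_jet_uminus: "open W \<Longrightarrow> graph_jet W v F \<Longrightarrow> graph_jet W v (\<lambda>y w. - F y w)"
  by (simp add: graph_jet_def jcompat_uminus leibniz_rel_pder_rel)

lemma graph_jet_jmul: "open W \<Longrightarrow> graph_jet W v F \<Longrightarrow> graph_jet W v G \<Longrightarrow> graph_jet W v (\<lambda>y. jmul (F y) (G y))"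
  unfolding graph_jet_def
  by (intro conjI allI impI ballI jmul_eq_0[of letters0] jcompat_jmul leibniz_rel_pder_rel) auto

lemma graph_jet_sum:
  "open W \<Longrightarrow> finite T \<Longrightarrow> (\<And>l. l \<in> T \<Longrightarrow> graph_jet W v (F l)) \<Longrightarrow> graph_jet W v (\<lambda>y w. \<Sum>l\<in>T. F l y w)"
  by (simp add: graph_jet_def jcompat_sum leibniz_rel_pder_rel)

lemma graph_jet_jderiv: "graph_jet W v F \<Longrightarrow> b \<in> letters0 \<Longrightarrow> graph_jet W v (\<lambda>y. jderiv b (F y))"
  using letters0_subset by (auto simp: graph_jet_def intro!: jcompat_jderiv)

lemma graph_jet_jconst: "open W \<Longrightarrow> graph_jet W v (\<lambda>y. jconst z)"
  by (auto simp: graph_jet_def jconst_def[of z] jcompat_jconst[unfolded jconst_def] leibniz_rel_pder_rel)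

lemma graph_jet_jcoord_LY:
  assumes W: "open W" and b: "b \<in> Basis"
  shows "graph_jet W v (\<lambda>y. jcoord (LY b) (complex_of_real (y \<bullet> b)))"
  unfolding graph_jet_def
proof (intro conjI ballI allI impI jcompat_jcoord)
  fix c :: 'a assume c: "c \<in> Basis"
  have "((\<lambda>y. complex_of_real (y \<bullet> b)) has_derivative (\<lambda>h. complex_of_real (h \<bullet> b))) (at y)" for y
    by (intro has_derivative_of_real has_derivative_inner_left has_derivative_ident)
  hence "partial_deriv c (\<lambda>y. complex_of_real (y \<bullet> b)) y = (if b = c then 1 else 0)" for y
    using b c partial_deriv_at[of "\<lambda>y. complex_of_real (y \<bullet> b)" "\<lambda>h. complex_of_real (h \<bullet> b)" y c]
    by (auto simp: inner_Basis)
  moreover have "Ck_on 1 (\<lambda>y. complex_of_real (y \<bullet> b)) W"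
    by (intro Ck_on_bounded_linear bounded_linear_compose[OF bounded_linear_of_real bounded_linear_inner_left])
  ultimately show "pder_rel W c (\<lambda>y. complex_of_real (y \<bullet> b)) (tcoef v c (LY b))"
    by (simp add: pder_rel_def tcoef_def del: Ck_on.simps One_nat_def)
qed (use W b in \<open>auto simp: jcoord_def leibniz_rel_pder_rel\<close>)

lemma graph_jet_jcoord_LV:
  assumes W: "open W" and "Ck_on 1 (v m) W"
  shows "graph_jet W v (\<lambda>y. jcoord (LV m) (v m y))"
  unfolding graph_jet_def
proof (intro conjI ballI allI impI jcompat_jcoord)
  fix c :: 'a assume c: "c \<in> Basis"
  show "pder_rel W c (v m) (tcoef v c (LV m))"
    using assms by (simp add: pder_rel_def tcoef_def del: Ck_on.simps One_nat_def)
qed (use W in \<open>auto simp: jcoord_def leibniz_rel_pder_rel\<close>)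

lemma graph_jet_C1:
  fixes v :: "'m::finite \<Rightarrow> 'a::euclidean_space \<Rightarrow> complex"
  assumes F: "graph_jet W v F" and w: "w \<in> lists letters"
  shows "Ck_on 1 (\<lambda>y. F y w) W"
    and "y \<in> W \<Longrightarrow> c \<in> Basis \<Longrightarrow>
      partial_deriv c (\<lambda>y. F y w) y = F y (w @ [LY c]) + (\<Sum>m\<in>UNIV. partial_deriv c (v m) y * F y (w @ [LV m]))"
proof -
  have rel: "pder_rel W c (\<lambda>y. F y w) (\<lambda>y. \<Sum>l\<in>letters. tcoef v c l y * F y (w @ [l]))" if "c \<in> Basis" for c
    using F w that by (auto simp: graph_jet_def jcompat_def)
  \<comment> \<open>The \<open>C^1\<close> property is part of the relation for each direction, so
    any one basis vector supplies it.\<close>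
  show "Ck_on 1 (\<lambda>y. F y w) W"
    using rel[of "SOME b. b \<in> Basis"] some_in_eq[of "Basis :: 'a set"]
    by (auto simp: pder_rel_def simp del: Ck_on.simps One_nat_def)
  assume y: "y \<in> W" and c: "c \<in> Basis"
  have "partial_deriv c (\<lambda>y. F y w) y = (\<Sum>l\<in>letters. tcoef v c l y * F y (w @ [l]))"
    using rel[OF c] y by (simp add: pder_rel_def)
  also have "\<dots> = (\<Sum>l\<in>letters0. tcoef v c l y * F y (w @ [l]))"
    using F by (intro sum_letters_eq_letters0) (auto simp: graph_jet_def)
  also have "\<dots> = (\<Sum>b\<in>Basis. (if b = c then 1 else 0) * F y (w @ [LY b])) +
      (\<Sum>m\<in>UNIV. partial_deriv c (v m) y * F y (w @ [LV m]))"
    by (simp add: sum_letters0 tcoef_def)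
  also have "(\<Sum>b\<in>Basis. (if b = c then 1 else 0) * F y (w @ [LY b])) = (\<Sum>b\<in>Basis. if b = c then F y (w @ [LY b]) else 0)"
    by (intro sum.cong) auto
  finally show "partial_deriv c (\<lambda>y. F y w) y = F y (w @ [LY c]) + (\<Sum>m\<in>UNIV. partial_deriv c (v m) y * F y (w @ [LV m]))"
    using c by simp
qed

text \<open>The total derivative F_b + \<Sum>_m (\<partial>_b v_m) F_(v_m), read as a function of
  the enlarged variables: \<partial>_b v_m is the coordinate \<open>LW m b\<close>, along which
  further derivatives can be taken.\<close>

definition total_jet :: "('m::finite \<Rightarrow> 'a::euclidean_space \<Rightarrow> complex) \<Rightarrow> 'a \<Rightarrow>
    ('a \<Rightarrow> ('a, 'm) letter jet) \<Rightarrow> 'a \<Rightarrow> ('a, 'm) letter jet" where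
  "total_jet v b F y = (\<lambda>w. jderiv (LY b) (F y) w +
     (\<Sum>m\<in>UNIV. jmul (jcoord (LW m b) (partial_deriv b (v m) y)) (jderiv (LV m) (F y)) w))"

lemma partial_deriv_graph_jet:
  "graph_jet W v F \<Longrightarrow> y \<in> W \<Longrightarrow> b \<in> Basis \<Longrightarrow> partial_deriv b (\<lambda>y. F y []) y = total_jet v b F y []"
  using graph_jet_C1(2)[of W v F "[]" y b] by (simp add: total_jet_def jcoord_def)

lemma vfield_graph_jet:
  assumes F: "graph_jet W v F" and w: "w \<in> lists letters" and y: "y \<in> W"
  shows "vfield \<beta> (\<lambda>y. F y w) y = (\<Sum>b\<in>Basis. \<beta> b y * F y (w @ [LY b])) +
    (\<Sum>m\<in>UNIV. vfield \<beta> (v m) y * F y (w @ [LV m]))"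
proof -
  have "(\<Sum>b\<in>Basis. \<Sum>m\<in>UNIV. \<beta> b y * (partial_deriv b (v m) y * F y (w @ [LV m]))) =
      (\<Sum>m\<in>UNIV. \<Sum>b\<in>Basis. \<beta> b y * (partial_deriv b (v m) y * F y (w @ [LV m])))"
    by (rule sum.swap)
  thus ?thesis
    by (simp add: vfield_def graph_jet_C1(2)[OF F w y] distrib_left sum.distrib sum_distrib_left
        sum_distrib_right mult.assoc)
qed

text \<open>A first-order system in which every unknown has the same principal part \<beta>, and
  both \<beta> and the right sides H depend on y and the unknowns but not on their derivatives. The
  nonlinear equation is brought to this form with the unknowns u and u_x.\<close>

locale quasilinear =
  fixes M :: "nat \<Rightarrow> real" and W :: "'a::euclidean_space set" and v :: "'m::finite \<Rightarrow> 'a \<Rightarrow> complex"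
    and B :: "'a \<Rightarrow> 'a \<Rightarrow> ('a, 'm) letter jet" and H :: "'m \<Rightarrow> 'a \<Rightarrow> ('a, 'm) letter jet"
  assumes M: "regular_sequence M" and W: "open W"
    and v: "\<And>m. Ck_on 1 (v m) W"
    and B: "\<And>b. b \<in> Basis \<Longrightarrow> graph_jet W v (B b)"
    and H: "\<And>m. graph_jet W v (H m)"
    and CM_B: "\<And>b K. b \<in> Basis \<Longrightarrow> compact K \<Longrightarrow> K \<subseteq> W \<Longrightarrow> CM_jets M letters K (B b)"
    and CM_H: "\<And>m K. compact K \<Longrightarrow> K \<subseteq> W \<Longrightarrow> CM_jets M letters K (H m)"
    and system: "\<And>m y. y \<in> W \<Longrightarrow> vfield (\<lambda>b y. B b y []) (v m) y = H m y []"
begin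

abbreviation \<beta> :: "'a \<Rightarrow> 'a \<Rightarrow> complex" where
  "\<beta> \<equiv> \<lambda>b y. B b y []"

text \<open>The jet at \<open>y'\<close> of the symbol of the operator on the FBI phase based at \<open>y\<close>, divided by the
  length of the frequency, whose direction is \<open>\<omega>\<close>.\<close>

definition q :: "'a \<Rightarrow> 'a \<Rightarrow> 'a \<Rightarrow> ('a, 'm) letter jet" where
  "q y \<omega> y' = (\<lambda>w. \<Sum>b\<in>Basis. jmul (B b y') (\<lambda>w.
     jconst (- \<i> * of_real (\<omega> \<bullet> b) + 2 * of_real (y \<bullet> b)) w +
     jmul (jconst (- 2)) (jcoord (LY b) (of_real (y' \<bullet> b))) w) w)"

definition r :: "'a \<Rightarrow> 'a \<Rightarrow> 'a \<Rightarrow> ('a, 'm) letter jet" where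
  "r y \<omega> y' = jcoord LR (inverse (q y \<omega> y' []))"

text \<open>L applied to each variable: L y_b = \<beta>_b, L v_m = H_m, L(1/q) = -(1/q)^2 L q, and,
  by differentiating the system along b, L(\<partial>_b v_m) = D_b H_m - \<Sum>_c (D_b \<beta>_c)
  \<partial>_c v_m with D_b the total derivative.\<close>

definition coef :: "'a \<Rightarrow> 'a \<Rightarrow> ('a, 'm) letter \<Rightarrow> 'a \<Rightarrow> ('a, 'm) letter jet" where
  "coef y \<omega> l y' = (case l of LY b \<Rightarrow> B b y' | LV m \<Rightarrow> H m y'
     | LW m b \<Rightarrow> (\<lambda>w. total_jet v b (H m) y' w +
          - (\<Sum>c\<in>Basis. jmul (total_jet v b (B c) y') (jcoord (LW m c) (partial_deriv c (v m) y')) w))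
     | LR \<Rightarrow> (\<lambda>w. - jmul (jmul (r y \<omega> y') (r y \<omega> y'))
          (\<lambda>w. (\<Sum>b\<in>Basis. jmul (B b y') (jderiv (LY b) (q y \<omega> y')) w) +
               (\<Sum>m\<in>UNIV. jmul (H m y') (jderiv (LV m) (q y \<omega> y')) w)) w))"

text \<open>The divergence of \<beta>. Total derivatives are required, as \<beta> depends on the
  point also through the unknowns.\<close>

definition dv :: "'a \<Rightarrow> ('a, 'm) letter jet" where
  "dv y' = (\<lambda>w. \<Sum>b\<in>Basis. total_jet v b (B b) y' w)"

definition iter :: "'m \<Rightarrow> nat \<Rightarrow> 'a \<Rightarrow> 'a \<Rightarrow> 'a \<Rightarrow> ('a, 'm) letter jet" where
  "iter m k y \<omega> y' =
     (jstep letters (\<lambda>l. coef y \<omega> l y') (dv y') (r y \<omega> y') ^^ k) (jcoord (LV m) (v m y'))"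

lemma coef_LW: "coef y \<omega> (LW m b) = (\<lambda>y' w. total_jet v b (H m) y' w +
    - (\<Sum>c\<in>Basis. jmul (total_jet v b (B c) y') (jcoord (LW m c) (partial_deriv c (v m) y')) w))"
  and coef_LR: "coef y \<omega> LR = (\<lambda>y' w. - jmul (jmul (r y \<omega> y') (r y \<omega> y'))
    (\<lambda>w. (\<Sum>b\<in>Basis. jmul (B b y') (jderiv (LY b) (q y \<omega> y')) w) +
         (\<Sum>m\<in>UNIV. jmul (H m y') (jderiv (LV m) (q y \<omega> y')) w)) w)"
  by (simp_all add: coef_def fun_eq_iff)

lemma q_Nil: "q y \<omega> y' [] = (\<Sum>b\<in>Basis. \<beta> b y' * (- \<i> * of_real (\<omega> \<bullet> b) + 2 * of_real ((y - y') \<bullet> b)))"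
  by (simp add: q_def jconst_def jcoord_def inner_diff_left algebra_simps)

lemma graph_jet_q: "graph_jet W v (q y \<omega>)"
  unfolding q_def[abs_def] using W
  by (intro graph_jet_sum graph_jet_jmul graph_jet_add B graph_jet_jconst graph_jet_jcoord_LY) auto

lemma r_Nil: "r y \<omega> y' [] = inverse (q y \<omega> y' [])"
  by (simp add: r_def jcoord_def)

lemma cont_\<beta>: "b \<in> Basis \<Longrightarrow> K \<subseteq> W \<Longrightarrow> continuous_on K (\<beta> b)"
  by (rule continuous_on_subset[OF Ck_on_continuous[OF graph_jet_C1(1)[OF B]]]) auto

lemma C1_\<beta>: "b \<in> Basis \<Longrightarrow> Ck_on 1 (\<beta> b) W"
  by (rule graph_jet_C1(1)[OF B]) auto

lemma C1_H: "Ck_on 1 (\<lambda>y. H m y []) W"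
  by (rule graph_jet_C1(1)[OF H]) auto

context
  fixes K y \<omega>
  assumes K: "compact K" "K \<subseteq> W" and q0: "\<And>y'. y' \<in> K \<Longrightarrow> q y \<omega> y' [] \<noteq> 0"
begin

abbreviation Rel :: "('a \<Rightarrow> complex) \<Rightarrow> ('a \<Rightarrow> complex) \<Rightarrow> bool" where
  "Rel \<equiv> strong_deriv \<beta> K"

abbreviation a :: "('a, 'm) letter \<Rightarrow> 'a \<Rightarrow> complex" where
  "a \<equiv> \<lambda>l y'. coef y \<omega> l y' []"

lemma leibniz_Rel: "leibniz_rel Rel"
  using K cont_\<beta> by (intro leibniz_rel_strong_deriv) auto

text \<open>Along L the chain rule does not see the individual derivatives of the unknowns, only the
  combination L v_m, which the system replaces by H_m. These jets are \<open>C^1\<close> on W, so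
  the relation holds classically.\<close>

lemma jcompat_graph_jet:
  assumes F: "graph_jet W v F"
  shows "jcompat Rel letters a F"
  unfolding jcompat_def
proof
  fix w :: "('a, 'm) letter list" assume w: "w \<in> lists letters"
  have "(\<Sum>l\<in>letters. a l y * F y (w @ [l])) = vfield \<beta> (\<lambda>y. F y w) y" if "y \<in> K" for y
  proof -
    have yW: "y \<in> W" using that K by auto
    have "(\<Sum>l\<in>letters. a l y * F y (w @ [l])) = (\<Sum>l\<in>letters0. a l y * F y (w @ [l]))"
      using F by (intro sum_letters_eq_letters0) (auto simp: graph_jet_def)
    also have "\<dots> = vfield \<beta> (\<lambda>y. F y w) y"
      unfolding vfield_graph_jet[OF F w yW] sum_letters0 system[OF yW] by (simp add: coef_def)
    finally show ?thesis .
  qed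
  thus "Rel (\<lambda>y. F y w) (\<lambda>y. \<Sum>l\<in>letters. a l y * F y (w @ [l]))"
    using K by (intro strong_deriv_classical[OF W _ graph_jet_C1(1)[OF F w]]) auto
qed

text \<open>The only variable for which the closure in \<open>strong_deriv\<close> is essential:
  \<partial>_b v_m is merely continuous, and L acts on it through the limit of difference
  quotients.\<close>

lemma jcompat_LW:
  assumes b: "b \<in> Basis"
  shows "jcompat Rel letters a (\<lambda>y. jcoord (LW m b) (partial_deriv b (v m) y))"
proof (rule jcompat_jcoord[OF leibniz_Rel])
  have 1: "Rel (partial_deriv b (v m)) (\<lambda>y. partial_deriv b (\<lambda>y. H m y []) y -
      (\<Sum>c\<in>Basis. partial_deriv b (\<beta> c) y * partial_deriv c (v m) y))"
    using b by (intro strong_deriv_partial_deriv[OF K(1) W K(2)] C1_\<beta> v C1_H system)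
  have "a (LW m b) y' = partial_deriv b (\<lambda>y. H m y []) y' -
      (\<Sum>c\<in>Basis. partial_deriv b (\<beta> c) y' * partial_deriv c (v m) y')" if "y' \<in> K" for y'
    using that K b
    by (auto simp: coef_def partial_deriv_graph_jet[OF H] partial_deriv_graph_jet[OF B] jcoord_def intro!: sum.cong)
  thus "Rel (partial_deriv b (v m)) (a (LW m b))"
    by (intro strong_deriv_cong[OF 1]) simp
qed (use b in auto)

lemma jcompat_r: "jcompat Rel letters a (r y \<omega>)"
  unfolding r_def[abs_def]
proof (rule jcompat_jcoord[OF leibniz_Rel])
  let ?q = "\<lambda>y'. q y \<omega> y' []"
  have C1: "Ck_on 1 ?q W" by (rule graph_jet_C1(1)[OF graph_jet_q]) auto
  define U where "U = {y'\<in>W. ?q y' \<noteq> 0}"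
  have U: "open U" "K \<subseteq> U" "U \<subseteq> W"
  proof -
    have "U = W \<inter> ?q -` (- {0})" by (auto simp: U_def)
    thus "open U" using continuous_open_preimage[OF Ck_on_continuous[OF C1] W, of "- {0}"] by auto
  qed (use K q0 in \<open>auto simp: U_def\<close>)
  show "Rel (\<lambda>y'. inverse (?q y')) (a LR)"
  proof (rule strong_deriv_classical[OF U(1,2)])
    show "Ck_on 1 (\<lambda>y'. inverse (?q y')) U"
      by (intro Ck_on_inverse Ck_on_subset[OF C1] U) (auto simp: U_def)
    fix y' assume y': "y' \<in> K"
    hence yW: "y' \<in> W" using K by auto
    have d: "?q differentiable (at y')" using C1 yW by simp
    have "vfield \<beta> (\<lambda>y'. inverse (?q y')) y' = - (inverse (?q y') * inverse (?q y')) * vfield \<beta> ?q y'"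
      using partial_deriv_inverse[OF d q0[OF y']]
      by (simp add: vfield_def sum_distrib_left sum_negf mult_ac)
    also have "vfield \<beta> ?q y' = (\<Sum>b\<in>Basis. \<beta> b y' * q y \<omega> y' [LY b]) + (\<Sum>m\<in>UNIV. H m y' [] * q y \<omega> y' [LV m])"
      using vfield_graph_jet[OF graph_jet_q _ yW, of "[]" \<beta> y \<omega>] system[OF yW] by simp
    finally show "a LR y' = vfield \<beta> (\<lambda>y'. inverse (?q y')) y'"
      by (simp add: coef_def r_Nil)
  qed
qed auto

lemma jcompat_total_jet:
  assumes "graph_jet W v F" "b \<in> Basis"
  shows "jcompat Rel letters a (total_jet v b F)"
  unfolding total_jet_def[abs_def] using assms
  by (intro jcompat_add jcompat_sum jcompat_jmul jcompat_jderiv jcompat_LW leibniz_Rel jcompat_graph_jet) auto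

text \<open>The next application of L differentiates the coefficients brought in by the previous
  ones, so these must obey the chain rule as well.\<close>

lemma jcompat_coef:
  assumes "l \<in> letters"
  shows "jcompat Rel letters a (coef y \<omega> l)"
proof (cases l)
  case (LY b)
  thus ?thesis using assms jcompat_graph_jet[OF B]
    by (auto simp: coef_def[abs_def] letters_def letters0_def)
next
  case (LV m)
  thus ?thesis using jcompat_graph_jet[OF H] by (simp add: coef_def[abs_def])
next
  case (LW m b)
  hence "b \<in> Basis" using assms by (auto simp: letters_def letters0_def)
  thus ?thesis unfolding LW coef_LW using B H
    by (intro jcompat_add jcompat_uminus jcompat_sum jcompat_jmul jcompat_total_jet jcompat_LW leibniz_Rel) auto
next
  case LR
  show ?thesis unfolding LR coef_LR
    by (intro jcompat_uminus jcompat_add jcompat_sum jcompat_jmul jcompat_jderiv jcompat_r leibniz_Rel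
        jcompat_graph_jet B H graph_jet_q) auto
qed

lemma jcompat_iter: "jcompat Rel letters a (iter m k y \<omega>)"
proof (induction k)
  case 0
  show ?case using jcompat_graph_jet[OF graph_jet_jcoord_LV[OF W v]] by (simp add: iter_def[abs_def])
next
  case (Suc k)
  have "jcompat Rel letters a (\<lambda>y'. jstep letters (\<lambda>l. coef y \<omega> l y') (dv y') (r y \<omega> y') (iter m k y \<omega> y'))"
    using Suc B unfolding dv_def[abs_def]
    by (intro jcompat_jstep jcompat_coef jcompat_r jcompat_sum jcompat_total_jet leibniz_Rel) auto
  thus ?case by (simp add: iter_def[abs_def])
qed

end

end


section \<open>Cutoff functions\<close>

text \<open>The functions p(1/x) exp(-1/x), extended by 0 to x \<le> 0, form a family closed under
  differentiation; this gives smoothness by induction over all p simultaneously.\<close>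

definition flat_exp :: "real poly \<Rightarrow> real \<Rightarrow> real" where
  "flat_exp p x = (if 0 < x then poly p (inverse x) * exp (- inverse x) else 0)"

lemma poly_mult_exp_minus_tendsto_0: "((\<lambda>t. poly p t * exp (- t)) \<longlongrightarrow> (0::real)) at_top"
proof -
  have "((\<lambda>t. \<Sum>i\<le>degree p. coeff p i * (t ^ i / exp t)) \<longlongrightarrow> (\<Sum>i\<le>degree p. coeff p i * 0)) at_top"
    by (intro tendsto_intros tendsto_power_div_exp_0)
  moreover have "(\<Sum>i\<le>degree p. coeff p i * (t ^ i / exp t)) = poly p t * exp (- t)" for t
    by (simp add: poly_altdef sum_distrib_right exp_minus divide_inverse mult.assoc)
  ultimately show ?thesis by simp
qed

text \<open>With t = 1/x one has dt/dx = -t^2, and p(t) exp(-t) has t-derivative (p' - p)(t)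
  exp(-t); hence the polynomial t^2 (p - p').\<close>

lemma DERIV_flat_exp:
  "DERIV (flat_exp p) x :> flat_exp (monom 1 2 * (p - pderiv p)) x"
proof -
  consider "0 < x" | "x < 0" | "x = 0" by linarith
  thus ?thesis
  proof cases
    case 1
    have "DERIV (\<lambda>x. poly p (inverse x) * exp (- inverse x)) x :>
        flat_exp (monom 1 2 * (p - pderiv p)) x"
      using 1 by (auto intro!: derivative_eq_intros simp: flat_exp_def poly_monom field_simps power2_eq_square)
    moreover have "eventually (\<lambda>x. poly p (inverse x) * exp (- inverse x) = flat_exp p x) (nhds x)"
      using eventually_nhds_in_open[of "{0<..}" x] 1 by (auto simp: flat_exp_def elim: eventually_mono)
    ultimately show ?thesis by (subst DERIV_cong_ev[OF refl _ refl, symmetric])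
  next
    case 2
    have "DERIV (\<lambda>x. 0) x :> flat_exp (monom 1 2 * (p - pderiv p)) x"
      using 2 by (simp add: flat_exp_def)
    moreover have "eventually (\<lambda>x. 0 = flat_exp p x) (nhds x)"
      using eventually_nhds_in_open[of "{..<0}" x] 2 by (auto simp: flat_exp_def elim: eventually_mono)
    ultimately show ?thesis by (subst DERIV_cong_ev[OF refl _ refl, symmetric])
  next
    case 3
    \<comment> \<open>The difference quotient at 0 is t p(t) exp(-t) with t = 1/h;
      \<open>pCons 0 p\<close> is the polynomial t p(t).\<close>
    have "((\<lambda>h. poly (pCons 0 p) (inverse h) * exp (- inverse h)) \<longlongrightarrow> 0) (at_right 0)"
      using filterlim_compose[OF poly_mult_exp_minus_tendsto_0[of "pCons 0 p"] filterlim_inverse_at_top_right] .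
    hence "((\<lambda>h. flat_exp p h / h) \<longlongrightarrow> 0) (at_right 0)"
      by (rule Lim_transform_eventually)
        (auto simp: flat_exp_def eventually_at_filter field_simps)
    moreover have "((\<lambda>h. flat_exp p h / h) \<longlongrightarrow> 0) (at_left 0)"
      by (rule Lim_transform_eventually[OF tendsto_const])
        (auto simp: flat_exp_def eventually_at_filter)
    ultimately have "((\<lambda>h. flat_exp p h / h) \<longlongrightarrow> 0) (at 0)"
      by (simp add: filterlim_at_split)
    thus ?thesis using 3 by (simp add: DERIV_def flat_exp_def)
  qed
qed

lemma Ck_on_flat_exp:
  fixes N :: "'a::euclidean_space \<Rightarrow> real"
  assumes N: "\<And>k. Ck_on k (\<lambda>y. complex_of_real (N y)) UNIV"
  shows "Ck_on k (\<lambda>y. complex_of_real (flat_exp p (N y))) UNIV"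
proof (induction k arbitrary: p)
  have d: "((\<lambda>y. complex_of_real (flat_exp p (N y))) has_derivative
      (\<lambda>h. complex_of_real (flat_exp (monom 1 2 * (p - pderiv p)) (N y)) * partial_deriv h (\<lambda>y. complex_of_real (N y)) y)) (at y)"
    for p y
  proof -
    have dN: "((\<lambda>y. complex_of_real (N y)) has_derivative (\<lambda>h. partial_deriv h (\<lambda>y. complex_of_real (N y)) y)) (at y)"
      using N[of 1] by (intro has_derivative_partial_deriv) simp
    hence "((\<lambda>y. Re (complex_of_real (N y))) has_derivative (\<lambda>h. Re (partial_deriv h (\<lambda>y. complex_of_real (N y)) y))) (at y)"
      and i: "((\<lambda>y. Im (complex_of_real (N y))) has_derivative (\<lambda>h. Im (partial_deriv h (\<lambda>y. complex_of_real (N y)) y))) (at y)"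
      by (rule has_derivative_Re, rule has_derivative_Im)
    hence N': "(N has_derivative (\<lambda>h. Re (partial_deriv h (\<lambda>y. complex_of_real (N y)) y))) (at y)" by simp
    have im: "Im (partial_deriv h (\<lambda>y. complex_of_real (N y)) y) = 0" for h
    proof -
      have "((\<lambda>y. Im (complex_of_real (N y))) has_derivative (\<lambda>h. 0)) (at y)" by simp
      from has_derivative_unique[OF i this] show ?thesis by (simp add: fun_eq_iff)
    qed
    have "((\<lambda>y. flat_exp p (N y)) has_derivative
      (\<lambda>h. flat_exp (monom 1 2 * (p - pderiv p)) (N y) * Re (partial_deriv h (\<lambda>y. complex_of_real (N y)) y))) (at y)"
      using has_derivative_compose[OF N' DERIV_flat_exp[of p "N y", unfolded has_field_derivative_def]] by simp
    hence "((\<lambda>y. complex_of_real (flat_exp p (N y))) has_derivative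
      (\<lambda>h. complex_of_real (flat_exp (monom 1 2 * (p - pderiv p)) (N y) * Re (partial_deriv h (\<lambda>y. complex_of_real (N y)) y)))) (at y)"
      by (rule has_derivative_of_real)
    moreover have "complex_of_real (Re (partial_deriv h (\<lambda>y. complex_of_real (N y)) y)) = partial_deriv h (\<lambda>y. complex_of_real (N y)) y" for h
      using im by (simp add: complex_eq_iff)
    ultimately show ?thesis by simp
  qed
  {
    case 0
    show ?case unfolding Ck_on.simps
      by (intro continuous_at_imp_continuous_on ballI has_derivative_continuous[OF d])
  next
    case (Suc k)
    have "partial_deriv b (\<lambda>y. complex_of_real (flat_exp p (N y))) =
        (\<lambda>y. complex_of_real (flat_exp (monom 1 2 * (p - pderiv p)) (N y)) * partial_deriv b (\<lambda>y. complex_of_real (N y)) y)" for b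
      by (simp add: fun_eq_iff partial_deriv_at[OF d])
    moreover have "Ck_on k (\<lambda>y. complex_of_real (flat_exp (monom 1 2 * (p - pderiv p)) (N y)) * partial_deriv b (\<lambda>y. complex_of_real (N y)) y) UNIV"
      if "b \<in> Basis" for b
      using N[of "Suc k"] that by (intro Ck_on_mult Suc.IH) auto
    moreover have "(\<lambda>y. complex_of_real (flat_exp p (N y))) differentiable (at y)" for y
      using d unfolding differentiable_def by blast
    ultimately show ?case by simp
  }
qed

text \<open>The quotient s / (s + t), where s vanishes outside radius b and t vanishes inside radius
  a. Since a < b they have no common zero. Both are functions of the squared distance, which is
  smooth also at the centre.\<close>

lemma exists_cutoff:
  fixes x0 :: "'a::euclidean_space"
  assumes ab: "0 < a" "a < b"
  obtains \<theta> :: "'a \<Rightarrow> complex" where "smooth_on \<theta> UNIV" "\<And>x. x \<in> ball x0 a \<Longrightarrow> \<theta> x = 1" "supp \<theta> \<subseteq> cball x0 b"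
proof -
  define R where "R = (\<lambda>x. (x - x0) \<bullet> (x - x0))"
  have R: "Ck_on k (\<lambda>x. complex_of_real (R x)) UNIV" for k
  proof -
    have "Ck_on k (\<lambda>x. \<Sum>b\<in>Basis. complex_of_real ((x - x0) \<bullet> b) * complex_of_real ((x - x0) \<bullet> b)) UNIV"
      by (intro Ck_on_sum Ck_on_mult Ck_on_of_real_inner) auto
    moreover have "complex_of_real (R x) = (\<Sum>b\<in>Basis. complex_of_real ((x - x0) \<bullet> b) * complex_of_real ((x - x0) \<bullet> b))" for x
      unfolding R_def by (subst euclidean_inner) simp
    ultimately show ?thesis by simp
  qed
  define s where "s = (\<lambda>x. complex_of_real (flat_exp 1 (b\<^sup>2 - R x)))"
  define t where "t = (\<lambda>x. complex_of_real (flat_exp 1 (R x - a\<^sup>2)))"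
  have "Ck_on k (\<lambda>x. complex_of_real (b\<^sup>2 - R x)) UNIV" "Ck_on k (\<lambda>x. complex_of_real (R x - a\<^sup>2)) UNIV" for k
    using Ck_on_add[OF open_UNIV Ck_on_const Ck_on_uminus[OF open_UNIV R], of k "complex_of_real (b\<^sup>2)"]
      Ck_on_add[OF open_UNIV R Ck_on_const, of k "- complex_of_real (a\<^sup>2)"] by simp_all
  hence st: "Ck_on k s UNIV" "Ck_on k t UNIV" for k
    unfolding s_def t_def by (auto intro!: Ck_on_flat_exp simp del: of_real_diff)
  have ab2: "a\<^sup>2 < b\<^sup>2" using ab by (simp add: power_strict_mono)
  have nz: "s x + t x \<noteq> 0" for x
  proof -
    have "0 < flat_exp 1 (b\<^sup>2 - R x) + flat_exp 1 (R x - a\<^sup>2)"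
      using ab2 by (auto simp: flat_exp_def intro: add_pos_pos)
    thus ?thesis unfolding s_def t_def by (metis of_real_add of_real_eq_0_iff less_irrefl)
  qed
  define \<theta> where "\<theta> = (\<lambda>x. s x * inverse (s x + t x))"
  have R_dist: "R x = (dist x0 x)\<^sup>2" for x
    by (simp add: R_def dist_norm norm_minus_commute[of x0] power2_norm_eq_inner)
  show ?thesis
  proof
    show "smooth_on \<theta> UNIV" unfolding smooth_on_def \<theta>_def
      using nz st by (auto intro!: Ck_on_mult Ck_on_inverse Ck_on_add)
    show "\<theta> x = 1" if "x \<in> ball x0 a" for x
    proof -
      have "R x < a\<^sup>2" using that ab by (simp add: R_dist power_strict_mono)
      hence "t x = 0" by (simp add: t_def flat_exp_def)
      thus ?thesis using nz[of x] by (simp add: \<theta>_def)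
    qed
    have "{x. \<theta> x \<noteq> 0} \<subseteq> cball x0 b"
    proof
      fix x assume "x \<in> {x. \<theta> x \<noteq> 0}"
      hence "R x < b\<^sup>2" by (auto simp: \<theta>_def s_def flat_exp_def split: if_splits)
      hence "dist x0 x < b" using ab power_less_imp_less_base[of "dist x0 x" 2 b] by (simp add: R_dist)
      thus "x \<in> cball x0 b" by simp
    qed
    thus "supp \<theta> \<subseteq> cball x0 b" unfolding supp_def by (intro closure_minimal) auto
  qed
qed


section \<open>Exponential decay of FBI integrals\<close>

lemma CM_jets_reindex:
  "CM_jets M S K F \<Longrightarrow> (\<And>i. i \<in> J \<Longrightarrow> g i \<in> K) \<Longrightarrow> CM_jets M S J (\<lambda>i. F (g i))"
  by (auto simp: CM_jets_def)

lemma CM_jets_jcoord_continuous: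
  assumes "regular_sequence M" "compact K" "continuous_on K z"
  shows "CM_jets M S K (\<lambda>y. jcoord l (z y))"
proof -
  obtain C where "\<forall>y\<in>K. norm (z y) \<le> C"
    using compact_imp_bounded[OF compact_continuous_image[OF assms(3,2)]] by (auto simp: bounded_iff)
  thus ?thesis by (intro CM_jets_jcoord assms) auto
qed

lemma CM_jets_uminus: "CM_jets M S J F \<Longrightarrow> CM_jets M S J (\<lambda>i w. - F i w)"
  by (auto simp: CM_jets_def intro: jbound_uminus)

section \<open>From the recursion of integrals to decay in the frequency\<close>

lemma power_mult_exp_minus_le:
  fixes c e :: real
  assumes "0 < c" "0 \<le> e"
  shows "e ^ n * exp (- (c * e)) \<le> fact n / c ^ n"
proof -
  have "(\<Sum>k\<in>{n}. (c * e) ^ k /\<^sub>R fact k) \<le> (\<Sum>k. (c * e) ^ k /\<^sub>R fact k)"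
    using assms by (intro sum_le_suminf summable_exp_generic) auto
  hence "(c * e) ^ n / fact n \<le> exp (c * e)"
    by (simp add: exp_def divide_inverse mult.commute)
  thus ?thesis using assms by (simp add: exp_minus power_mult_distrib field_simps)
qed

text \<open>Unrolling the recursion gives e^k I_0 = I_k minus the sum over j < k of e^(k-1-j) J_j.
  The decay of J_j turns e^(k-1-j) into (k-1-j)! / c^(k-1-j), and the factorial is absorbed into
  M.\<close>

lemma shift_recursion_bound:
  fixes I J :: "nat \<Rightarrow> complex"
  assumes M: "regular_sequence M" and e: "0 < e" and c: "0 < c" and A: "0 \<le> A" and C: "0 \<le> C"
    and rec: "\<And>k. of_real e * I k = I (Suc k) - J k"
    and I: "\<And>k. norm (I k) \<le> A * (C ^ Suc k * M k)"
    and J: "\<And>k. norm (J k) \<le> A * (C ^ Suc k * M k) * exp (- (c * e))"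
  defines "G \<equiv> max C (max 1 (1 / c))"
  shows "norm (I 0) \<le> (max 1 A * (2 * G)) ^ Suc k * M k / e ^ k"
proof -
  have closed: "of_real e ^ k * I 0 = I k - (\<Sum>j<k. of_real e ^ (k - Suc j) * J j)" for k
  proof (induction k)
    case (Suc k)
    have "(\<Sum>j<k. of_real e ^ (Suc k - Suc j) * J j) = of_real e * (\<Sum>j<k. of_real e ^ (k - Suc j) * J j)"
      unfolding sum_distrib_left
      by (intro sum.cong) (auto simp: Suc_diff_Suc simp flip: power_Suc mult.assoc)
    moreover have "of_real e ^ Suc k * I 0 = of_real e * (I k - (\<Sum>j<k. of_real e ^ (k - Suc j) * J j))"
      using Suc by simp
    ultimately show ?case using rec[of k] by (simp add: right_diff_distrib)
  qed simp
  have G: "1 \<le> G" "C \<le> G" "1 / c \<le> G" by (auto simp: G_def)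
  have Mpos: "0 < M i" for i by (rule regular_sequence_pos[OF M])
  have tm: "norm (of_real e ^ (k - Suc j) * J j) \<le> A * (G ^ Suc k * M k)" if j: "j < k" for j
  proof -
    have "norm (of_real e ^ (k - Suc j) * J j) \<le> e ^ (k - Suc j) * (A * (C ^ Suc j * M j) * exp (- (c * e)))"
      using J[of j] e by (simp add: norm_mult norm_power mult_left_mono)
    also have "\<dots> = A * C ^ Suc j * M j * (e ^ (k - Suc j) * exp (- (c * e)))" by simp
    also have "\<dots> \<le> A * C ^ Suc j * M j * (fact (k - Suc j) / c ^ (k - Suc j))"
      using A C c e less_imp_le[OF Mpos] by (intro mult_left_mono power_mult_exp_minus_le) auto
    also have "\<dots> = A * (C ^ Suc j * (1 / c) ^ (k - Suc j)) * (fact (k - Suc j) * M j)"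
      by (simp add: power_divide)
    also have "\<dots> \<le> A * (G ^ Suc j * G ^ (k - Suc j)) * M k"
    proof (intro mult_mono)
      have "fact (k - Suc j) * M j \<le> M (k - Suc j + j)" by (rule regular_sequence_fact_mult_le[OF M])
      also have "\<dots> \<le> M k" using j by (intro regular_sequence_mono[OF M]) auto
      finally show "fact (k - Suc j) * M j \<le> M k" .
      show "C ^ Suc j \<le> G ^ Suc j" "(1 / c) ^ (k - Suc j) \<le> G ^ (k - Suc j)"
        using C c G by (intro power_mono; simp)+
    qed (use A C c G less_imp_le[OF Mpos] in auto)
    also have "G ^ Suc j * G ^ (k - Suc j) = G ^ k"
      using j by (simp only: power_add[symmetric] le_add_diff_inverse Suc_leI)
    also have "A * G ^ k * M k \<le> A * (G ^ Suc k * M k)"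
      using A G less_imp_le[OF Mpos[of k]] mult_right_mono[of 1 G "G ^ k * M k"]
      by (simp only: mult.assoc power_Suc) (intro mult_left_mono, auto)
    finally show ?thesis .
  qed
  have "e ^ k * norm (I 0) = norm (I k - (\<Sum>j<k. of_real e ^ (k - Suc j) * J j))"
    using e by (simp add: norm_mult norm_power flip: closed)
  also have "\<dots> \<le> norm (I k) + (\<Sum>j<k. A * (G ^ Suc k * M k))"
    using tm by (intro order_trans[OF norm_triangle_ineq4] add_left_mono sum_norm_le) auto
  also have "norm (I k) \<le> A * (G ^ Suc k * M k)"
    using A C G less_imp_le[OF Mpos[of k]]
    by (intro order_trans[OF I] mult_left_mono mult_right_mono power_mono) auto
  also have "A * (G ^ Suc k * M k) + (\<Sum>j<k. A * (G ^ Suc k * M k)) = real (Suc k) * (A * (G ^ Suc k * M k))"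
    by (simp add: algebra_simps)
  \<comment> \<open>The number k + 1 of equal terms and the constant A are moved into the (k + 1)-st
    power.\<close>
  also have "\<dots> \<le> 2 ^ Suc k * (max 1 A ^ Suc k * (G ^ Suc k * M k))"
  proof (intro mult_mono)
    show "real (Suc k) \<le> 2 ^ Suc k"
      by (metis less_exp less_imp_le of_nat_le_iff of_nat_numeral of_nat_power)
    show "A \<le> max 1 A ^ Suc k"
      using self_le_power[of "max 1 A" "Suc k"] by simp
  qed (use A G less_imp_le[OF Mpos[of k]] in \<open>auto intro!: mult_nonneg_nonneg\<close>)
  finally show ?thesis using e by (simp add: field_simps power_mult_distrib)
qed

section \<open>The FBI phase and uniform bounds on the iterates\<close>

definition phase :: "'a::euclidean_space \<Rightarrow> 'a \<Rightarrow> 'a \<Rightarrow> complex" where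
  "phase y \<eta> y' = exp (\<i> * of_real ((y - y') \<bullet> \<eta>) - of_real (norm \<eta> * ((y - y') \<bullet> (y - y'))))"

lemma norm_phase: "norm (phase y \<eta> y') = exp (- (norm \<eta> * (dist y y')\<^sup>2))"
  by (simp add: phase_def norm_exp_eq_Re dist_norm power2_norm_eq_inner)

lemma has_derivative_phase:
  "(phase y \<eta> has_derivative (\<lambda>h. (- \<i> * of_real (h \<bullet> \<eta>) + 2 * of_real (norm \<eta>) * of_real ((y - y') \<bullet> h)) * phase y \<eta> y')) (at y')"
proof -
  have "((\<lambda>y'. \<i> * complex_of_real ((y - y') \<bullet> \<eta>) - complex_of_real (norm \<eta> * ((y - y') \<bullet> (y - y')))) has_derivative
      (\<lambda>h. \<i> * complex_of_real ((0 - h) \<bullet> \<eta>) - complex_of_real (norm \<eta> * ((y - y') \<bullet> (0 - h) + (0 - h) \<bullet> (y - y'))))) (at y')"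
    by (intro has_derivative_diff has_derivative_mult_right has_derivative_of_real has_derivative_inner_left
        has_derivative_inner has_derivative_const has_derivative_ident)
  moreover have "\<i> * complex_of_real ((0 - h) \<bullet> \<eta>) - complex_of_real (norm \<eta> * ((y - y') \<bullet> (0 - h) + (0 - h) \<bullet> (y - y'))) =
      - \<i> * of_real (h \<bullet> \<eta>) + 2 * of_real (norm \<eta>) * of_real ((y - y') \<bullet> h)" for h
    by (simp add: inner_diff_left inner_diff_right inner_commute algebra_simps)
  ultimately have "((\<lambda>y'. \<i> * complex_of_real ((y - y') \<bullet> \<eta>) - complex_of_real (norm \<eta> * ((y - y') \<bullet> (y - y')))) has_derivative
      (\<lambda>h. - \<i> * of_real (h \<bullet> \<eta>) + 2 * of_real (norm \<eta>) * of_real ((y - y') \<bullet> h))) (at y')"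
    by (simp only:)
  from has_derivative_compose[OF this DERIV_exp[unfolded has_field_derivative_def]]
  show ?thesis unfolding phase_def[abs_def] by (simp add: mult.commute)
qed

lemma continuous_phase: "continuous_on S (phase y \<eta>)"
  by (intro continuous_at_imp_continuous_on ballI has_derivative_continuous[OF has_derivative_phase])

lemma Ck_on_phase: "Ck_on 1 (phase y \<eta>) W"
proof -
  have "partial_deriv b (phase y \<eta>) = (\<lambda>y'. (- \<i> * of_real (b \<bullet> \<eta>) + 2 * of_real (norm \<eta>) * of_real ((y - y') \<bullet> b)) * phase y \<eta> y')" for b
    by (simp add: fun_eq_iff partial_deriv_at[OF has_derivative_phase])
  moreover have "phase y \<eta> differentiable (at y')" for y'
    using has_derivative_phase unfolding differentiable_def by blast
  ultimately show ?thesis by (auto intro!: continuous_intros continuous_phase)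
qed

context quasilinear
begin

text \<open>The exponent is positively homogeneous of degree one in \<eta>. Hence the factor
  |\<eta>| splits off and the symbol depends on the direction only, which varies in a compact
  set.\<close>

lemma vfield_phase:
  assumes "\<eta> \<noteq> 0"
  shows "vfield \<beta> (phase y \<eta>) y' = of_real (norm \<eta>) * q y (\<eta> /\<^sub>R norm \<eta>) y' [] * phase y \<eta> y'"
proof -
  have "of_real (norm \<eta>) * (- \<i> * of_real ((\<eta> /\<^sub>R norm \<eta>) \<bullet> b) + 2 * of_real ((y - y') \<bullet> b)) =
      - \<i> * of_real (b \<bullet> \<eta>) + 2 * of_real (norm \<eta>) * of_real ((y - y') \<bullet> b)" for b
    using assms by (simp add: inner_commute field_simps)
  hence "partial_deriv b (phase y \<eta>) y' =
      of_real (norm \<eta>) * (- \<i> * of_real ((\<eta> /\<^sub>R norm \<eta>) \<bullet> b) + 2 * of_real ((y - y') \<bullet> b)) * phase y \<eta> y'" for b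
    by (simp only: partial_deriv_at[OF has_derivative_phase])
  thus ?thesis
    by (simp only: q_Nil sum_distrib_left sum_distrib_right vfield_def mult_ac)
qed

lemma cont_dv: "b \<in> Basis \<Longrightarrow> K \<subseteq> W \<Longrightarrow> continuous_on K (partial_deriv b (v m))"
  using v[of m] by (auto intro: continuous_on_subset[of W])

lemma CM_total_jet:
  assumes K: "compact K" "K \<subseteq> W" and F: "CM_jets M letters K F" and b: "b \<in> Basis"
  shows "CM_jets M letters K (total_jet v b F)"
proof -
  have "CM_jets M letters K (\<lambda>y. jcoord l (partial_deriv b (v m) y))" for l :: "('a, 'm) letter" and m
    by (rule CM_jets_jcoord_continuous[OF M K(1) cont_dv[OF b K(2)]])
  thus ?thesis unfolding total_jet_def[abs_def] using F b
    by (intro CM_jets_add CM_jets_sum CM_jets_jmul CM_jets_jderiv M) auto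
qed

text \<open>The base point and the direction enter the jets only as bounded constants, and 1/q as a
  coordinate bounded by 1/c. So \<open>jstep_iterate_bound\<close>, indexed by triples of base
  point, direction and point, gives one constant for all of them and all k.\<close>

lemma CM_iter:
  assumes K: "compact K" "K \<subseteq> W" and P: "\<And>y \<omega>. (y, \<omega>) \<in> P \<Longrightarrow> norm y \<le> Cy \<and> norm \<omega> \<le> C\<omega>"
    and c: "0 < c" and q: "\<And>y \<omega> y'. (y, \<omega>) \<in> P \<Longrightarrow> y' \<in> K \<Longrightarrow> c \<le> norm (q y \<omega> y' [])"
  obtains C where "0 \<le> C"
    "\<And>y \<omega> y' k. (y, \<omega>) \<in> P \<Longrightarrow> y' \<in> K \<Longrightarrow> norm (iter m k y \<omega> y' []) \<le> C ^ Suc k * M k"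
proof -
  define J where "J = {i. (fst i, fst (snd i)) \<in> P \<and> snd (snd i) \<in> K}"
  let ?y = "\<lambda>i::'a \<times> 'a \<times> 'a. fst i" and ?\<omega> = "\<lambda>i::'a \<times> 'a \<times> 'a. fst (snd i)"
    and ?y' = "\<lambda>i::'a \<times> 'a \<times> 'a. snd (snd i)"
  have re: "CM_jets M letters J (\<lambda>i. F (?y' i))" if "CM_jets M letters K F" for F :: "'a \<Rightarrow> ('a, 'm) letter jet"
    using that by (rule CM_jets_reindex) (auto simp: J_def)
  have B': "CM_jets M letters J (\<lambda>i. B b (?y' i))" if "b \<in> Basis" for b
    by (rule re[OF CM_B[OF that K]])
  have H': "CM_jets M letters J (\<lambda>i. H m (?y' i))" for m
    by (rule re[OF CM_H[OF K]])
  have coordV: "CM_jets M (letters :: ('a, 'm) letter set) J (\<lambda>i. jcoord (LV m) (v m (?y' i)))" for m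
    by (intro re[of "\<lambda>y. jcoord (LV m) (v m y)"] CM_jets_jcoord_continuous[OF M K(1)]
        continuous_on_subset[OF Ck_on_continuous[OF v] K(2)])
  have coordW: "CM_jets M letters J (\<lambda>i. jcoord (LW m c) (partial_deriv c (v m) (?y' i)))" if "c \<in> Basis" for m c
    by (intro re[of "\<lambda>y. jcoord (LW m c) (partial_deriv c (v m) y)"] CM_jets_jcoord_continuous[OF M K(1)]
        cont_dv[OF that K(2)])
  have tot: "CM_jets M letters J (\<lambda>i. total_jet v b F (?y' i))" if "CM_jets M letters K F" "b \<in> Basis" for F b
    by (rule re[OF CM_total_jet[OF K that]])
  have q': "CM_jets M letters J (\<lambda>i. q (?y i) (?\<omega> i) (?y' i))"
    unfolding q_def
  proof (intro CM_jets_sum CM_jets_jmul CM_jets_add M B')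
    fix b :: 'a assume b: "b \<in> Basis"
    have "norm (- \<i> * complex_of_real (?\<omega> i \<bullet> b) + 2 * complex_of_real (?y i \<bullet> b)) \<le> C\<omega> + 2 * Cy" if "i \<in> J" for i
    proof -
      have "\<bar>?\<omega> i \<bullet> b\<bar> \<le> C\<omega>" "\<bar>?y i \<bullet> b\<bar> \<le> Cy"
        using P[of "?y i" "?\<omega> i"] that Basis_le_norm[OF b] by (auto simp: J_def intro: order_trans)
      thus ?thesis
        by (intro order_trans[OF norm_triangle_ineq]) (simp add: norm_mult)
    qed
    thus "CM_jets M letters J (\<lambda>i. jconst (- \<i> * complex_of_real (?\<omega> i \<bullet> b) + 2 * complex_of_real (?y i \<bullet> b)))"
      by (rule CM_jets_jconst[OF M])
    show "CM_jets M letters J (\<lambda>i. jconst (- 2))"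
      by (rule CM_jets_jconst[OF M, of _ _ 2]) simp
    have "continuous_on K (\<lambda>y. complex_of_real (y \<bullet> b))" by (intro continuous_intros)
    hence "CM_jets M letters K (\<lambda>y. jcoord (LY b :: ('a, 'm) letter) (complex_of_real (y \<bullet> b)))"
      by (rule CM_jets_jcoord_continuous[OF M K(1)])
    thus "CM_jets M letters J (\<lambda>i. jcoord (LY b :: ('a, 'm) letter) (complex_of_real (?y' i \<bullet> b)))" by (rule re)
  qed auto
  have r': "CM_jets M letters J (\<lambda>i. r (?y i) (?\<omega> i) (?y' i))"
    unfolding r_def
  proof (rule CM_jets_jcoord[OF M])
    fix i assume "i \<in> J"
    hence "c \<le> norm (q (?y i) (?\<omega> i) (?y' i) [])" by (intro q) (auto simp: J_def)
    thus "norm (inverse (q (?y i) (?\<omega> i) (?y' i) [])) \<le> inverse c"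
      using c by (simp add: norm_inverse le_imp_inverse_le)
  qed
  have coef': "CM_jets M letters J (\<lambda>i. coef (?y i) (?\<omega> i) l (?y' i))" if "l \<in> letters" for l
  proof (cases l)
    case (LY b)
    thus ?thesis using that B' by (auto simp: coef_def letters_def letters0_def)
  next
    case (LV m)
    thus ?thesis using H' by (simp add: coef_def)
  next
    case (LW m b)
    hence "b \<in> Basis" using that by (auto simp: letters_def letters0_def)
    thus ?thesis unfolding LW coef_LW
      by (intro CM_jets_add CM_jets_uminus CM_jets_sum CM_jets_jmul tot coordW CM_B CM_H K M) auto
  next
    case LR
    show ?thesis unfolding LR coef_LR
      by (intro CM_jets_uminus CM_jets_add CM_jets_sum CM_jets_jmul CM_jets_jderiv B' H' q' r' M) auto
  qed
  have dv': "CM_jets M letters J (\<lambda>i. dv (?y' i))"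
    unfolding dv_def by (intro CM_jets_sum M tot CM_B K) auto
  show ?thesis
  proof (rule jstep_iterate_bound[OF M finite_letters(2) coef' dv' r' coordV])
    fix C assume C: "0 \<le> C" "\<And>i k. i \<in> J \<Longrightarrow>
      norm (((jstep letters (\<lambda>l. coef (?y i) (?\<omega> i) l (?y' i)) (dv (?y' i)) (r (?y i) (?\<omega> i) (?y' i))) ^^ k)
        (jcoord (LV m) (v m (?y' i))) []) \<le> C ^ Suc k * M k"
    show thesis
    proof (rule that[OF C(1)])
      fix y \<omega> y' k assume "(y, \<omega>) \<in> P" "y' \<in> K"
      hence "(y, \<omega>, y') \<in> J" by (simp add: J_def)
      from C(2)[OF this, of k] show "norm (iter m k y \<omega> y' []) \<le> C ^ Suc k * M k"
        by (simp add: iter_def)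
    qed
  qed
qed

end


section \<open>Integration by parts against the FBI kernel\<close>

lemma norm_set_integral_le:
  fixes f :: "'a::euclidean_space \<Rightarrow> complex"
  assumes K: "compact K" and f: "continuous_on K f" and B: "\<And>y. y \<in> K \<Longrightarrow> norm (f y) \<le> B" "0 \<le> B"
  shows "norm (LINT y:K|lborel. f y) \<le> measure lborel K * B"
proof -
  have "norm (LINT y:K|lborel. f y) \<le> integral\<^sup>L lborel (\<lambda>y. indicator K y * B)"
    unfolding set_lebesgue_integral_def
  proof (rule Bochner_Integration.integral_norm_bound_integral)
    show "integrable lborel (\<lambda>y. indicator K y *\<^sub>R f y)"
      using borel_integrable_compact[OF K f] by simp
    show "integrable lborel (\<lambda>y. indicator K y * B)"
      using borel_integrable_compact[OF K continuous_on_const, of B] by simp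
    show "norm (indicator K y *\<^sub>R f y) \<le> indicator K y * B" for y
      using B by (auto simp: indicator_def)
  qed
  also have "\<dots> = measure lborel K * B" using K by (simp add: borel_compact)
  finally show ?thesis .
qed

lemma set_integral_cong_support:
  assumes "A \<subseteq> B" "\<And>y. y \<in> B - A \<Longrightarrow> f y = 0"
  shows "(LINT y:B|M. f y) = (LINT y:A|M. f y)"
proof -
  have "(\<lambda>y. indicator B y *\<^sub>R f y) = (\<lambda>y. indicator A y *\<^sub>R f y)"
    using assms by (auto simp: indicator_def fun_eq_iff)
  thus ?thesis by (simp add: set_lebesgue_integral_def)
qed

context quasilinear
begin

lemma integral_step:
  assumes K: "compact K" "K \<subseteq> W" and \<eta>: "\<eta> \<noteq> 0"
    and \<omega>: "\<omega> = \<eta> /\<^sub>R norm \<eta>"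
    and q0: "\<And>y'. y' \<in> K \<Longrightarrow> q y \<omega> y' [] \<noteq> 0"
    and \<theta>: "Ck_on 1 \<theta> UNIV" and K0: "compact K0" "K0 \<subseteq> interior K" "\<And>y'. y' \<notin> K0 \<Longrightarrow> \<theta> y' = 0"
  shows "of_real (norm \<eta>) * (LINT y':K|lborel. iter m k y \<omega> y' [] * (\<theta> y' * phase y \<eta> y')) =
     (LINT y':K|lborel. iter m (Suc k) y \<omega> y' [] * (\<theta> y' * phase y \<eta> y')) -
     (LINT y':K|lborel. r y \<omega> y' [] * iter m k y \<omega> y' [] * (vfield \<beta> \<theta> y' * phase y \<eta> y'))"
    and "continuous_on K (\<lambda>y'. iter m k y \<omega> y' [])"
    and "continuous_on K (\<lambda>y'. r y \<omega> y' [])"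
proof -
  define a where "a = (\<lambda>l y'. coef y \<omega> l y' [])"
  define \<phi> where "\<phi> = (\<lambda>y'. jmul (r y \<omega> y') (iter m k y \<omega> y') [])"
  define g where "g = (\<lambda>y'. \<Sum>l\<in>letters. a l y' * jmul (r y \<omega> y') (iter m k y \<omega> y') [l])"
  have c\<beta>: "\<And>b. b \<in> Basis \<Longrightarrow> continuous_on K (\<beta> b)" using cont_\<beta> K(2) by blast
  have L: "leibniz_rel (strong_deriv \<beta> K)" by (rule leibniz_rel_strong_deriv[OF K(1) c\<beta>])
  have ji: "jcompat (strong_deriv \<beta> K) letters a (iter m k y \<omega>)" for k
    unfolding a_def by (rule jcompat_iter[OF K q0])
  have jr: "jcompat (strong_deriv \<beta> K) letters a (r y \<omega>)"
    unfolding a_def by (rule jcompat_r[OF K q0])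
  have cont: "continuous_on K (\<lambda>y'. F y' [])" if "jcompat (strong_deriv \<beta> K) letters a F" for F
  proof -
    have "strong_deriv \<beta> K (\<lambda>y'. F y' []) (\<lambda>y'. \<Sum>l\<in>letters. a l y' * F y' ([] @ [l]))"
      using that unfolding jcompat_def by blast
    from strong_derivE[where \<beta>=\<beta>, OF this K(1) c\<beta>] show ?thesis by blast
  qed
  show ci: "continuous_on K (\<lambda>y'. iter m k y \<omega> y' [])" and cr: "continuous_on K (\<lambda>y'. r y \<omega> y' [])"
    using cont[OF ji] cont[OF jr] by auto
  have rel: "strong_deriv \<beta> K \<phi> g"
    using jcompat_jmul[OF L jr ji, of k] unfolding jcompat_def \<phi>_def g_def
    by (auto dest: bspec[of _ _ "[]"])
  have c\<theta>: "continuous_on K \<theta>" using Ck_on_continuous[OF \<theta>] by (rule continuous_on_subset) auto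
  have cL\<theta>: "continuous_on K (vfield \<beta> \<theta>)" by (rule continuous_on_vfield[OF \<theta> _ c\<beta>]) auto
  have "(LINT y':K|lborel. (g y' + (\<Sum>b\<in>Basis. partial_deriv b (\<beta> b) y') * \<phi> y') * (\<theta> y' * phase y \<eta> y')
      + \<phi> y' * vfield \<beta> (\<lambda>y'. \<theta> y' * phase y \<eta> y') y') = 0"
    using K0(3) by (intro strong_deriv_by_parts[OF K(1) W K(2) C1_\<beta> rel _ K0(1,2)] Ck_on_mult \<theta> Ck_on_phase) auto
  moreover have "(g y' + (\<Sum>b\<in>Basis. partial_deriv b (\<beta> b) y') * \<phi> y') * (\<theta> y' * phase y \<eta> y')
      + \<phi> y' * vfield \<beta> (\<lambda>y'. \<theta> y' * phase y \<eta> y') y' =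
     of_real (norm \<eta>) * (iter m k y \<omega> y' [] * (\<theta> y' * phase y \<eta> y')) +
     (r y \<omega> y' [] * iter m k y \<omega> y' [] * (vfield \<beta> \<theta> y' * phase y \<eta> y') - iter m (Suc k) y \<omega> y' [] * (\<theta> y' * phase y \<eta> y'))"
    if y': "y' \<in> K" for y'
  proof -
    have yW: "y' \<in> W" using y' K by auto
    have d: "(\<Sum>b\<in>Basis. partial_deriv b (\<beta> b) y') = dv y' []"
      unfolding dv_def using partial_deriv_graph_jet[OF B yW] by simp
    have s: "iter m (Suc k) y \<omega> y' [] = - (g y' + dv y' [] * \<phi> y')"
      by (simp add: iter_def jstep_def jfield_def g_def \<phi>_def a_def)
    have "vfield \<beta> (\<lambda>y'. \<theta> y' * phase y \<eta> y') y' = vfield \<beta> \<theta> y' * phase y \<eta> y' + \<theta> y' * vfield \<beta> (phase y \<eta>) y'"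
      using \<theta> Ck_on_phase[of y \<eta> UNIV] by (intro vfield_mult) auto
    also have "vfield \<beta> (phase y \<eta>) y' = of_real (norm \<eta>) * q y \<omega> y' [] * phase y \<eta> y'"
      unfolding \<omega> by (rule vfield_phase[OF \<eta>])
    finally have v: "\<phi> y' * vfield \<beta> (\<lambda>y'. \<theta> y' * phase y \<eta> y') y' =
        \<phi> y' * (vfield \<beta> \<theta> y' * phase y \<eta> y') + of_real (norm \<eta>) * (\<phi> y' * q y \<omega> y' []) * (\<theta> y' * phase y \<eta> y')"
      by (simp add: algebra_simps)
    have p: "\<phi> y' = r y \<omega> y' [] * iter m k y \<omega> y' []" by (simp add: \<phi>_def)
    \<comment> \<open>The symbol produced by L on the phase cancels the 1/q contained in \<phi>;
      this is the reason for integrating by parts with \<Phi>/q instead of \<Phi>.\<close>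
    have "\<phi> y' * q y \<omega> y' [] = iter m k y \<omega> y' []"
      using q0[OF y'] by (simp add: p r_Nil field_simps)
    thus ?thesis unfolding v s d by (simp add: p algebra_simps)
  qed
  ultimately have zero: "(LINT y':K|lborel. of_real (norm \<eta>) * (iter m k y \<omega> y' [] * (\<theta> y' * phase y \<eta> y')) +
     (r y \<omega> y' [] * iter m k y \<omega> y' [] * (vfield \<beta> \<theta> y' * phase y \<eta> y') - iter m (Suc k) y \<omega> y' [] * (\<theta> y' * phase y \<eta> y'))) = 0"
    using K(1) by (subst set_lebesgue_integral_cong[where g="\<lambda>y'. (g y' + (\<Sum>b\<in>Basis. partial_deriv b (\<beta> b) y') * \<phi> y') * (\<theta> y' * phase y \<eta> y')
      + \<phi> y' * vfield \<beta> (\<lambda>y'. \<theta> y' * phase y \<eta> y') y'"]) (auto simp: borel_compact)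
  have int: "set_integrable lborel K h" if "continuous_on K h" for h :: "'a \<Rightarrow> complex"
    unfolding set_integrable_def using borel_integrable_compact[OF K(1) that] by simp
  have iX: "set_integrable lborel K (\<lambda>y'. iter m k y \<omega> y' [] * (\<theta> y' * phase y \<eta> y'))" for k
    by (intro int continuous_intros cont[OF ji] c\<theta> continuous_phase)
  have iZ: "set_integrable lborel K (\<lambda>y'. r y \<omega> y' [] * iter m k y \<omega> y' [] * (vfield \<beta> \<theta> y' * phase y \<eta> y'))"
    by (intro int continuous_intros cont[OF ji] cr cL\<theta> continuous_phase)
  have lin: "(LINT y':K|lborel. e * X y' + (Z y' - Y y')) = e * (LINT y':K|lborel. X y') + ((LINT y':K|lborel. Z y') - (LINT y':K|lborel. Y y'))"
    if "set_integrable lborel K X" "set_integrable lborel K Y" "set_integrable lborel K Z" for e X Y and Z :: "'a \<Rightarrow> complex"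
    using that by (simp add: set_integral_add set_integral_diff)
  have rearrange: "x = z - y" if "x + (y - z) = 0" for x y z :: complex
    using that eq_neg_iff_add_eq_0[of x "y - z"] by simp
  show "of_real (norm \<eta>) * (LINT y':K|lborel. iter m k y \<omega> y' [] * (\<theta> y' * phase y \<eta> y')) =
     (LINT y':K|lborel. iter m (Suc k) y \<omega> y' [] * (\<theta> y' * phase y \<eta> y')) -
     (LINT y':K|lborel. r y \<omega> y' [] * iter m k y \<omega> y' [] * (vfield \<beta> \<theta> y' * phase y \<eta> y'))"
    by (rule rearrange) (rule zero[unfolded lin[OF iX iX iZ]])
qed

text \<open>q is jointly continuous in base point, direction and point, so half of its modulus at
  the centre is a lower bound on a product of small balls.\<close>

lemma q_bounded_below:
  assumes y0: "y0 \<in> W" and "q y0 \<omega>0 y0 [] \<noteq> 0"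
  obtains c \<rho> where "0 < c" "0 < \<rho>" "cball y0 \<rho> \<subseteq> W"
    "\<And>y \<omega> y'. y \<in> cball y0 \<rho> \<Longrightarrow> \<omega> \<in> cball \<omega>0 \<rho> \<Longrightarrow> y' \<in> cball y0 \<rho> \<Longrightarrow> c \<le> norm (q y \<omega> y' [])"
proof -
  define c where "c = norm (q y0 \<omega>0 y0 []) / 2"
  have c: "0 < c" using assms by (simp add: c_def)
  define f where "f = (\<lambda>p. norm (q (fst p) (fst (snd p)) (snd (snd p)) []))"
  define S where "S = (UNIV :: 'a set) \<times> (UNIV :: 'a set) \<times> W"
  have oS: "open S" unfolding S_def using W by (intro open_Times) auto
  have "continuous_on S (\<lambda>p. \<beta> b (snd (snd p)))" if "b \<in> Basis" for b
    by (rule continuous_on_compose2[OF cont_\<beta>[OF that order_refl]])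
      (auto intro!: continuous_intros simp: S_def)
  hence "continuous_on S f"
    unfolding f_def q_Nil by (intro continuous_intros) auto
  hence "open (S \<inter> f -` {c<..})"
    using continuous_open_preimage[OF _ oS, of f "{c<..}"] by simp
  moreover have "(y0, \<omega>0, y0) \<in> S \<inter> f -` {c<..}"
    using y0 c by (simp add: S_def f_def c_def)
  ultimately obtain A BB where AB: "open A" "open BB" "y0 \<in> A" "(\<omega>0, y0) \<in> BB" "A \<times> BB \<subseteq> S \<inter> f -` {c<..}"
    by (rule open_prod_elim) auto
  obtain B1 B2 where B12: "open B1" "open B2" "\<omega>0 \<in> B1" "y0 \<in> B2" "B1 \<times> B2 \<subseteq> BB"
    using open_prod_elim[OF AB(2,4)] by (metis mem_Sigma_iff)
  obtain \<rho>1 where \<rho>1: "0 < \<rho>1" "cball y0 \<rho>1 \<subseteq> A \<inter> B2"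
    using open_contains_cball[of "A \<inter> B2"] AB B12 by (metis IntI open_Int)
  obtain \<rho>2 where \<rho>2: "0 < \<rho>2" "cball \<omega>0 \<rho>2 \<subseteq> B1"
    using open_contains_cball[of B1] B12 by metis
  define \<rho> where "\<rho> = min \<rho>1 \<rho>2"
  have sub: "cball y0 \<rho> \<subseteq> A" "cball y0 \<rho> \<subseteq> B2" "cball \<omega>0 \<rho> \<subseteq> B1"
    using \<rho>1 \<rho>2 by (auto simp: \<rho>_def)
  have in': "(y, \<omega>, y') \<in> S \<inter> f -` {c<..}" if "y \<in> cball y0 \<rho>" "\<omega> \<in> cball \<omega>0 \<rho>" "y' \<in> cball y0 \<rho>" for y \<omega> y'
    using that sub AB(5) B12(5) by blast
  show ?thesis
  proof (rule that[OF c])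
    show \<rho>: "0 < \<rho>" using \<rho>1 \<rho>2 by (simp add: \<rho>_def)
    have "y' \<in> W" if "y' \<in> cball y0 \<rho>" for y'
      using in'[of y0 \<omega>0 y'] that \<rho> by (simp add: S_def)
    thus "cball y0 \<rho> \<subseteq> W" by blast
    show "c \<le> norm (q y \<omega> y' [])" if "y \<in> cball y0 \<rho>" "\<omega> \<in> cball \<omega>0 \<rho>" "y' \<in> cball y0 \<rho>" for y \<omega> y'
      using in'[OF that] by (simp add: f_def)
  qed
qed

lemma CM_regular_direction_solution:
  assumes y0: "y0 \<in> W" and \<eta>0: "\<eta>0 \<noteq> 0" and nc: "(\<Sum>b\<in>Basis. \<beta> b y0 * of_real (\<eta>0 \<bullet> b)) \<noteq> 0"
  shows "CM_regular_direction M W (distr_of_fun W (v m)) y0 \<eta>0"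
proof -
  define \<omega>0 where "\<omega>0 = \<eta>0 /\<^sub>R norm \<eta>0"
  \<comment> \<open>On the diagonal the Gaussian part of the phase is stationary, so q reduces to a
    non-zero multiple of the principal symbol of L: non-vanishing there is exactly the
    non-characteristic condition.\<close>
  have "q y0 \<omega>0 y0 [] = - \<i> / of_real (norm \<eta>0) * (\<Sum>b\<in>Basis. \<beta> b y0 * of_real (\<eta>0 \<bullet> b))"
    by (simp add: q_Nil \<omega>0_def sum_distrib_left divide_inverse mult_ac)
  hence "q y0 \<omega>0 y0 [] \<noteq> 0" using nc \<eta>0 by simp
  then obtain c \<rho> where c: "0 < c" and \<rho>: "0 < \<rho>" "cball y0 \<rho> \<subseteq> W"
    and q: "\<And>y \<omega> y'. y \<in> cball y0 \<rho> \<Longrightarrow> \<omega> \<in> cball \<omega>0 \<rho> \<Longrightarrow> y' \<in> cball y0 \<rho> \<Longrightarrow> c \<le> norm (q y \<omega> y' [])"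
    by (rule q_bounded_below[OF y0]) blast
  define K where "K = cball y0 \<rho>"
  \<comment> \<open>Nested radii: \<rho> for the integration domain, 3 \<rho> / 4 for the support of
    the cutoff, \<rho> / 2 where the cutoff is 1, and \<rho> / 4 for the base points y.\<close>
  define K0 where "K0 = cball y0 (3 * \<rho> / 4)"
  have K: "compact K" "K \<subseteq> W" "compact K0" "K0 \<subseteq> interior K" "K0 \<subseteq> K"
    using \<rho> by (auto simp: K_def K0_def)
  obtain \<theta> :: "'a \<Rightarrow> complex" where \<theta>: "smooth_on \<theta> UNIV" "\<And>x. x \<in> ball y0 (\<rho> / 2) \<Longrightarrow> \<theta> x = 1" "supp \<theta> \<subseteq> K0"
    using exists_cutoff[of "\<rho> / 2" "3 * \<rho> / 4" y0] \<rho> unfolding K0_def by auto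
  have C\<theta>: "Ck_on 1 \<theta> UNIV" using \<theta>(1) unfolding smooth_on_def by blast
  have \<theta>0: "\<theta> x = 0" if "x \<notin> K0" for x
    using that \<theta>(3) closure_subset[of "{x. \<theta> x \<noteq> 0}"] by (auto simp: supp_def)
  have test: "\<theta> \<in> test_functions W"
  proof -
    have "compact (supp \<theta>)"
      using compact_Int_closed[OF K(3), of "supp \<theta>"] \<theta>(3) by (simp add: supp_def Int_absorb1)
    thus ?thesis using \<theta> K by (auto simp: test_functions_def)
  qed
  have c\<beta>: "\<And>b. b \<in> Basis \<Longrightarrow> continuous_on K (\<beta> b)" using cont_\<beta> K(2) by blast
  have c\<theta>: "continuous_on K \<theta>" using Ck_on_continuous[OF C\<theta>] by (rule continuous_on_subset) auto
  have cL\<theta>: "continuous_on K (vfield \<beta> \<theta>)" by (rule continuous_on_vfield[OF C\<theta> _ c\<beta>]) auto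
  have "\<exists>T. \<forall>x\<in>K. norm (h x) \<le> T" if "continuous_on K h" for h :: "'a \<Rightarrow> complex"
    using compact_imp_bounded[OF compact_continuous_image[OF that K(1)]] by (auto simp: bounded_iff)
  from this[OF c\<theta>] this[OF cL\<theta>] obtain T1 T2 where T12: "\<And>x. x \<in> K \<Longrightarrow> norm (\<theta> x) \<le> T1" "\<And>x. x \<in> K \<Longrightarrow> norm (vfield \<beta> \<theta> x) \<le> T2"
    by blast
  define T where "T = max 0 (max T1 T2)"
  have T: "0 \<le> T" "\<And>x. x \<in> K \<Longrightarrow> norm (\<theta> x) \<le> T" "\<And>x. x \<in> K \<Longrightarrow> norm (vfield \<beta> \<theta> x) \<le> T"
    using T12 by (force simp: T_def)+
  define P where "P = {(y, \<omega>). y \<in> cball y0 \<rho> \<and> \<omega> \<in> cball \<omega>0 \<rho>}"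
  have P: "norm y \<le> norm y0 + \<rho> \<and> norm \<omega> \<le> norm \<omega>0 + \<rho>" if "(y, \<omega>) \<in> P" for y \<omega>
  proof -
    have "norm (y - y0) \<le> \<rho>" "norm (\<omega> - \<omega>0) \<le> \<rho>"
      using that by (auto simp: P_def dist_norm norm_minus_commute)
    thus ?thesis using norm_triangle_sub[of y y0] norm_triangle_sub[of \<omega> \<omega>0] by linarith
  qed
  have qP: "c \<le> norm (q y \<omega> y' [])" if "(y, \<omega>) \<in> P" "y' \<in> K" for y \<omega> y'
    using q that by (auto simp: P_def K_def)
  show ?thesis
  proof (rule CM_iter[where m=m, OF K(1,2) P c qP])
    fix C assume C: "0 \<le> C"
      "\<And>y \<omega> y' k. (y, \<omega>) \<in> P \<Longrightarrow> y' \<in> K \<Longrightarrow> norm (iter m k y \<omega> y' []) \<le> C ^ Suc k * M k"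
    \<comment> \<open>One constant for both families: the summand 1 serves the integrals I, the
      summand 1 / c the integrals J, which carry an additional 1/q.\<close>
    define A where "A = measure lborel K * (T * (1 + 1 / c))"
    have A: "0 \<le> A" using T(1) c by (simp add: A_def)
    \<comment> \<open>Where L \<theta> is non-zero, y' lies outside radius \<rho> / 2, hence at
      distance at least \<rho> / 4 from y; this is the rate of the Gaussian decay.\<close>
    define s where "s = (\<rho> / 4)\<^sup>2"
    have s: "0 < s" using \<rho> by (simp add: s_def)
    define G where "G = max C (max 1 (1 / s))"
    define D where "D = max 1 A * (2 * G)"
    have D: "0 < D" by (auto simp: D_def G_def intro!: mult_pos_pos)
    define \<Gamma> where "\<Gamma> = {\<eta>. \<eta> \<noteq> 0 \<and> \<eta> /\<^sub>R norm \<eta> \<in> ball \<omega>0 \<rho>}"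
    have bound: "norm (fbi (mult_distr \<theta> (distr_of_fun W (v m))) y \<eta>) \<le> D ^ Suc k * M k / norm \<eta> ^ k"
      if y: "y \<in> ball y0 (\<rho> / 4)" and \<eta>: "\<eta> \<in> \<Gamma>" for y \<eta> k
    proof -
      define \<omega> where "\<omega> = \<eta> /\<^sub>R norm \<eta>"
      have n: "\<eta> \<noteq> 0" and P': "(y, \<omega>) \<in> P"
        using y \<eta> \<rho>(1) by (auto simp: \<Gamma>_def \<omega>_def P_def)
      have q0: "q y \<omega> y' [] \<noteq> 0" if "y' \<in> K" for y' using qP[OF P' that] c by auto
      define I where "I = (\<lambda>k. LINT y':K|lborel. iter m k y \<omega> y' [] * (\<theta> y' * phase y \<eta> y'))"
      define J where "J = (\<lambda>k. LINT y':K|lborel. r y \<omega> y' [] * iter m k y \<omega> y' [] * (vfield \<beta> \<theta> y' * phase y \<eta> y'))"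
      note step = integral_step[OF K(1,2) n \<omega>_def q0 C\<theta> K(3,4) \<theta>0]
      have rec: "of_real (norm \<eta>) * I k = I (Suc k) - J k" for k
        unfolding I_def J_def by (rule step(1))
      have ci: "continuous_on K (\<lambda>y'. iter m k y \<omega> y' [])" for k by (rule step(2))
      have cr: "continuous_on K (\<lambda>y'. r y \<omega> y' [])" by (rule step(3))
      have Mn: "0 \<le> M k" for k using regular_sequence_pos[OF M, of k] by simp
      have ph: "norm (phase y \<eta> y') \<le> 1" for y' by (simp add: norm_phase)
      have I: "norm (I k) \<le> A * (C ^ Suc k * M k)" for k
      proof -
        have "norm (I k) \<le> measure lborel K * (C ^ Suc k * M k * (T * 1))"
          unfolding I_def
        proof (rule norm_set_integral_le[OF K(1)])
          show "continuous_on K (\<lambda>y'. iter m k y \<omega> y' [] * (\<theta> y' * phase y \<eta> y'))"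
            by (intro continuous_intros ci c\<theta> continuous_phase)
          show "norm (iter m k y \<omega> y' [] * (\<theta> y' * phase y \<eta> y')) \<le> C ^ Suc k * M k * (T * 1)" if "y' \<in> K" for y'
            unfolding norm_mult using C T ph Mn that P' by (intro mult_mono) auto
        qed (use C T Mn in auto)
        also have "\<dots> = measure lborel K * (T * 1) * (C ^ Suc k * M k)" by simp
        also have "\<dots> \<le> A * (C ^ Suc k * M k)" unfolding A_def
          using C T Mn c by (intro mult_right_mono mult_left_mono) auto
        finally show ?thesis .
      qed
      have J: "norm (J k) \<le> A * (C ^ Suc k * M k) * exp (- (s * norm \<eta>))" for k
      proof -
        have "norm (J k) \<le> measure lborel K * (1 / c * (C ^ Suc k * M k) * (T * exp (- (s * norm \<eta>))))"
          unfolding J_def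
        proof (rule norm_set_integral_le[OF K(1)])
          show "continuous_on K (\<lambda>y'. r y \<omega> y' [] * iter m k y \<omega> y' [] * (vfield \<beta> \<theta> y' * phase y \<eta> y'))"
            by (intro continuous_intros ci cr cL\<theta> continuous_phase)
          show "norm (r y \<omega> y' [] * iter m k y \<omega> y' [] * (vfield \<beta> \<theta> y' * phase y \<eta> y')) \<le>
              1 / c * (C ^ Suc k * M k) * (T * exp (- (s * norm \<eta>)))" if y': "y' \<in> K" for y'
          proof (cases "y' \<in> ball y0 (\<rho> / 2)")
            case True
            have "partial_deriv b \<theta> y' = 0" for b
              using partial_deriv_cong_open[OF open_ball True, of \<theta> "\<lambda>_. 1" b] \<theta>(2) by (simp add: partial_deriv_const)
            hence "vfield \<beta> \<theta> y' = 0" by (simp add: vfield_def)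
            thus ?thesis using C T Mn c by simp
          next
            case False
            hence "\<rho> / 4 \<le> dist y y'" using y dist_triangle[of y0 y' y] by simp
            hence "s \<le> (dist y y')\<^sup>2" unfolding s_def using \<rho> by (intro power_mono) auto
            hence "norm (phase y \<eta> y') \<le> exp (- (s * norm \<eta>))"
              by (simp add: norm_phase mult.commute[of s] mult_left_mono)
            moreover have "norm (r y \<omega> y' []) \<le> 1 / c"
              using qP[OF P' y'] c by (simp add: r_Nil norm_inverse le_imp_inverse_le divide_inverse)
            ultimately show ?thesis unfolding norm_mult using C T Mn y' P' c
              by (intro mult_mono) auto
          qed
        qed (use C T Mn c in auto)
        also have "\<dots> = measure lborel K * (T * (1 / c)) * (C ^ Suc k * M k) * exp (- (s * norm \<eta>))" by simp
        also have "\<dots> \<le> A * (C ^ Suc k * M k) * exp (- (s * norm \<eta>))" unfolding A_def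
          using C T Mn c by (intro mult_right_mono mult_left_mono) auto
        finally show ?thesis .
      qed
      have "fbi (mult_distr \<theta> (distr_of_fun W (v m))) y \<eta> = (LINT y':W|lborel. v m y' * (\<theta> y' * phase y \<eta> y'))"
        by (simp add: fbi_def mult_distr_def distr_of_fun_def phase_def)
      also have "\<dots> = (LINT y':K|lborel. v m y' * (\<theta> y' * phase y \<eta> y'))"
        using K \<theta>0 by (intro set_integral_cong_support) auto
      also have "\<dots> = I 0" by (simp add: I_def iter_def jcoord_def)
      finally have "fbi (mult_distr \<theta> (distr_of_fun W (v m))) y \<eta> = I 0" .
      thus ?thesis
        using shift_recursion_bound[OF M _ s A C(1) rec I J, of k] n by (simp add: D_def G_def)
    qed
    have "\<forall>\<^sub>F x in nhds y0. \<theta> x = 1"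
      using \<rho> \<theta>(2) by (intro eventually_nhds_in_open[of "ball y0 (\<rho> / 2)", THEN eventually_mono]) auto
    moreover have "open_cone \<Gamma>"
      unfolding open_cone_def
    proof (intro conjI ballI allI impI)
      have "continuous_on (- {0}) (\<lambda>\<eta>::'a. \<eta> /\<^sub>R norm \<eta>)"
        by (intro continuous_intros) auto
      hence "open (- {0} \<inter> (\<lambda>\<eta>::'a. \<eta> /\<^sub>R norm \<eta>) -` ball \<omega>0 \<rho>)"
        by (intro continuous_open_preimage) auto
      moreover have "- {0} \<inter> (\<lambda>\<eta>::'a. \<eta> /\<^sub>R norm \<eta>) -` ball \<omega>0 \<rho> = \<Gamma>" by (auto simp: \<Gamma>_def)
      ultimately show "open \<Gamma>" by simp
      show "0 \<notin> \<Gamma>" by (simp add: \<Gamma>_def)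
      fix \<eta> :: 'a and c :: real
      assume "\<eta> \<in> \<Gamma>" "0 < c"
      moreover have "(c *\<^sub>R \<eta>) /\<^sub>R norm (c *\<^sub>R \<eta>) = \<eta> /\<^sub>R norm \<eta>" using \<open>0 < c\<close> by simp
      ultimately show "c *\<^sub>R \<eta> \<in> \<Gamma>" unfolding \<Gamma>_def mem_Collect_eq by (metis scaleR_eq_0_iff less_irrefl)
    qed
    moreover have "\<eta>0 \<in> \<Gamma>" using \<eta>0 \<rho> by (simp add: \<Gamma>_def \<omega>0_def)
    moreover have "\<exists>A>0. \<forall>k. \<forall>y\<in>ball y0 (\<rho> / 4). \<forall>\<eta>\<in>\<Gamma>.
        norm (fbi (mult_distr \<theta> (distr_of_fun W (v m))) y \<eta>) \<le> A ^ (k + 1) * M k / norm \<eta> ^ k"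
      using bound D by (intro exI[of _ D]) auto
    moreover have "open (ball y0 (\<rho> / 4))" "y0 \<in> ball y0 (\<rho> / 4)" using \<rho> by auto
    ultimately show ?thesis
      unfolding CM_regular_direction_def using test by blast
  qed
qed

end


section \<open>Functions of the class with holomorphic parameters\<close>

text \<open>The direction of the complex variable \<open>\<zeta>\<^sub>0\<close> (for \<open>None\<close>) or \<open>\<zeta>\<^sub>j\<close> (for \<open>Some j\<close>), scaled by \<open>h\<close>.\<close>

definition cvec :: "'n::finite option \<Rightarrow> complex \<Rightarrow> 'a::euclidean_space \<times> (complex \<times> (complex ^ 'n))" where
  "cvec m h = (case m of None \<Rightarrow> (0, (h, 0)) | Some j \<Rightarrow> (0, (0, axis j h)))"

lemma axis_add: "axis j (x + y) = axis j x + (axis j y :: 'b::monoid_add ^ 'n)"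
  by (simp add: vec_eq_iff axis_def)

lemma axis_scaleR: "axis j (r *\<^sub>R x) = r *\<^sub>R (axis j x :: complex ^ 'n)"
  by (simp add: vec_eq_iff axis_def)

lemma linear_cvec: "linear (cvec m)"
  by (rule linearI) (auto simp: cvec_def axis_add axis_scaleR zero_prod_def split: option.split)

lemma cvec_0 [simp]: "cvec m 0 = 0"
  by (rule linear_0[OF linear_cvec])

lemma norm_cvec: "norm (cvec m h) = norm h"
  by (auto simp: cvec_def norm_Pair norm_eq_sqrt_inner[of "axis _ h"] inner_axis_axis norm_eq_sqrt_inner[of h]
      split: option.split)

lemma cvec_Basis:
  fixes m :: "'n::finite option"
  shows "(cvec m 1 :: 'a::euclidean_space \<times> (complex \<times> (complex ^ 'n))) \<in> Basis"
    and "(cvec m \<i> :: 'a::euclidean_space \<times> (complex \<times> (complex ^ 'n))) \<in> Basis"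
proof -
  have axis: "axis j u \<in> Basis" if "u \<in> Basis" for j :: 'n and u :: complex
    using that by (auto simp: Basis_vec_def)
  have B1: "(0::'a, z) \<in> Basis" if "z \<in> Basis" for z :: "complex \<times> (complex ^ 'n)"
    using that by (simp add: Basis_prod_def)
  have B2: "(0::'a, (u, 0 :: complex ^ 'n)) \<in> Basis" "(0::'a, (0::complex, axis j u)) \<in> Basis"
    if "u \<in> Basis" for u :: complex and j :: 'n
    using that axis by (auto intro!: B1 simp: Basis_prod_def)
  have "(1::complex) \<in> Basis" "\<i> \<in> Basis" by (simp_all add: Basis_complex_def)
  from B2[OF this(1)] B2[OF this(2)]
  show "(cvec m 1 :: 'a \<times> (complex \<times> (complex ^ 'n))) \<in> Basis" "(cvec m \<i> :: 'a \<times> (complex \<times> (complex ^ 'n))) \<in> Basis"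
    unfolding cvec_def by (auto split: option.split)
qed

text \<open>Holomorphy is stated as Cauchy-Riemann equations between directional derivatives, a form
  that passes to further partial derivatives.\<close>

definition smooth_hol :: "'a::euclidean_space set \<Rightarrow> ('a \<times> (complex \<times> (complex ^ 'n::finite)) \<Rightarrow> complex) \<Rightarrow> bool" where
  "smooth_hol W g \<longleftrightarrow> (\<forall>k. Ck_on k g (W \<times> UNIV)) \<and>
     (\<forall>x\<in>W \<times> UNIV. \<forall>m. partial_deriv (cvec m \<i>) g x = \<i> * partial_deriv (cvec m 1) g x)"

lemma smooth_hol_differentiable: "smooth_hol W g \<Longrightarrow> x \<in> W \<times> UNIV \<Longrightarrow> g differentiable (at x)"
proof -
  assume "smooth_hol W g" "x \<in> W \<times> UNIV"
  hence "Ck_on 1 g (W \<times> UNIV)" unfolding smooth_hol_def by blast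
  thus ?thesis using \<open>x \<in> W \<times> UNIV\<close> by (simp only: One_nat_def Ck_on.simps)
qed

lemma smooth_hol_cvec:
  assumes "smooth_hol W g" "x \<in> W \<times> UNIV"
  shows "partial_deriv (cvec m h) g x = h * partial_deriv (cvec m 1) g x"
proof -
  note lin = partial_deriv_linear[OF smooth_hol_differentiable[OF assms]]
  have "h = Re h *\<^sub>R 1 + Im h *\<^sub>R \<i>" by (simp add: complex_eq_iff)
  hence "cvec m h = (Re h *\<^sub>R cvec m 1 + Im h *\<^sub>R cvec m \<i> :: 'a \<times> complex \<times> (complex ^ 'b))"
    using linear_add[OF linear_cvec, of m] linear_scale[OF linear_cvec, of m] by metis
  hence "partial_deriv (cvec m h) g x = Re h *\<^sub>R partial_deriv (cvec m 1) g x + Im h *\<^sub>R partial_deriv (cvec m \<i>) g x"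
    by (simp add: linear_add[OF lin] linear_scale[OF lin])
  also have "partial_deriv (cvec m \<i>) g x = \<i> * partial_deriv (cvec m 1) g x"
    using assms unfolding smooth_hol_def by blast
  also have "Re h *\<^sub>R partial_deriv (cvec m 1) g x + Im h *\<^sub>R (\<i> * partial_deriv (cvec m 1) g x) =
      (of_real (Re h) + \<i> * of_real (Im h)) * partial_deriv (cvec m 1) g x"
    by (simp add: scaleR_conv_of_real algebra_simps)
  finally show ?thesis by (simp flip: complex_eq)
qed

text \<open>Partial derivatives commute, so the Cauchy-Riemann equations can be differentiated in
  any real direction.\<close>

lemma smooth_hol_partial_deriv:
  assumes W: "open W" and g: "smooth_hol W g" and b: "b \<in> Basis"
  shows "smooth_hol W (partial_deriv b g)"
proof -
  let ?D = "W \<times> (UNIV :: (complex \<times> (complex ^ 'b)) set)"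
  have D: "open ?D" using W by (intro open_Times) auto
  have Ck: "Ck_on k g ?D" for k using g unfolding smooth_hol_def by blast
  have Ck': "Ck_on k (partial_deriv c g) ?D" if "c \<in> Basis" for k c
    using Ck[of "Suc k"] that by simp
  have "partial_deriv (cvec m \<i>) (partial_deriv b g) x = \<i> * partial_deriv (cvec m 1) (partial_deriv b g) x"
    if x: "x \<in> ?D" for x m
  proof -
    have d: "partial_deriv (cvec m 1) g differentiable (at x)"
      using Ck'[OF cvec_Basis(1), of 1 m] x by (simp only: One_nat_def Ck_on.simps)
    have "partial_deriv (cvec m \<i>) (partial_deriv b g) x = partial_deriv b (partial_deriv (cvec m \<i>) g) x"
      by (rule partial_deriv_commute[OF D x Ck b cvec_Basis(2)])
    also have "\<dots> = partial_deriv b (\<lambda>x. \<i> * partial_deriv (cvec m 1) g x) x"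
      by (rule partial_deriv_cong_open[OF D x]) (rule smooth_hol_cvec[OF g])
    also have "\<dots> = \<i> * partial_deriv b (partial_deriv (cvec m 1) g) x"
      using partial_deriv_mult[OF differentiable_const d, of b \<i>] by (simp add: partial_deriv_const)
    also have "partial_deriv b (partial_deriv (cvec m 1) g) x = partial_deriv (cvec m 1) (partial_deriv b g) x"
      by (rule partial_deriv_commute[OF D x Ck cvec_Basis(1) b])
    finally show ?thesis .
  qed
  thus ?thesis unfolding smooth_hol_def using Ck'[OF b] by blast
qed

lemma smooth_hol_iter_deriv:
  assumes "open W" "smooth_hol W g" "set bs \<subseteq> Basis"
  shows "smooth_hol W (iter_deriv bs g)"
  using assms(3)
proof (induction bs)
  case Nil
  show ?case using assms(2) by simp
next
  case (Cons b bs)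
  hence "smooth_hol W (iter_deriv bs g)" "b \<in> Basis" by simp_all
  thus ?case using smooth_hol_partial_deriv[OF assms(1)] by simp
qed

lemma iter_deriv_append: "iter_deriv (xs @ ys) g = iter_deriv xs (iter_deriv ys g)"
  by (induction xs) auto

lemma iter_deriv_move:
  assumes W: "open W" and g: "smooth_hol W g" and "b \<in> Basis" "set xs \<subseteq> Basis" "x \<in> W \<times> UNIV"
  shows "iter_deriv (b # xs) g x = iter_deriv (xs @ [b]) g x"
  using assms(4,5)
proof (induction xs arbitrary: x)
  case (Cons c xs)
  let ?D = "W \<times> (UNIV :: (complex \<times> (complex ^ 'b)) set)"
  have D: "open ?D" using W by (intro open_Times) auto
  have "Ck_on 2 (iter_deriv xs g) ?D"
    using smooth_hol_iter_deriv[OF W g, of xs] Cons.prems unfolding smooth_hol_def by auto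
  hence "iter_deriv (b # c # xs) g x = partial_deriv c (iter_deriv (b # xs) g) x"
    using Cons.prems assms(3) by (simp add: partial_deriv_commute[OF D])
  also have "\<dots> = partial_deriv c (iter_deriv (xs @ [b]) g) x"
    using Cons by (intro partial_deriv_cong_open[OF D]) auto
  finally show ?case by simp
qed simp

text \<open>Sorting puts the parameter derivatives outermost and the base derivatives innermost: the
  bound of the class applies inside, Cauchy's inequality outside.\<close>

lemma iter_deriv_sort:
  assumes W: "open W" and g: "smooth_hol W g" and "set bs \<subseteq> Basis" "x \<in> W \<times> UNIV"
  shows "iter_deriv bs g x = iter_deriv (filter P bs @ filter (\<lambda>b. \<not> P b) bs) g x"
  using assms(3,4)
proof (induction bs arbitrary: x)
  case (Cons b bs)
  let ?D = "W \<times> (UNIV :: (complex \<times> (complex ^ 'b)) set)"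
  have D: "open ?D" using W by (intro open_Times) auto
  have "iter_deriv (b # bs) g x = partial_deriv b (iter_deriv (filter P bs @ filter (\<lambda>b. \<not> P b) bs) g) x"
    using Cons by (simp, intro partial_deriv_cong_open[OF D]) auto
  also have "\<dots> = iter_deriv (filter P (b # bs) @ filter (\<lambda>b. \<not> P b) (b # bs)) g x"
  proof (cases "P b")
    case False
    have "smooth_hol W (iter_deriv (filter (\<lambda>b. \<not> P b) bs) g)"
      using Cons.prems by (intro smooth_hol_iter_deriv[OF W g]) auto
    moreover have "b \<in> Basis" "set (filter P bs) \<subseteq> Basis" using Cons.prems by auto
    ultimately have "iter_deriv (b # filter P bs) (iter_deriv (filter (\<lambda>b. \<not> P b) bs) g) x =
        iter_deriv (filter P bs @ [b]) (iter_deriv (filter (\<lambda>b. \<not> P b) bs) g) x"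
      using Cons.prems(2) by (intro iter_deriv_move[OF W])
    thus ?thesis using False by (simp add: iter_deriv_append)
  qed simp
  finally show ?case .
qed simp

lemma has_derivative_cvec_line:
  assumes "smooth_hol W g" "x + cvec m c \<in> W \<times> UNIV"
  shows "((\<lambda>c. g (x + cvec m c)) has_field_derivative partial_deriv (cvec m 1) g (x + cvec m c)) (at c)"
proof -
  have "bounded_linear (cvec m :: complex \<Rightarrow> 'a \<times> (complex \<times> (complex ^ 'b)))"
    using linear_cvec by (rule linear_conv_bounded_linear[THEN iffD1])
  hence "((\<lambda>c. x + cvec m c) has_derivative cvec m) (at c)"
    by (auto intro!: derivative_eq_intros bounded_linear_imp_has_derivative)
  from has_derivative_compose[OF this has_derivative_partial_deriv[OF smooth_hol_differentiable[OF assms]]]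
  have "((\<lambda>c. g (x + cvec m c)) has_derivative (\<lambda>h. partial_deriv (cvec m h) g (x + cvec m c))) (at c)" .
  moreover have "(\<lambda>h. partial_deriv (cvec m h) g (x + cvec m c)) = (*) (partial_deriv (cvec m 1) g (x + cvec m c))"
    using smooth_hol_cvec[OF assms] by (intro ext) (metis mult.commute)
  ultimately show ?thesis by (simp only: has_field_derivative_def)
qed

lemma fst_cvec [simp]: "fst (cvec m c) = 0"
  by (auto simp: cvec_def split: option.split)

section \<open>Cauchy estimates in the complex parameters\<close>

lemma cauchy_step:
  assumes g: "smooth_hol W g" and x: "x \<in> W \<times> UNIV" and \<rho>: "0 < \<rho>"
    and B: "\<And>c. norm c \<le> \<rho> \<Longrightarrow> norm (g (x + cvec m c)) \<le> B"
  shows "norm (partial_deriv (cvec m 1) g x) \<le> B / \<rho>"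
proof -
  have in': "x + cvec m c \<in> W \<times> UNIV" for c using x by (auto simp: mem_Times_iff)
  define F where "F = (\<lambda>c. g (x + cvec m c))"
  have F: "(F has_field_derivative partial_deriv (cvec m 1) g (x + cvec m c)) (at c)" for c
    unfolding F_def by (rule has_derivative_cvec_line[OF g in'])
  hence hol: "F holomorphic_on S" for S
    unfolding holomorphic_on_def field_differentiable_def using has_field_derivative_at_within by blast
  have "norm ((deriv ^^ 1) F 0) \<le> fact 1 * B / \<rho> ^ 1"
    using hol \<rho> B
    by (intro Cauchy_inequality holomorphic_on_imp_continuous_on) (auto simp: F_def)
  moreover have "deriv F 0 = partial_deriv (cvec m 1) g x"
    using DERIV_imp_deriv[OF F, of 0] by simp
  ultimately show ?thesis by simp
qed

text \<open>Each derivative uses a disc of radius \<rho> in its own complex direction, and the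
  displacements add up; hence the bound on g is required at distance up to the number of derivatives
  times \<rho>.\<close>

lemma cauchy_iterate:
  assumes W: "open W" and g: "smooth_hol W g" and x: "x \<in> W \<times> UNIV" and \<rho>: "0 < \<rho>"
    and B: "\<And>z. norm z \<le> real (length ms) * \<rho> \<Longrightarrow> fst z = 0 \<Longrightarrow> norm (g (x + z)) \<le> B"
  shows "norm (iter_deriv (map (\<lambda>m. cvec m 1) ms) g x) \<le> B / \<rho> ^ length ms"
  using x B
proof (induction ms arbitrary: x)
  case Nil
  thus ?case using Nil(2)[of 0] by simp
next
  case (Cons m ms)
  have "norm (partial_deriv (cvec m 1) (iter_deriv (map (\<lambda>m. cvec m 1) ms) g) x) \<le> (B / \<rho> ^ length ms) / \<rho>"
  proof (rule cauchy_step[OF smooth_hol_iter_deriv[OF W g] Cons.prems(1) \<rho>])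
    fix c :: complex assume c: "norm c \<le> \<rho>"
    show "norm (iter_deriv (map (\<lambda>m. cvec m 1) ms) g (x + cvec m c)) \<le> B / \<rho> ^ length ms"
    proof (rule Cons.IH)
      show "x + cvec m c \<in> W \<times> UNIV" using Cons.prems(1) by (auto simp: mem_Times_iff)
      fix z :: "'a \<times> complex \<times> (complex ^ 'b)" assume z: "norm z \<le> real (length ms) * \<rho>" "fst z = 0"
      have "norm (cvec m c + z) \<le> real (length (m # ms)) * \<rho>"
        using norm_triangle_ineq[of "cvec m c" z] z(1) c by (simp add: norm_cvec distrib_right)
      from Cons.prems(2)[OF this] z(2) show "norm (g (x + cvec m c + z)) \<le> B"
        by (simp add: add.assoc)
    qed
  qed (use cvec_Basis in auto)
  thus ?case by (simp add: mult.commute)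
qed

text \<open>Translates between derivatives on the product space, which can be reordered, and
  derivatives of slices, in which the bound of the class is expressed.\<close>

lemma iter_deriv_slice:
  assumes W: "open W" and g: "smooth_hol W g" and "set bs \<subseteq> Basis" "y \<in> W"
  shows "iter_deriv (map (\<lambda>b. (b, 0)) bs) g (y, z) = iter_deriv bs (\<lambda>y. g (y, z)) y"
  using assms(3,4)
proof (induction bs arbitrary: y)
  case (Cons b bs)
  have sm: "smooth_hol W (iter_deriv (map (\<lambda>b. (b, 0)) bs) g)"
    using Cons.prems by (intro smooth_hol_iter_deriv[OF W g]) (auto simp: Basis_prod_def)
  have "((\<lambda>y. (y, z)) has_derivative (\<lambda>h. (h, 0))) (at y)"
    by (auto intro!: derivative_eq_intros)
  from has_derivative_compose[OF this has_derivative_partial_deriv[OF smooth_hol_differentiable[OF sm]]] Cons.prems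
  have "((\<lambda>y. iter_deriv (map (\<lambda>b. (b, 0)) bs) g (y, z)) has_derivative
      (\<lambda>h. partial_deriv (h, 0) (iter_deriv (map (\<lambda>b. (b, 0)) bs) g) (y, z))) (at y)" by auto
  from partial_deriv_at[OF this, of b]
  have "iter_deriv (map (\<lambda>b. (b, 0)) (b # bs)) g (y, z) = partial_deriv b (\<lambda>y. iter_deriv (map (\<lambda>b. (b, 0)) bs) g (y, z)) y"
    by simp
  also have "\<dots> = partial_deriv b (iter_deriv bs (\<lambda>y. g (y, z))) y"
    using Cons by (intro partial_deriv_cong_open[OF W]) auto
  finally show ?case by simp
qed simp

text \<open>Along a complex line the real derivative of f and multiplication by its complex
  derivative are derivatives of the same function, so they agree by uniqueness. This gives the
  Cauchy-Riemann equations and identifies \<open>zeta_deriv\<close>.\<close>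

lemma smooth_hol_CM_holomorphic:
  assumes "CM_holomorphic M f W UNIV"
  shows "smooth_hol W f"
    and "y \<in> W \<Longrightarrow> zeta_deriv j f (y, z0, z) = partial_deriv (cvec (Some j) 1) f (y, z0, z)"
proof -
  have Ck: "Ck_on k f (W \<times> UNIV)" for k using assms by (auto simp: CM_holomorphic_def smooth_on_def)
  have hol: "\<exists>d. \<forall>h. partial_deriv (cvec m h) f (y, z0, z) = h * d" 
    and zd: "zeta_deriv j f (y, z0, z) = partial_deriv (cvec (Some j) 1) f (y, z0, z)"
    if y: "y \<in> W" for y z0 z m j
  proof -
    have hp: "holomorphic_at_params (\<lambda>z. f (y, z)) (z0, z)" using assms y by (auto simp: CM_holomorphic_def)
    have d: "f differentiable (at (y, z0, z))"
      using Ck[of 1] y by (simp only: One_nat_def Ck_on.simps) blast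
    have 1: "\<exists>d. \<forall>h. partial_deriv (cvec None h) f (y, z0, z) = h * d"
    proof -
      obtain d' where d': "((\<lambda>w. f (y, w, z)) has_field_derivative d') (at z0)"
        using hp by (auto simp: holomorphic_at_params_def field_differentiable_def)
      have "((\<lambda>w. (y, w, z)) has_derivative cvec None) (at z0)"
        by (auto intro!: derivative_eq_intros simp: cvec_def)
      from has_derivative_compose[OF this has_derivative_partial_deriv[OF d]]
      have "(\<lambda>h. partial_deriv (cvec None h) f (y, z0, z)) = (*) d'"
        using d' has_derivative_unique unfolding has_field_derivative_def by blast
      thus ?thesis by (auto simp: fun_eq_iff mult.commute)
    qed
    have 2: "partial_deriv (cvec (Some j) h) f (y, z0, z) = h * zeta_deriv j f (y, z0, z)" for j h
    proof -
      have "(\<lambda>w. f (y, z0, vec_upd z j w)) field_differentiable (at (z $ j))"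
        using hp by (auto simp: holomorphic_at_params_def)
      hence d': "((\<lambda>w. f (y, z0, vec_upd z j w)) has_field_derivative zeta_deriv j f (y, z0, z)) (at (z $ j))"
        unfolding zeta_deriv_def by (simp add: field_differentiable_derivI)
      have eq: "(y, z0, vec_upd z j w) = (y, z0, z) + cvec (Some j) (w - z $ j)" for w
        by (auto simp: cvec_def vec_upd_def vec_eq_iff axis_def)
      have "bounded_linear (cvec (Some j) :: complex \<Rightarrow> 'a \<times> (complex \<times> (complex ^ 'b)))"
        using linear_cvec by (rule linear_conv_bounded_linear[THEN iffD1])
      hence "((\<lambda>w. (y, z0, z) + cvec (Some j) (w - z $ j)) has_derivative (\<lambda>h. cvec (Some j) h)) (at (z $ j))"
        by (auto intro!: derivative_eq_intros bounded_linear.has_derivative[of "cvec (Some j)"])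
      hence "((\<lambda>w. (y, z0, vec_upd z j w)) has_derivative (\<lambda>h. cvec (Some j) h)) (at (z $ j))"
        by (simp only: eq)
      moreover have "(y, z0, vec_upd z j (z $ j)) = (y, z0, z)"
        by (simp add: vec_upd_def vec_eq_iff)
      ultimately have "((\<lambda>w. f (y, z0, vec_upd z j w)) has_derivative (\<lambda>h. partial_deriv (cvec (Some j) h) f (y, z0, z))) (at (z $ j))"
        using has_derivative_compose[of "\<lambda>w. (y, z0, vec_upd z j w)" "cvec (Some j)" "z $ j" UNIV f]
          has_derivative_partial_deriv[OF d] by simp
      hence "(\<lambda>h. partial_deriv (cvec (Some j) h) f (y, z0, z)) = (*) (zeta_deriv j f (y, z0, z))"
        using d' has_derivative_unique unfolding has_field_derivative_def by blast
      thus ?thesis by (simp add: fun_eq_iff mult.commute)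
    qed
    show "\<exists>d. \<forall>h. partial_deriv (cvec m h) f (y, z0, z) = h * d" using 1 2 by (cases m) auto
    show "zeta_deriv j f (y, z0, z) = partial_deriv (cvec (Some j) 1) f (y, z0, z)" using 2[of j 1] by simp
  qed
  have "partial_deriv (cvec m \<i>) f x = \<i> * partial_deriv (cvec m 1) f x" if "x \<in> W \<times> UNIV" for x m
  proof -
    obtain y z0 z where x: "x = (y, z0, z)" "y \<in> W" using \<open>x \<in> W \<times> UNIV\<close> by (cases x) auto
    show ?thesis using hol[OF x(2), of m z0 z] x(1) by auto
  qed
  thus "smooth_hol W f" unfolding smooth_hol_def using Ck by blast
  show "y \<in> W \<Longrightarrow> zeta_deriv j f (y, z0, z) = partial_deriv (cvec (Some j) 1) f (y, z0, z)" by (rule zd)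
qed

fun letter_vec :: "('a::euclidean_space, 'n::finite option) letter \<Rightarrow> 'a \<times> (complex \<times> (complex ^ 'n))" where
  "letter_vec (LY b) = (b, 0)"
| "letter_vec (LV m) = cvec m 1"
| "letter_vec _ = 0"

lemma letter_vec_Basis: "l \<in> letters0 \<Longrightarrow> letter_vec l \<in> Basis"
  by (auto simp: letters0_def cvec_Basis) (auto simp: Basis_prod_def)

lemma power_self_le_exp_fact: "real n ^ n \<le> exp 1 ^ n * fact n"
  using power_mult_exp_minus_le[of 1 "real n" n]
  by (simp add: exp_minus field_simps flip: exp_of_nat_mult)

text \<open>The class bounds only derivatives in the base variables. Each of the n parameter
  derivatives is paid for by Cauchy's inequality, in total e^n n!, and the factorial is absorbed by
  \<open>regular_sequence_fact_mult_le\<close>.\<close>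

lemma CM_holomorphic_bound:
  assumes M: "regular_sequence M" and W: "open W" and f: "CM_holomorphic M f W UNIV"
    and K: "compact K" "K \<subseteq> W \<times> UNIV"
  obtains C R where "0 \<le> C" "0 \<le> R"
    "\<And>x w. x \<in> K \<Longrightarrow> w \<in> lists letters0 \<Longrightarrow> norm (iter_deriv (map letter_vec w) f x) \<le> C * R ^ length w * M (length w)"
proof -
  have sf: "smooth_hol W f" using smooth_hol_CM_holomorphic[OF f] by blast
  \<comment> \<open>Room for the Cauchy discs: K is thickened by 1 in the parameters only, whose
    domain is the whole space.\<close>
  define K1 where "K1 = {x + z |x z. x \<in> K \<and> z \<in> {0::'a} \<times> cball (0 :: complex \<times> (complex ^ 'b)) 1}"
  have "compact K1" unfolding K1_def by (intro compact_sums K compact_Times) auto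
  moreover have "K1 \<subseteq> W \<times> UNIV" using K by (force simp: K1_def)
  ultimately obtain A where A: "0 < A" "\<And>bs y z. set bs \<subseteq> Basis \<Longrightarrow> (y, z) \<in> K1 \<Longrightarrow>
      norm (iter_deriv bs (\<lambda>y. f (y, z)) y) \<le> A ^ (length bs + 1) * M (length bs)"
  proof -
    assume that: "\<And>A. 0 < A \<Longrightarrow> (\<And>bs y z. set bs \<subseteq> Basis \<Longrightarrow> (y, z) \<in> K1 \<Longrightarrow>
      norm (iter_deriv bs (\<lambda>y. f (y, z)) y) \<le> A ^ (length bs + 1) * M (length bs)) \<Longrightarrow> thesis"
    assume "compact K1" "K1 \<subseteq> W \<times> UNIV"
    then obtain A where "A > 0" "\<forall>bs. set bs \<subseteq> Basis \<longrightarrow> (\<forall>(y, z)\<in>K1.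
        norm (iter_deriv bs (\<lambda>y. f (y, z)) y) \<le> A ^ (length bs + 1) * M (length bs))"
      using f unfolding CM_holomorphic_def by blast
    thus thesis by (intro that[of A]) auto
  qed
  \<comment> \<open>Dominates both growth rates: A for the base derivatives and e for the parameter
    derivatives.\<close>
  define R where "R = max 1 A * exp 1"
  have R: "1 \<le> R" "A \<le> R" "exp 1 \<le> R"
  proof -
    have e: "1 \<le> exp (1::real)" by simp
    show "1 \<le> R" "A \<le> R" "exp 1 \<le> R" unfolding R_def
      using mult_mono[of 1 "max 1 A" 1 "exp 1"] mult_mono[of A "max 1 A" 1 "exp 1"] mult_mono[of 1 "max 1 A" "exp 1" "exp 1"] e A(1) by auto
  qed
  show ?thesis
  proof (rule that[of A R])
    fix x :: "'a \<times> complex \<times> (complex ^ 'b)" and w :: "('a, 'b option) letter list"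
    assume x: "x \<in> K" and w: "w \<in> lists letters0"
    \<comment> \<open>A zero base component singles out the parameter directions, since vectors of
      the base \<open>Basis\<close> are non-zero.\<close>
    define V where "V = (\<lambda>b :: 'a \<times> complex \<times> (complex ^ 'b). fst b = 0)"
    define bs where "bs = map letter_vec w"
    have bs: "set bs \<subseteq> Basis" using w letter_vec_Basis unfolding bs_def set_map in_lists_conv_set by blast
    have ex: "\<exists>ms ys. filter V bs = map (\<lambda>m. cvec m 1) ms \<and> filter (\<lambda>b. \<not> V b) bs = map (\<lambda>b. (b, 0)) ys \<and> set ys \<subseteq> Basis"
      using w unfolding bs_def
    proof (induction w)
      case (Cons l w)
      then obtain ms ys where IH: "filter V (map letter_vec w) = map (\<lambda>m. cvec m 1) ms"
        "filter (\<lambda>b. \<not> V b) (map letter_vec w) = map (\<lambda>b. (b, 0)) ys" "set ys \<subseteq> Basis" by auto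
      have "l \<in> letters0" using Cons by auto
      then consider b where "l = LY b" "b \<in> Basis" | m where "l = LV m" by (auto simp: letters0_def)
      thus ?case
      proof cases
        case 1
        thus ?thesis using IH nonzero_Basis[of b] by (intro exI[of _ ms] exI[of _ "b # ys"]) (auto simp: V_def)
      next
        case 2
        thus ?thesis using IH by (intro exI[of _ "m # ms"] exI[of _ ys]) (auto simp: V_def)
      qed
    qed simp
    then obtain ms ys where ms: "filter V bs = map (\<lambda>m. cvec m 1) ms"
      and ys: "filter (\<lambda>b. \<not> V b) bs = map (\<lambda>b. (b, 0)) ys" "set ys \<subseteq> Basis" by blast
    have len: "length w = length ms + length ys"
      using sum_length_filter_compl[of V bs] unfolding ms ys by (simp add: bs_def)
    have xW: "x \<in> W \<times> UNIV" using x K by auto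
    define n where "n = length ms"
    define a where "a = length ys"
    define G where "G = iter_deriv (map (\<lambda>b. (b, 0 :: complex \<times> (complex ^ 'b))) ys) f"
    have sG: "smooth_hol W G" unfolding G_def
      using ys(2) by (intro smooth_hol_iter_deriv[OF W sf]) (auto simp: Basis_prod_def)
    have Mp: "0 < M i" for i by (rule regular_sequence_pos[OF M])
    have GB: "norm (G (x + z)) \<le> A ^ (a + 1) * M a" if z: "norm z \<le> 1" "fst z = 0" for z
    proof -
      have "x + z \<in> K1"
      proof -
        have "z \<in> {0} \<times> cball 0 1" using z by (cases z) (auto simp: norm_Pair)
        thus ?thesis using x unfolding K1_def by blast
      qed
      moreover have "fst (x + z) \<in> W" using xW z by auto
      ultimately show ?thesis
        using A(2)[OF ys(2), of "fst (x + z)" "snd (x + z)"] iter_deriv_slice[OF W sf ys(2), of "fst (x + z)" "snd (x + z)"]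
        unfolding prod.collapse by (simp add: G_def a_def del: fst_add snd_add)
    qed
    have "iter_deriv bs f x = iter_deriv (map (\<lambda>m. cvec m 1) ms) G x"
      using iter_deriv_sort[OF W sf bs xW, of V] by (simp add: ms ys iter_deriv_append G_def)
    also have "norm \<dots> \<le> (A ^ (a + 1) * M a) * (exp 1 ^ n * fact n)"
    proof (cases "n = 0")
      case True
      thus ?thesis using GB[of 0] by (simp add: n_def)
    next
      case False
      \<comment> \<open>Discs of radius 1/n keep the total displacement of n steps within 1, at the
        price n^n \<le> e^n n!.\<close>
      have "norm (iter_deriv (map (\<lambda>m. cvec m 1) ms) G x) \<le> (A ^ (a + 1) * M a) / (1 / real n) ^ length ms"
      proof (rule cauchy_iterate[OF W sG xW])
        show "norm (G (x + z)) \<le> A ^ (a + 1) * M a"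
          if "norm z \<le> real (length ms) * (1 / real n)" "fst z = 0" for z
          using that False by (intro GB) (simp_all add: n_def)
      qed (use False in simp)
      also have "\<dots> = (A ^ (a + 1) * M a) * real n ^ n" by (simp add: n_def power_divide)
      also have "\<dots> \<le> (A ^ (a + 1) * M a) * (exp 1 ^ n * fact n)"
        using A(1) Mp[of a] by (intro mult_left_mono power_self_le_exp_fact) auto
      finally show ?thesis .
    qed
    also have "\<dots> = A * (A ^ a * exp 1 ^ n) * (fact n * M a)" by simp
    also have "\<dots> \<le> A * (R ^ a * R ^ n) * M (n + a)"
      using A(1) R Mp less_imp_le[OF Mp] by (intro mult_mono power_mono regular_sequence_fact_mult_le[OF M]) auto
    finally show "norm (iter_deriv (map letter_vec w) f x) \<le> A * R ^ length w * M (length w)"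
      by (simp add: bs_def len n_def a_def power_add mult_ac add.commute)
  qed (use A R in auto)
qed


section \<open>Restriction to the graph of the unknowns\<close>

definition graph_pt :: "('n::finite option \<Rightarrow> 'a::euclidean_space \<Rightarrow> complex) \<Rightarrow> 'a \<Rightarrow> 'a \<times> (complex \<times> (complex ^ 'n))" where
  "graph_pt v y = (y, 0) + (\<Sum>m\<in>UNIV. cvec m (v m y))"

lemma sum_option: "(\<Sum>m\<in>UNIV. g m) = g None + (\<Sum>j\<in>(UNIV :: 'n::finite set). g (Some j))"
  by (simp add: UNIV_option_conv sum.reindex)

lemma graph_pt_eq: "graph_pt v y = (y, v None y, \<chi> j. v (Some j) y)"
proof -
  have "(\<Sum>j\<in>(UNIV :: 'b set). cvec (Some j) (V j)) = (0 :: 'a, 0, \<chi> j. V j)" for V :: "'b \<Rightarrow> complex"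
  proof -
    have "(\<Sum>j\<in>(UNIV :: 'b set). (0 :: 'a, 0 :: complex, axis j (V j))) = (0, 0, \<Sum>j\<in>UNIV. axis j (V j))"
      by (simp add: prod_eq_iff fst_sum snd_sum)
    moreover have "(\<Sum>j\<in>(UNIV :: 'b set). axis j (V j)) = (\<chi> j. V j)"
      by (simp add: vec_eq_iff axis_def)
    ultimately show ?thesis by (simp add: cvec_def)
  qed
  thus ?thesis by (simp add: graph_pt_def sum_option) (simp add: cvec_def)
qed

lemma bounded_linear_cvec: "bounded_linear (cvec m)"
  using linear_cvec by (rule linear_conv_bounded_linear[THEN iffD1])

text \<open>Holomorphy removes the conjugate derivatives from the chain rule: a complex-valued
  unknown contributes through a single complex derivative. Writing the graph point as a sum of
  vectors \<open>cvec\<close> makes this a consequence of linearity.\<close>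

lemma smooth_hol_graph:
  assumes W: "open W" and g: "smooth_hol W g" and v: "\<And>m. Ck_on 1 (v m) W"
  shows "Ck_on 1 (\<lambda>y. g (graph_pt v y)) W"
    and "y \<in> W \<Longrightarrow> partial_deriv c (\<lambda>y. g (graph_pt v y)) y =
      partial_deriv (c, 0) g (graph_pt v y) + (\<Sum>m\<in>UNIV. partial_deriv c (v m) y * partial_deriv (cvec m 1) g (graph_pt v y))"
proof -
  have dv: "v m differentiable (at y)" if "y \<in> W" for y m
    using v[of m] that by simp
  have gW: "graph_pt v y \<in> W \<times> UNIV" if "y \<in> W" for y
    using that by (simp add: graph_pt_eq)
  have d: "((\<lambda>y. g (graph_pt v y)) has_derivative (\<lambda>h. partial_deriv (h, 0) g (graph_pt v y) +
      (\<Sum>m\<in>UNIV. partial_deriv h (v m) y * partial_deriv (cvec m 1) g (graph_pt v y)))) (at y)" if y: "y \<in> W" for y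
  proof -
    note lin = partial_deriv_linear[OF smooth_hol_differentiable[OF g gW[OF y]]]
    have "(graph_pt v has_derivative (\<lambda>h. (h, 0) + (\<Sum>m\<in>UNIV. cvec m (partial_deriv h (v m) y)))) (at y)"
      unfolding graph_pt_def[abs_def]
      by (intro has_derivative_add has_derivative_sum has_derivative_Pair has_derivative_ident has_derivative_const
          bounded_linear.has_derivative[OF bounded_linear_cvec] has_derivative_partial_deriv dv[OF y])
    from has_derivative_compose[OF this has_derivative_partial_deriv[OF smooth_hol_differentiable[OF g gW[OF y]]]]
    have "((\<lambda>y. g (graph_pt v y)) has_derivative
        (\<lambda>h. partial_deriv ((h, 0) + (\<Sum>m\<in>UNIV. cvec m (partial_deriv h (v m) y))) g (graph_pt v y))) (at y)" .
    moreover have "partial_deriv ((h, 0) + (\<Sum>m\<in>UNIV. cvec m (partial_deriv h (v m) y))) g (graph_pt v y) =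
        partial_deriv (h, 0) g (graph_pt v y) + (\<Sum>m\<in>UNIV. partial_deriv h (v m) y * partial_deriv (cvec m 1) g (graph_pt v y))" for h
      unfolding linear_add[OF lin] linear_sum[OF lin] using smooth_hol_cvec[OF g gW[OF y]] by metis
    ultimately show ?thesis by simp
  qed
  show p: "partial_deriv c (\<lambda>y. g (graph_pt v y)) y =
      partial_deriv (c, 0) g (graph_pt v y) + (\<Sum>m\<in>UNIV. partial_deriv c (v m) y * partial_deriv (cvec m 1) g (graph_pt v y))"
    if "y \<in> W" for y c
    by (rule partial_deriv_at[OF d[OF that]])
  have cg: "continuous_on W (graph_pt v)"
    unfolding graph_pt_def[abs_def] using Ck_on_continuous[OF v]
    by (intro continuous_intros bounded_linear.continuous_on[OF bounded_linear_cvec])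
  have cp: "continuous_on W (\<lambda>y. partial_deriv b g (graph_pt v y))" if b: "b \<in> Basis" for b
  proof (rule continuous_on_compose2[OF _ cg])
    have "Ck_on 1 g (W \<times> UNIV)" using g by (simp add: smooth_hol_def del: Ck_on.simps One_nat_def)
    thus "continuous_on (W \<times> UNIV) (partial_deriv b g)" using b by simp
  qed (use gW in blast)
  have cv: "continuous_on W (partial_deriv c (v m))" if "c \<in> Basis" for c m
    using v[of m] that by simp
  have "continuous_on W (partial_deriv c (\<lambda>y. g (graph_pt v y)))" if c: "c \<in> Basis" for c
  proof -
    have "(c, 0) \<in> (Basis :: ('a \<times> (complex \<times> (complex ^ 'b))) set)" using c by (simp add: Basis_prod_def)
    hence "continuous_on W (\<lambda>y. partial_deriv (c, 0) g (graph_pt v y) +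
        (\<Sum>m\<in>UNIV. partial_deriv c (v m) y * partial_deriv (cvec m 1) g (graph_pt v y)))"
      by (intro continuous_intros cp cvec_Basis cv c)
    thus ?thesis using p by (simp cong: continuous_on_cong)
  qed
  moreover have "(\<lambda>y. g (graph_pt v y)) differentiable (at y)" if "y \<in> W" for y
    using d[OF that] unfolding differentiable_def by blast
  ultimately show "Ck_on 1 (\<lambda>y. g (graph_pt v y)) W" by simp
qed

text \<open>The reversal reconciles two conventions: a jet word begins with the derivation applied
  first, the list of \<open>iter_deriv\<close> with the one applied last. The value 0 off
  \<open>letters0\<close> expresses that f does not involve the additional variables.\<close>

definition jfun :: "('a::euclidean_space \<times> (complex \<times> (complex ^ 'n)) \<Rightarrow> complex) \<Rightarrow>
    ('n::finite option \<Rightarrow> 'a \<Rightarrow> complex) \<Rightarrow> 'a \<Rightarrow> ('a, 'n option) letter jet" where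
  "jfun f v y w = (if w \<in> lists letters0 then iter_deriv (rev (map letter_vec w)) f (graph_pt v y) else 0)"

text \<open>Because of the reversal, appending a letter to a word differentiates the corresponding
  entry once more from outside, so the claim is the chain rule of \<open>smooth_hol_graph\<close>
  for that entry.\<close>

lemma graph_jet_jfun:
  assumes W: "open W" and f: "smooth_hol W f" and v: "\<And>m. Ck_on 1 (v m) W"
  shows "graph_jet W v (jfun f v)"
  unfolding graph_jet_def
proof (intro conjI ballI allI impI)
  fix c :: 'a assume c: "c \<in> Basis"
  show "jcompat (pder_rel W c) letters (tcoef v c) (jfun f v)"
    unfolding jcompat_def
  proof
    fix w :: "('a, 'b option) letter list" assume "w \<in> lists letters"
    show "pder_rel W c (\<lambda>y. jfun f v y w) (\<lambda>y. \<Sum>l\<in>letters. tcoef v c l y * jfun f v y (w @ [l]))"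
    proof (cases "w \<in> lists letters0")
      case False
      thus ?thesis by (simp add: jfun_def pder_rel_def partial_deriv_const del: Ck_on.simps One_nat_def)
    next
      case True
      define g where "g = iter_deriv (rev (map letter_vec w)) f"
      have g: "smooth_hol W g" unfolding g_def using True letter_vec_Basis
        by (intro smooth_hol_iter_deriv[OF W f]) (force simp: in_lists_conv_set)
      have w: "jfun f v y w = g (graph_pt v y)" for y using True by (simp add: jfun_def g_def)
      have wl: "jfun f v y (w @ [l]) = partial_deriv (letter_vec l) g (graph_pt v y)" if "l \<in> letters0" for y l
        using True that by (simp add: jfun_def g_def)
      have "(\<Sum>l\<in>letters. tcoef v c l y * jfun f v y (w @ [l])) = partial_deriv c (\<lambda>y. g (graph_pt v y)) y"
        if y: "y \<in> W" for y
      proof -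
        have "(\<Sum>l\<in>letters. tcoef v c l y * jfun f v y (w @ [l])) = (\<Sum>l\<in>letters0. tcoef v c l y * jfun f v y (w @ [l]))"
          by (intro sum_letters_eq_letters0) (auto simp: jfun_def)
        also have "\<dots> = (\<Sum>b\<in>Basis. (if b = c then partial_deriv (b, 0) g (graph_pt v y) else 0)) +
            (\<Sum>m\<in>UNIV. partial_deriv c (v m) y * partial_deriv (cvec m 1) g (graph_pt v y))"
          unfolding sum_letters0 by (intro arg_cong2[of _ _ _ _ "(+)"] sum.cong) (auto simp: wl tcoef_def)
        also have "\<dots> = partial_deriv c (\<lambda>y. g (graph_pt v y)) y"
          using c by (simp add: smooth_hol_graph(2)[OF W g v y])
        finally show ?thesis .
      qed
      thus ?thesis unfolding pder_rel_def w using smooth_hol_graph(1)[OF W g v] by simp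
    qed
  qed
qed (simp add: jfun_def)

lemma CM_jets_jfun:
  assumes M: "regular_sequence M" and W: "open W" and f: "CM_holomorphic M f W UNIV"
    and v: "\<And>m. continuous_on W (v m)" and K: "compact K" "K \<subseteq> W"
  shows "CM_jets M letters K (jfun f v)"
proof -
  have "continuous_on K (graph_pt v)"
    unfolding graph_pt_def[abs_def] using continuous_on_subset[OF v K(2)]
    by (intro continuous_intros bounded_linear.continuous_on[OF bounded_linear_cvec])
  hence "compact (graph_pt v ` K)" using K(1) by (rule compact_continuous_image)
  moreover have "graph_pt v ` K \<subseteq> W \<times> UNIV" using K(2) by (auto simp: graph_pt_eq)
  ultimately show ?thesis
  proof (rule CM_holomorphic_bound[OF M W f])
    fix C R :: real
    assume CR: "0 \<le> C" "0 \<le> R" "\<And>x w. x \<in> graph_pt v ` K \<Longrightarrow> w \<in> lists letters0 \<Longrightarrow>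
      norm (iter_deriv (map letter_vec w) f x) \<le> C * R ^ length w * M (length w)"
    show ?thesis
    proof (rule CM_jetsI[OF M CR(1,2)])
      fix y assume y: "y \<in> K"
      show "jbound M letters 0 C R (jfun f v y)"
        unfolding jbound_def
      proof
        fix w :: "('a, 'b option) letter list"
        show "norm (jfun f v y w) \<le> C * R ^ length w * M (0 + length w)"
        proof (cases "w \<in> lists letters0")
          case True
          hence "rev w \<in> lists letters0" by auto
          from CR(3)[OF imageI[OF y] this] True show ?thesis by (simp add: jfun_def rev_map)
        next
          case False
          thus ?thesis using CR(1,2) regular_sequence_pos[OF M, of "length w"] by (simp add: jfun_def)
        qed
      qed
    qed
  qed
qed

section \<open>The wave-front set of a solution\<close>

lemma sum_Basis_vec_real: "(\<Sum>b\<in>(Basis :: (real ^ 'n) set). g b) = (\<Sum>j\<in>UNIV. g (axis j 1))"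
proof -
  have 1: "(Basis :: (real ^ 'n) set) = range (\<lambda>j. axis j 1)" by (auto simp: Basis_vec_def)
  have 2: "inj (\<lambda>j :: 'n. axis j (1::real))" by (auto simp: inj_on_def axis_eq_axis)
  show ?thesis by (simp only: 1 sum.reindex[OF 2] o_def)
qed

lemma sum_Basis_space_time:
  fixes g :: "(real ^ 'n) \<times> real \<Rightarrow> 'b::comm_monoid_add"
  shows "(\<Sum>b\<in>Basis. g b) = (\<Sum>j\<in>UNIV. g (axis j 1, 0)) + g (0, 1)"
proof -
  have "(\<Sum>b\<in>Basis. g b) = sum g ((\<lambda>u. (u, 0)) ` Basis) + sum g (Pair 0 ` Basis)"
    unfolding Basis_prod_def by (intro sum.union_disjoint) auto
  thus ?thesis by (simp add: sum.reindex inj_on_def sum_Basis_vec_real)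
qed

definition unknowns :: "((real ^ 'n) \<times> real \<Rightarrow> complex) \<Rightarrow> 'n option \<Rightarrow> (real ^ 'n) \<times> real \<Rightarrow> complex" where
  "unknowns u m = (case m of None \<Rightarrow> u | Some j \<Rightarrow> partial_deriv (axis j 1, 0) u)"

lemma unknowns_simps:
  "unknowns u None = u" "unknowns u (Some j) = partial_deriv (axis j 1, 0) u"
  by (simp_all add: unknowns_def)

text \<open>The coefficients of \<open>L\<^sup>u\<close>, and the right hand sides of the equations \<open>L\<^sup>u u = \<dots>\<close> and
  \<open>L\<^sup>u u\<^bsub>x\<^sub>i\<^esub> = \<dots>\<close> obtained by differentiating the nonlinear equation.\<close>

definition lin_coef :: "(((real ^ 'n) \<times> real) \<times> (complex \<times> (complex ^ 'n)) \<Rightarrow> complex) \<Rightarrow>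
    ((real ^ 'n) \<times> real \<Rightarrow> complex) \<Rightarrow> (real ^ 'n) \<times> real \<Rightarrow> (real ^ 'n) \<times> real \<Rightarrow>
    ((real ^ 'n) \<times> real, 'n option) letter jet" where
  "lin_coef f u b y = (\<lambda>w. jconst (of_real (snd b)) w +
     - (\<Sum>k\<in>UNIV. jmul (jconst (of_real (fst b $ k))) (jderiv (LV (Some k)) (jfun f (unknowns u) y)) w))"

definition lin_rhs :: "(((real ^ 'n) \<times> real) \<times> (complex \<times> (complex ^ 'n)) \<Rightarrow> complex) \<Rightarrow>
    ((real ^ 'n) \<times> real \<Rightarrow> complex) \<Rightarrow> 'n option \<Rightarrow> (real ^ 'n) \<times> real \<Rightarrow>
    ((real ^ 'n) \<times> real, 'n option) letter jet" where
  "lin_rhs f u m y = (case m of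
     None \<Rightarrow> (\<lambda>w. jfun f (unknowns u) y w + - (\<Sum>k\<in>UNIV.
       jmul (jcoord (LV (Some k)) (unknowns u (Some k) y)) (jderiv (LV (Some k)) (jfun f (unknowns u) y)) w))
   | Some i \<Rightarrow> (\<lambda>w. jderiv (LY (axis i 1, 0)) (jfun f (unknowns u) y) w +
       jmul (jcoord (LV (Some i)) (unknowns u (Some i) y)) (jderiv (LV None) (jfun f (unknowns u) y)) w))"

lemma space_time_Basis: "((axis j 1, 0) :: (real ^ 'n) \<times> real) \<in> Basis" "((0, 1) :: (real ^ 'n) \<times> real) \<in> Basis"
  by (auto simp: Basis_prod_def Basis_vec_def)

text \<open>Differentiating u_t = f along x_i produces second derivatives only in the combination
  \<Sum>_k f_(\<zeta>_k) \<partial>_k u_(x_i). Moved to the left, this is the principal part of L on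
  u_(x_i); so u and all u_(x_i) share the same operator, and the right sides are free of second
  derivatives.\<close>

lemma quasilinear_solution:
  fixes f :: "((real ^ 'n) \<times> real) \<times> (complex \<times> (complex ^ 'n)) \<Rightarrow> complex"
  assumes M: "regular_sequence M" and W: "open W" and f: "CM_holomorphic M f W UNIV"
    and u: "Ck_on 2 u W" and pde: "\<And>p. p \<in> W \<Longrightarrow> t_deriv u p = f (p, u p, x_grad u p)"
  shows "quasilinear M W (unknowns u) (lin_coef f u) (lin_rhs f u)"
    and "p \<in> W \<Longrightarrow> lin_coef f u b p [] = of_real (snd b) -
      (\<Sum>j\<in>UNIV. zeta_deriv j f (p, u p, x_grad u p) * of_real (fst b $ j))"
proof -
  let ?v = "unknowns u" and ?J = "jfun f (unknowns u)"
  have LY: "(LY (axis i 1, 0) :: ((real ^ 'n) \<times> real, 'n option) letter) \<in> letters0"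
    "(LY (axis i 1, 0) :: ((real ^ 'n) \<times> real, 'n option) letter) \<in> letters" for i
    by (rule letters_intros space_time_Basis)+
  have sf: "smooth_hol W f" by (rule smooth_hol_CM_holomorphic(1)[OF f])
  have u2: "Ck_on (Suc 1) u W" using u by (simp add: numeral_2_eq_2 del: Ck_on.simps)
  have du: "Ck_on 1 (partial_deriv b u) W" if "b \<in> Basis" for b
    using u2 that unfolding Ck_on.simps(2) by blast
  have v: "Ck_on 1 (?v m) W" for m
    using Ck_on_SucD[OF u2] du[OF space_time_Basis(1)]
    by (cases m) (simp_all add: unknowns_simps del: Ck_on.simps One_nat_def)
  have gJ: "graph_jet W ?v ?J" by (rule graph_jet_jfun[OF W sf v])
  have gV: "graph_jet W ?v (\<lambda>y. jcoord (LV m) (?v m y))" for m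
    by (rule graph_jet_jcoord_LV[OF W v])
  have cJ: "CM_jets M letters K ?J" if "compact K" "K \<subseteq> W" for K
    by (rule CM_jets_jfun[OF M W f Ck_on_continuous[OF v] that])
  have g: "graph_pt ?v p = (p, u p, x_grad u p)" for p
    by (simp add: graph_pt_eq unknowns_simps x_grad_def)
  have J0: "?J p [] = f (graph_pt ?v p)" for p by (simp add: jfun_def)
  have J1: "?J p [l] = partial_deriv (letter_vec l) f (graph_pt ?v p)" if "l \<in> letters0" for p l
    using that by (simp add: jfun_def)
  have zeta: "zeta_deriv j f (p, u p, x_grad u p) = ?J p [LV (Some j)]" if "p \<in> W" for p j
    using smooth_hol_CM_holomorphic(2)[OF f that] by (simp add: J1 g)
  have coef0: "lin_coef f u b p [] = of_real (snd b) - (\<Sum>k\<in>UNIV. of_real (fst b $ k) * ?J p [LV (Some k)])" for b p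
    by (simp add: lin_coef_def jconst_def)
  show "p \<in> W \<Longrightarrow> lin_coef f u b p [] = of_real (snd b) -
      (\<Sum>j\<in>UNIV. zeta_deriv j f (p, u p, x_grad u p) * of_real (fst b $ j))"
    by (simp add: coef0 zeta mult.commute)
  have L: "vfield (\<lambda>b y. lin_coef f u b y []) \<phi> y = partial_deriv (0, 1) \<phi> y -
      (\<Sum>k\<in>UNIV. ?J y [LV (Some k)] * partial_deriv (axis k 1, 0) \<phi> y)" for \<phi> y
  proof -
    have "lin_coef f u (axis j 1, 0) y [] = - ?J y [LV (Some j)]" for j
    proof -
      have "(\<Sum>k\<in>UNIV. complex_of_real (axis j 1 $ k) * ?J y [LV (Some k)]) = (\<Sum>k\<in>UNIV. if k = j then ?J y [LV (Some k)] else 0)"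
        by (intro sum.cong) (auto simp: axis_def)
      thus ?thesis by (simp add: coef0)
    qed
    moreover have "lin_coef f u (0, 1) y [] = 1" by (simp add: coef0)
    ultimately show ?thesis by (simp add: vfield_def sum_Basis_space_time sum_negf)
  qed
  show "quasilinear M W ?v (lin_coef f u) (lin_rhs f u)"
  proof
    show "regular_sequence M" "open W" by fact+
    show "Ck_on 1 (?v m) W" for m by (rule v)
    show "graph_jet W ?v (lin_coef f u b)" for b
      unfolding lin_coef_def[abs_def] using W
      by (intro graph_jet_add graph_jet_uminus graph_jet_sum graph_jet_jmul graph_jet_jconst graph_jet_jderiv gJ) auto
    show "graph_jet W ?v (lin_rhs f u m)" for m
      unfolding lin_rhs_def[abs_def] using W LY
      by (cases m) (simp_all only: option.case, intro graph_jet_add graph_jet_uminus graph_jet_sum graph_jet_jmul gV graph_jet_jderiv gJ; auto)+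
    fix K :: "((real ^ 'n) \<times> real) set" assume K: "compact K" "K \<subseteq> W"
    have cC: "CM_jets M (letters :: ((real ^ 'n) \<times> real, 'n option) letter set) K (\<lambda>y. jconst z)" for z
      by (rule CM_jets_jconst[OF M order_refl])
    show "CM_jets M letters K (lin_coef f u b)" for b
      unfolding lin_coef_def[abs_def]
      by (intro CM_jets_add CM_jets_uminus CM_jets_sum CM_jets_jmul CM_jets_jderiv cJ cC K M) auto
    have cV: "CM_jets M letters K (\<lambda>y. jcoord (LV m :: ((real ^ 'n) \<times> real, 'n option) letter) (?v m y))" for m
      using continuous_on_subset[OF Ck_on_continuous[OF v] K(2)] by (rule CM_jets_jcoord_continuous[OF M K(1)])
    show "CM_jets M letters K (lin_rhs f u m)" for m
      unfolding lin_rhs_def[abs_def] using LY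
      by (cases m) (simp_all only: option.case, intro CM_jets_add CM_jets_uminus CM_jets_sum CM_jets_jmul CM_jets_jderiv cJ K M cV; auto)+
  next
    fix m y assume y: "y \<in> W"
    show "vfield (\<lambda>b y. lin_coef f u b y []) (?v m) y = lin_rhs f u m y []"
    proof (cases m)
      case None
      have "partial_deriv (0, 1) u y = ?J y []"
        using pde[OF y] by (simp add: t_deriv_def J0 g)
      thus ?thesis unfolding L None by (simp add: lin_rhs_def unknowns_simps jcoord_def mult.commute)
    next
      case (Some i)
      let ?e = "\<lambda>k :: 'n. (axis k 1, 0) :: (real ^ 'n) \<times> real"
      \<comment> \<open>Symmetry of second derivatives is used twice: here, to turn \<partial>_t
        u_(x_i) into the x_i-derivative of f, and below, so that the derivatives of u_(x_k) along
        x_i become derivatives of u_(x_i) along x_k.\<close>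
      have "partial_deriv (0, 1) (partial_deriv (?e i) u) y = partial_deriv (?e i) (partial_deriv (0, 1) u) y"
        by (rule partial_deriv_commute[OF W y u space_time_Basis])
      also have "\<dots> = partial_deriv (?e i) (\<lambda>y. f (graph_pt ?v y)) y"
        using pde by (intro partial_deriv_cong_open[OF W y]) (simp add: t_deriv_def g)
      also have "\<dots> = ?J y [LY (?e i)] + (\<Sum>m\<in>UNIV. partial_deriv (?e i) (?v m) y * ?J y [LV m])"
        using smooth_hol_graph(2)[OF W sf v y] by (simp add: J1 space_time_Basis)
      also have "\<dots> = ?J y [LY (?e i)] + partial_deriv (?e i) u y * ?J y [LV None] +
          (\<Sum>k\<in>UNIV. partial_deriv (?e i) (partial_deriv (?e k) u) y * ?J y [LV (Some k)])"
        by (simp add: sum_option unknowns_simps)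
      also have "(\<Sum>k\<in>UNIV. partial_deriv (?e i) (partial_deriv (?e k) u) y * ?J y [LV (Some k)]) =
          (\<Sum>k\<in>UNIV. ?J y [LV (Some k)] * partial_deriv (?e k) (partial_deriv (?e i) u) y)"
        by (intro sum.cong refl) (simp add: partial_deriv_commute[OF W y u space_time_Basis(1) space_time_Basis(1)])
      finally show ?thesis unfolding L Some by (simp add: lin_rhs_def unknowns_simps jcoord_def)
    qed
  qed
qed

theorem theorem4p5:
  fixes M :: "nat \<Rightarrow> real"
    and \<Omega>' :: "(real ^ 'n) set" and I :: "real set" and \<Omega> :: "((real ^ 'n) \<times> real) set"
    and f :: "((real ^ 'n) \<times> real) \<times> (complex \<times> (complex ^ 'n)) \<Rightarrow> complex"
    and u :: "(real ^ 'n) \<times> real \<Rightarrow> complex"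
  assumes "regular_sequence M"
    and "open \<Omega>'" and "open I" and "is_interval I" and "\<Omega> = \<Omega>' \<times> I" and "0 \<in> \<Omega>"
    and "CM_holomorphic M f \<Omega> UNIV"
    and "Ck_on 2 u \<Omega>"
    and "\<forall>p\<in>\<Omega>. t_deriv u p = f (p, u p, x_grad u p)"
  shows "WF M \<Omega> (distr_of_fun \<Omega> u) \<subseteq> Char_linearized \<Omega> f u"
proof
  fix P assume P: "P \<in> WF M \<Omega> (distr_of_fun \<Omega> u)"
  obtain p \<xi> \<tau> where P_eq: "P = (p, (\<xi>, \<tau>))" by (metis prod.collapse)
  have p: "p \<in> \<Omega>" "(\<xi>, \<tau>) \<noteq> 0" and sing: "\<not> CM_regular_direction M \<Omega> (distr_of_fun \<Omega> u) p (\<xi>, \<tau>)"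
    using P by (auto simp: WF_def P_eq)
  have W: "open \<Omega>" using assms by (simp add: open_Times)
  have pde: "t_deriv u p = f (p, u p, x_grad u p)" if "p \<in> \<Omega>" for p using assms(9) that by blast
  interpret quasilinear M \<Omega> "unknowns u" "lin_coef f u" "lin_rhs f u"
    by (rule quasilinear_solution(1)[OF assms(1) W assms(7,8) pde])
  have coef: "lin_coef f u b p [] = of_real (snd b) -
      (\<Sum>j\<in>UNIV. zeta_deriv j f (p, u p, x_grad u p) * of_real (fst b $ j))" for b
    by (rule quasilinear_solution(2)[OF assms(1) W assms(7,8) pde p(1)])
  have "complex_of_real \<tau> - (\<Sum>j\<in>UNIV. zeta_deriv j f (p, u p, x_grad u p) * complex_of_real (\<xi> $ j)) = 0"
  proof (rule ccontr)
    assume nc: "complex_of_real \<tau> - (\<Sum>j\<in>UNIV. zeta_deriv j f (p, u p, x_grad u p) * complex_of_real (\<xi> $ j)) \<noteq> 0"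
    have "lin_coef f u (axis j 1, 0) p [] = - zeta_deriv j f (p, u p, x_grad u p)" for j
    proof -
      have "(\<Sum>k\<in>UNIV. zeta_deriv k f (p, u p, x_grad u p) * complex_of_real (axis j 1 $ k)) =
          (\<Sum>k\<in>UNIV. if k = j then zeta_deriv k f (p, u p, x_grad u p) else 0)"
        by (intro sum.cong) (auto simp: axis_def)
      thus ?thesis by (simp add: coef)
    qed
    moreover have "lin_coef f u (0, 1) p [] = 1" by (simp add: coef)
    ultimately have "(\<Sum>b\<in>Basis. lin_coef f u b p [] * of_real ((\<xi>, \<tau>) \<bullet> b)) =
        complex_of_real \<tau> - (\<Sum>j\<in>UNIV. zeta_deriv j f (p, u p, x_grad u p) * complex_of_real (\<xi> $ j))"
      by (simp add: sum_Basis_space_time sum_negf inner_axis)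
    \<comment> \<open>The regularity result concerns any unknown of the system; the component
      \<open>None\<close> is u itself.\<close>
    hence "CM_regular_direction M \<Omega> (distr_of_fun \<Omega> (unknowns u None)) p (\<xi>, \<tau>)"
      using nc by (intro CM_regular_direction_solution p) simp
    thus False using sing by (simp add: unknowns_simps)
  qed
  thus "P \<in> Char_linearized \<Omega> f u" using p by (simp add: Char_linearized_def P_eq)
qed

end
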